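(* Let $1<p<2$, let $p'$ be defined by $1/p+1/p'=1$, put $\theta:=2/p'$, and let $F$ be a $\theta$-type $2$ space. Then $$\mathcal{L}(\ell_1,F)=\Pi_{\mathcal{R},p}(\ell_1,F).$$
   Context: All Banach spaces are over $\mathbb{C}$. $\mathcal{L}(E,F)$ denotes the bounded linear operators $E\to F$; $E'$ is the dual of $E$ and $B_E$ its closed unit ball. For $0<\theta<1$ and an interpolation couple $[F_0,F_1]$ of Banach spaces, $[F_0,F_1]_\theta$ denotes the complex (Calderón) interpolation space. A Banach space $F$ is a $\theta$-type $2$ space if there is an interpolation couple $[F_0,F_1]$ such that $F_1$ has (Rademacher) type $2$ and $F=[F_0,F_1]_\theta$. For $1\le p\le 2$, $T\in\mathcal{L}(X,Y)$ is Rademacher $p$-summing, $T\in\Pi_{\mathcal{R},p}(X,Y)$, if there is a constant $c>0$ such that for all finite sequences $x_1,\dots,x_n$ in $X$ $$\Big(\int_0^1\Big\|\sum_{i=1}^n r_i(t)\,Tx_i\Big\|^2dt\Big)^{1/2}\le c\cdot\sup_{x'\in B_{X'}}\Big(\sum_{i=1}^n|\langle x',x_i\rangle|^p\Big)^{1/p},$$ where $(r_i)_i$ is the sequence of Rademacher functions on $[0,1]$. *)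

theory Defs
  imports "HOL-Analysis.Analysis" "HOL-Library.Function_Algebras"
begin

section \<open>Complex vector spaces\<close>

class complex_vector = ab_group_add +
  fixes scaleC :: "complex \<Rightarrow> 'a \<Rightarrow> 'a"  (infixr \<open>*\<^sub>C\<close> 75)
  assumes scaleC_add_right: "c *\<^sub>C (x + y) = c *\<^sub>C x + c *\<^sub>C y"
    and scaleC_add_left: "(c + d) *\<^sub>C x = c *\<^sub>C x + d *\<^sub>C x"
    and scaleC_scaleC: "c *\<^sub>C d *\<^sub>C x = (c * d) *\<^sub>C x"
    and scaleC_one: "1 *\<^sub>C x = x"

global_interpretation complex_vector:
  vector_space "scaleC :: complex \<Rightarrow> 'a \<Rightarrow> 'a :: complex_vector"
  by unfold_locales (fact scaleC_add_right scaleC_add_left scaleC_scaleC scaleC_one)+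

instantiation complex :: complex_vector
begin
definition scaleC_complex :: "complex \<Rightarrow> complex \<Rightarrow> complex"
  where "scaleC_complex c x = c * x"
instance by standard (simp_all add: scaleC_complex_def algebra_simps)
end

instantiation "fun" :: (type, complex_vector) complex_vector
begin
definition scaleC_fun :: "complex \<Rightarrow> ('a \<Rightarrow> 'b) \<Rightarrow> 'a \<Rightarrow> 'b"
  where "scaleC_fun c f = (\<lambda>x. c *\<^sub>C f x)"
instance
  by standard (simp_all add: scaleC_fun_def fun_eq_iff scaleC_add_right scaleC_add_left
      scaleC_scaleC scaleC_one)
end


section \<open>Banach spaces\<close>

text \<open>
  Interpolation theory works with several Banach spaces inside one vector space, so a normed
  space is given by a linear subspace of an ambient complex vector space and a norm on it.
  The values of \<open>nrm\<close> outside the carrier are irrelevant.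
\<close>

record 'v normed =
  car :: "'v set"
  nrm :: "'v \<Rightarrow> real"

text \<open>The case distinction makes this a metric in the sense of the locale \<^locale>\<open>Metric_space\<close>,
  which requires nonnegativity and symmetry also outside the carrier.\<close>

definition norm_dist :: "'v::complex_vector normed \<Rightarrow> 'v \<Rightarrow> 'v \<Rightarrow> real" where
  "norm_dist E x y = (if x \<in> car E \<and> y \<in> car E then nrm E (x - y) else 0)"

definition norm_topology :: "'v::complex_vector normed \<Rightarrow> 'v topology" where
  "norm_topology E = Metric_space.mtopology (car E) (norm_dist E)"

definition normed_space :: "'v::complex_vector normed \<Rightarrow> bool" where
  "normed_space E \<longleftrightarrow>
     complex_vector.subspace (car E) \<and>
     (\<forall>x\<in>car E. nrm E x = 0 \<longrightarrow> x = 0) \<and>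
     (\<forall>c. \<forall>x\<in>car E. nrm E (c *\<^sub>C x) = cmod c * nrm E x) \<and>
     (\<forall>x\<in>car E. \<forall>y\<in>car E. nrm E (x + y) \<le> nrm E x + nrm E y)"

lemma normed_space_nrm_nonneg:
  assumes "normed_space E" "x \<in> car E"
  shows "0 \<le> nrm E x"
proof -
  have sub: "complex_vector.subspace (car E)"
    and hom: "\<And>c. nrm E (c *\<^sub>C x) = cmod c * nrm E x"
    and tri: "\<And>y. y \<in> car E \<Longrightarrow> nrm E (x + y) \<le> nrm E x + nrm E y"
    using assms unfolding normed_space_def by blast+
  have "nrm E (x + (-1) *\<^sub>C x) \<le> nrm E x + nrm E ((-1) *\<^sub>C x)"
    using tri complex_vector.subspace_scale[OF sub assms(2)] by blast
  moreover have "x + (-1) *\<^sub>C x = 0 *\<^sub>C x"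
    by (simp add: complex_vector.scale_minus_left scaleC_one)
  ultimately show ?thesis
    using hom[of "-1"] hom[of 0] by simp
qed

lemma Metric_space_norm_dist:
  assumes "normed_space E"
  shows "Metric_space (car E) (norm_dist E)"
proof
  have sub: "complex_vector.subspace (car E)"
    and def0: "\<And>x. x \<in> car E \<Longrightarrow> nrm E x = 0 \<Longrightarrow> x = 0"
    and hom: "\<And>c x. x \<in> car E \<Longrightarrow> nrm E (c *\<^sub>C x) = cmod c * nrm E x"
    and tri: "\<And>x y. x \<in> car E \<Longrightarrow> y \<in> car E \<Longrightarrow> nrm E (x + y) \<le> nrm E x + nrm E y"
    using assms unfolding normed_space_def by blast+
  note diff = complex_vector.subspace_diff[OF sub]
  have zero: "nrm E 0 = 0"
    using hom[of 0 0] complex_vector.subspace_0[OF sub] by simp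
  have commute: "nrm E (x - y) = nrm E (y - x)" if "x \<in> car E" "y \<in> car E" for x y
  proof -
    have "(-1) *\<^sub>C (x - y) = y - x"
      by (simp only: complex_vector.scale_minus_left scaleC_one minus_diff_eq)
    then show ?thesis using hom[OF diff[OF that], of "-1"] by simp
  qed
  show "0 \<le> norm_dist E x y" for x y
    unfolding norm_dist_def by (simp add: normed_space_nrm_nonneg[OF assms] diff)
  show "norm_dist E x y = norm_dist E y x" for x y
    unfolding norm_dist_def using commute[of x y] by presburger
  show "norm_dist E x y = 0 \<longleftrightarrow> x = y" if "x \<in> car E" "y \<in> car E" for x y
    using that def0[OF diff[OF that]] zero by (auto simp: norm_dist_def)
  show "norm_dist E x z \<le> norm_dist E x y + norm_dist E y z"
    if "x \<in> car E" "y \<in> car E" "z \<in> car E" for x y z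
    using that tri[OF diff[OF that(1,2)] diff[OF that(2,3)]] by (simp add: norm_dist_def)
qed

definition banach_space :: "'v::complex_vector normed \<Rightarrow> bool" where
  "banach_space E \<longleftrightarrow> normed_space E \<and> Metric_space.mcomplete (car E) (norm_dist E)"

definition ell1 :: "(nat \<Rightarrow> complex) normed" where
  "ell1 = \<lparr>car = {x. summable (\<lambda>k. cmod (x k))}, nrm = (\<lambda>x. \<Sum>k. cmod (x k))\<rparr>"

definition scalars :: "complex normed" where
  "scalars = \<lparr>car = UNIV, nrm = cmod\<rparr>"


section \<open>Bounded operators and duality\<close>

text \<open>Operators are extensional functions on the carrier, so that distinct functions are
  distinct operators.\<close>

definition bounded_operators ::
  "'a::complex_vector normed \<Rightarrow> 'b::complex_vector normed \<Rightarrow> ('a \<Rightarrow> 'b) set" where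
  "bounded_operators E F =
     {T \<in> car E \<rightarrow>\<^sub>E car F.
        (\<forall>x\<in>car E. \<forall>y\<in>car E. T (x + y) = T x + T y) \<and>
        (\<forall>c. \<forall>x\<in>car E. T (c *\<^sub>C x) = c *\<^sub>C T x) \<and>
        (\<exists>C. \<forall>x\<in>car E. nrm F (T x) \<le> C * nrm E x)}"

definition operator_norm ::
  "'a::complex_vector normed \<Rightarrow> 'b::complex_vector normed \<Rightarrow> ('a \<Rightarrow> 'b) \<Rightarrow> real" where
  "operator_norm E F T = (SUP x\<in>{x \<in> car E. nrm E x \<le> 1}. nrm F (T x))"

definition dual_ball :: "'a::complex_vector normed \<Rightarrow> ('a \<Rightarrow> complex) set" where
  "dual_ball E = {\<phi> \<in> bounded_operators E scalars. operator_norm E scalars \<phi> \<le> 1}"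


section \<open>Complex interpolation\<close>

definition hausdorff_vector_topology :: "'v::complex_vector topology \<Rightarrow> bool" where
  "hausdorff_vector_topology \<T> \<longleftrightarrow>
     topspace \<T> = UNIV \<and> Hausdorff_space \<T> \<and>
     continuous_map (prod_topology \<T> \<T>) \<T> (\<lambda>(x, y). x + y) \<and>
     continuous_map (prod_topology euclidean \<T>) \<T> (\<lambda>(c, x). c *\<^sub>C x)"

definition interpolation_couple ::
  "'v::complex_vector normed \<Rightarrow> 'v normed \<Rightarrow> bool" where
  "interpolation_couple F0 F1 \<longleftrightarrow>
     banach_space F0 \<and> banach_space F1 \<and>
     (\<exists>\<T>. hausdorff_vector_topology \<T> \<and>
        continuous_map (norm_topology F0) \<T> id \<and>
        continuous_map (norm_topology F1) \<T> id)"

definition sum_space :: "'v::complex_vector normed \<Rightarrow> 'v normed \<Rightarrow> 'v normed" where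
  "sum_space F0 F1 =
     \<lparr>car = {a + b | a b. a \<in> car F0 \<and> b \<in> car F1},
      nrm = (\<lambda>x. Inf {nrm F0 a + nrm F1 b | a b. a \<in> car F0 \<and> b \<in> car F1 \<and> x = a + b})\<rparr>"

definition strip :: "complex set" where
  "strip = {z. 0 \<le> Re z \<and> Re z \<le> 1}"

definition open_strip :: "complex set" where
  "open_strip = {z. 0 < Re z \<and> Re z < 1}"

text \<open>
  Calderon's space of functions on the closed strip: bounded and continuous into
  \<open>F0 + F1\<close>, analytic in the interior, and on the lines \<open>Re z = 0\<close> and \<open>Re z = 1\<close> continuous
  into \<open>F0\<close> and \<open>F1\<close>, respectively, and vanishing at infinity.  The values outside the strip
  are irrelevant.
\<close>

definition calderon_functions ::
  "'v::complex_vector normed \<Rightarrow> 'v normed \<Rightarrow> (complex \<Rightarrow> 'v) set" where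
  "calderon_functions F0 F1 =
     {f. continuous_map (top_of_set strip) (norm_topology (sum_space F0 F1)) f \<and>
         (\<exists>B. \<forall>z\<in>strip. nrm (sum_space F0 F1) (f z) \<le> B) \<and>
         (\<forall>z\<in>open_strip. \<exists>d.
            limitin (norm_topology (sum_space F0 F1))
              (\<lambda>w. inverse (w - z) *\<^sub>C (f w - f z)) d (at z)) \<and>
         continuous_map euclidean (norm_topology F0) (\<lambda>t::real. f (Complex 0 t)) \<and>
         ((\<lambda>t::real. nrm F0 (f (Complex 0 t))) \<longlongrightarrow> 0) at_infinity \<and>
         continuous_map euclidean (norm_topology F1) (\<lambda>t::real. f (Complex 1 t)) \<and>
         ((\<lambda>t::real. nrm F1 (f (Complex 1 t))) \<longlongrightarrow> 0) at_infinity}"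

definition calderon_norm ::
  "'v::complex_vector normed \<Rightarrow> 'v normed \<Rightarrow> (complex \<Rightarrow> 'v) \<Rightarrow> real" where
  "calderon_norm F0 F1 f =
     max (SUP t::real. nrm F0 (f (Complex 0 t))) (SUP t::real. nrm F1 (f (Complex 1 t)))"

definition complex_interpolation ::
  "'v::complex_vector normed \<Rightarrow> 'v normed \<Rightarrow> real \<Rightarrow> 'v normed" where
  "complex_interpolation F0 F1 \<theta> =
     \<lparr>car = {f (of_real \<theta>) | f. f \<in> calderon_functions F0 F1},
      nrm = (\<lambda>x. Inf {calderon_norm F0 F1 f | f.
                        f \<in> calderon_functions F0 F1 \<and> f (of_real \<theta>) = x})\<rparr>"


section \<open>Rademacher type and Rademacher summing operators\<close>

definition rademacher :: "nat \<Rightarrow> real \<Rightarrow> real" where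
  "rademacher i t = sgn (sin (2 ^ i * pi * t))"

definition rademacher_average :: "'v::complex_vector normed \<Rightarrow> nat \<Rightarrow> (nat \<Rightarrow> 'v) \<Rightarrow> real" where
  "rademacher_average E n x =
     sqrt (LINT t:{0..1}|lborel. (nrm E (\<Sum>i=1..n. of_real (rademacher i t) *\<^sub>C x i))\<^sup>2)"

definition type_2 :: "'v::complex_vector normed \<Rightarrow> bool" where
  "type_2 E \<longleftrightarrow>
     (\<exists>c>0. \<forall>n x. (\<forall>i\<in>{1..n}. x i \<in> car E) \<longrightarrow>
        rademacher_average E n x \<le> c * sqrt (\<Sum>i=1..n. (nrm E (x i))\<^sup>2))"

text \<open>Equality with the interpolation space is equality of carriers and of norms.\<close>

definition theta_type_2 :: "real \<Rightarrow> 'v::complex_vector normed \<Rightarrow> bool" where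
  "theta_type_2 \<theta> F \<longleftrightarrow>
     banach_space F \<and>
     (\<exists>F0 F1. interpolation_couple F0 F1 \<and> type_2 F1 \<and>
        car F = car (complex_interpolation F0 F1 \<theta>) \<and>
        (\<forall>x\<in>car F. nrm F x = nrm (complex_interpolation F0 F1 \<theta>) x))"

definition weak_norm :: "real \<Rightarrow> 'a::complex_vector normed \<Rightarrow> nat \<Rightarrow> (nat \<Rightarrow> 'a) \<Rightarrow> real" where
  "weak_norm p E n x = (SUP \<phi>\<in>dual_ball E. (\<Sum>i=1..n. cmod (\<phi> (x i)) powr p) powr (1 / p))"

definition rademacher_summing ::
  "real \<Rightarrow> 'a::complex_vector normed \<Rightarrow> 'b::complex_vector normed \<Rightarrow> ('a \<Rightarrow> 'b) set" where
  "rademacher_summing p E F =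
     {T \<in> bounded_operators E F.
        \<exists>c>0. \<forall>n x. (\<forall>i\<in>{1..n}. x i \<in> car E) \<longrightarrow>
          rademacher_average F n (\<lambda>i. T (x i)) \<le> c * weak_norm p E n x}"

end

theory Submission
  imports Defs "HOL-Probability.Probability"
begin

text \<open>
  Only the inclusion of the bounded operators in the Rademacher \<open>p\<close>-summing ones needs an
  argument.  Let \<open>T\<close> map \<open>\<ell>\<^sub>1\<close> boundedly into \<open>F = [F\<^sub>0, F\<^sub>1]\<^sub>\<theta>\<close> and let \<open>x\<^sub>1, \<dots>, x\<^sub>n\<close> be finitely
  supported elements of \<open>\<ell>\<^sub>1\<close> with weak \<open>p\<close>-norm at most one.  The matrix of coordinates
  \<open>x\<^sub>i(k)\<close> is then a bilinear form of norm at most one on \<open>\<ell>\<^sub>\<infinity> \<times> \<ell>\<^sub>r\<close> with \<open>r = p' = 2 / \<theta>\<close>.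
  Grothendieck's inequality holds for such forms (\<open>grothendieck_inequality\<close>), and as \<open>r > 2\<close>, a
  minimax argument turns it into a factorization (\<open>maurey_factorization\<close>)
  \<open>x\<^sub>i(k) = \<surd>u\<^sub>k \<cdot> w\<^sub>k\<^sub>i \<cdot> a\<^sub>i\<close>, where \<open>a\<^sub>i\<close> is \<open>t\<^sub>i\<close> to the power \<open>(1 - \<theta>) / 2\<close>, the families \<open>u\<close> and \<open>t\<close> are
  positive with sums at most two, and the matrix \<open>w\<close> has norm at most 96 on Hilbert space.

  This form can be interpolated.  Replace the exponent \<open>(1 - \<theta>) / 2\<close> by \<open>(1 - z) / 2\<close> and the
  images \<open>T e\<^sub>k\<close> of the unit vectors by functions \<open>f\<^sub>k\<close> of the Calderon space with
  \<open>f\<^sub>k(\<theta>) = T e\<^sub>k\<close>; this gives functions \<open>g\<^sub>i\<close> with \<open>g\<^sub>i(\<theta>) = T x\<^sub>i\<close>.  On the line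
  \<open>Re z = 0\<close> the exponent is one half, and the Cauchy-Schwarz inequality bounds every sum
  \<open>\<Sum> \<epsilon>\<^sub>i g\<^sub>i\<close> with signs in the norm of \<open>F\<^sub>0\<close>.  On the line \<open>Re z = 1\<close> the numbers \<open>t\<^sub>i\<close> contribute
  only factors of modulus one, and it remains to bound the average over the signs of the squared
  norm of \<open>\<Sum>\<^sub>i \<epsilon>\<^sub>i \<Sum>\<^sub>k w\<^sub>k\<^sub>i y\<^sub>k\<close> in \<open>F\<^sub>1\<close>, where \<open>\<Sum> \<parallel>y\<^sub>k\<parallel>\<^sup>2\<close> is bounded.  If \<open>w\<close> were the identity, this would be
  the definition of type 2.  In general one passes from signs to Gaussian variables, whose
  joint distribution is invariant under rotations, so that a contraction \<open>w\<close> can only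
  decrease the average (\<open>gauss_avg_contraction\<close>, \<open>type_2_contraction\<close>).

  The two estimates on the boundary are combined in \<open>interpolation_average_bound\<close>: for each
  choice of signs, \<open>\<Sum> \<epsilon>\<^sub>i g\<^sub>i\<close> is divided by the square root of an analytic function whose real part
  dominates the squared norms on the boundary (\<open>outer_majorant\<close>).  The value of that function at
  \<open>\<theta>\<close> is a fixed linear combination of boundary values with bounded total weight, hence its
  average over the signs is bounded.  Finitely supported sequences are dense in \<open>\<ell>\<^sub>1\<close>, which
  gives the general case.
\<close>

section \<open>Grothendieck's inequality\<close>


definition rademacher_sum :: "'a set \<Rightarrow> ('a \<Rightarrow> complex) \<Rightarrow> 'a set \<Rightarrow> complex" where
  "rademacher_sum D a A = (\<Sum>l\<in>D. if l \<in> A then a l else - a l)"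

lemma rademacher_sum_empty [simp]: "rademacher_sum {} a A = 0"
  by (simp add: rademacher_sum_def)

lemma rademacher_sum_insert:
  assumes "finite D" "j \<notin> D" "A \<subseteq> D"
  shows "rademacher_sum (insert j D) a A = rademacher_sum D a A - a j"
    and "rademacher_sum (insert j D) a (insert j A) = rademacher_sum D a A + a j"
proof -
  show "rademacher_sum (insert j D) a A = rademacher_sum D a A - a j"
    using assms by (auto simp: rademacher_sum_def)
  have "(\<Sum>l\<in>D. if l \<in> insert j A then a l else - a l) = (\<Sum>l\<in>D. if l \<in> A then a l else - a l)"
    using assms by (intro sum.cong) auto
  then show "rademacher_sum (insert j D) a (insert j A) = rademacher_sum D a A + a j"
    using assms by (simp add: rademacher_sum_def add.commute)
qed

lemma sum_Pow_insert:
  fixes \<Phi> :: "'a set \<Rightarrow> 'b::comm_monoid_add"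
  assumes "finite D" "j \<notin> D"
  shows "(\<Sum>A\<in>Pow (insert j D). \<Phi> A) = (\<Sum>A\<in>Pow D. \<Phi> A + \<Phi> (insert j A))"
proof -
  have inj: "inj_on (insert j) (Pow D)"
    using assms(2) by (intro inj_onI) (metis Diff_insert_absorb PowD in_mono)
  have "(\<Sum>A\<in>Pow (insert j D). \<Phi> A) = (\<Sum>A\<in>Pow D. \<Phi> A) + (\<Sum>A\<in>insert j ` Pow D. \<Phi> A)"
    unfolding Pow_insert using assms by (intro sum.union_disjoint) auto
  then show ?thesis
    by (simp add: sum.reindex[OF inj] sum.distrib)
qed

lemma rademacher_sum_mixed_moment:
  assumes "finite D"
  shows "(\<Sum>A\<in>Pow D. (v + rademacher_sum D a A) * (w + rademacher_sum D b A))
    = 2 ^ card D * (v * w + (\<Sum>l\<in>D. a l * b l))"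
  using assms
proof (induction D arbitrary: v w rule: finite_induct)
  case (insert j D)
  have "(\<Sum>A\<in>Pow (insert j D). (v + rademacher_sum (insert j D) a A) * (w + rademacher_sum (insert j D) b A))
      = (\<Sum>A\<in>Pow D. (v - a j + rademacher_sum D a A) * (w - b j + rademacher_sum D b A)
          + (v + a j + rademacher_sum D a A) * (w + b j + rademacher_sum D b A))"
    unfolding sum_Pow_insert[OF insert.hyps]
    by (intro sum.cong refl) (simp add: rademacher_sum_insert[OF insert.hyps] algebra_simps)
  also have "\<dots> = 2 ^ card (insert j D) * (v * w + (\<Sum>l\<in>insert j D. a l * b l))"
    using insert.hyps by (simp add: sum.distrib insert.IH) (simp add: algebra_simps)
  finally show ?case .
qed simp

lemma cmod_sq_pm:
  "(cmod (v - u))\<^sup>2 + (cmod (v + u))\<^sup>2 = 2 * ((cmod v)\<^sup>2 + (cmod u)\<^sup>2)"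
  unfolding cmod_power2 by (simp add: power2_eq_square algebra_simps)

lemma cmod_fourth_pm:
  "(cmod (v - u)) ^ 4 + (cmod (v + u)) ^ 4
    \<le> 2 * ((cmod v) ^ 4 + 6 * (cmod v)\<^sup>2 * (cmod u)\<^sup>2 + (cmod u) ^ 4)"
proof -
  define d where "d = Re (v * cnj u)"
  have e: "(cmod (v - u))\<^sup>2 = (cmod v)\<^sup>2 + (cmod u)\<^sup>2 - 2 * d"
    "(cmod (v + u))\<^sup>2 = (cmod v)\<^sup>2 + (cmod u)\<^sup>2 + 2 * d"
    unfolding cmod_power2 by (simp_all add: d_def power2_eq_square algebra_simps)
  have "\<bar>d\<bar> \<le> cmod v * cmod u"
    unfolding d_def by (metis abs_Re_le_cmod complex_mod_cnj norm_mult)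
  then have d2: "d\<^sup>2 \<le> (cmod v)\<^sup>2 * (cmod u)\<^sup>2"
    by (metis abs_ge_zero power2_abs power_mono power_mult_distrib)
  have four: "z ^ 4 = (z\<^sup>2)\<^sup>2" for z :: real by simp
  show ?thesis
    unfolding four e using d2 by (simp add: power2_eq_square algebra_simps)
qed

text \<open>
  The base point \<open>v\<close> is there for the induction: averaging over one more sign is
  \<open>cmod_fourth_pm\<close>, and the coefficients 6 and 3 reproduce themselves.
\<close>

lemma rademacher_sum_fourth_moment:
  assumes "finite D"
  shows "(\<Sum>A\<in>Pow D. (cmod (v + rademacher_sum D a A)) ^ 4)
    \<le> 2 ^ card D * ((cmod v) ^ 4 + 6 * (cmod v)\<^sup>2 * (\<Sum>l\<in>D. (cmod (a l))\<^sup>2)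
        + 3 * (\<Sum>l\<in>D. (cmod (a l))\<^sup>2)\<^sup>2)"
  using assms
proof (induction D arbitrary: v rule: finite_induct)
  case (insert j D)
  define s where "s = (\<Sum>l\<in>D. (cmod (a l))\<^sup>2)"
  have s0: "s \<ge> 0" unfolding s_def by (simp add: sum_nonneg)
  have "(\<Sum>A\<in>Pow (insert j D). (cmod (v + rademacher_sum (insert j D) a A)) ^ 4)
      = (\<Sum>A\<in>Pow D. (cmod (v - a j + rademacher_sum D a A)) ^ 4)
        + (\<Sum>A\<in>Pow D. (cmod (v + a j + rademacher_sum D a A)) ^ 4)"
    unfolding sum_Pow_insert[OF insert.hyps] sum.distrib[symmetric]
    by (intro sum.cong refl) (simp add: rademacher_sum_insert[OF insert.hyps] algebra_simps)
  also have "\<dots> \<le> 2 ^ card D * ((cmod (v - a j)) ^ 4 + 6 * (cmod (v - a j))\<^sup>2 * s + 3 * s\<^sup>2)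
      + 2 ^ card D * ((cmod (v + a j)) ^ 4 + 6 * (cmod (v + a j))\<^sup>2 * s + 3 * s\<^sup>2)"
    unfolding s_def by (intro add_mono insert.IH)
  also have "\<dots> = 2 ^ card D * (((cmod (v - a j)) ^ 4 + (cmod (v + a j)) ^ 4)
      + 6 * ((cmod (v - a j))\<^sup>2 + (cmod (v + a j))\<^sup>2) * s + 6 * s\<^sup>2)"
    by (simp add: algebra_simps)
  also have "\<dots> \<le> 2 ^ card D * (2 * ((cmod v) ^ 4 + 6 * (cmod v)\<^sup>2 * (cmod (a j))\<^sup>2 + (cmod (a j)) ^ 4)
      + 6 * (2 * ((cmod v)\<^sup>2 + (cmod (a j))\<^sup>2)) * s + 6 * s\<^sup>2)"
    unfolding cmod_sq_pm using cmod_fourth_pm[of v "a j"] by (intro mult_left_mono add_right_mono) auto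
  also have "\<dots> \<le> 2 ^ card (insert j D) * ((cmod v) ^ 4 + 6 * (cmod v)\<^sup>2 * ((cmod (a j))\<^sup>2 + s)
      + 3 * ((cmod (a j))\<^sup>2 + s)\<^sup>2)"
  proof -
    have "2 * (cmod (a j)) ^ 4 \<ge> 0" by simp
    then have "2 * ((cmod v) ^ 4 + 6 * (cmod v)\<^sup>2 * (cmod (a j))\<^sup>2 + (cmod (a j)) ^ 4)
      + 6 * (2 * ((cmod v)\<^sup>2 + (cmod (a j))\<^sup>2)) * s + 6 * s\<^sup>2
      \<le> 2 * ((cmod v) ^ 4 + 6 * (cmod v)\<^sup>2 * ((cmod (a j))\<^sup>2 + s)
      + 3 * ((cmod (a j))\<^sup>2 + s)\<^sup>2)"
      by (simp add: power2_eq_square power4_eq_xxxx algebra_simps)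
    then have "2 ^ card D * (2 * ((cmod v) ^ 4 + 6 * (cmod v)\<^sup>2 * (cmod (a j))\<^sup>2 + (cmod (a j)) ^ 4)
      + 6 * (2 * ((cmod v)\<^sup>2 + (cmod (a j))\<^sup>2)) * s + 6 * s\<^sup>2)
      \<le> 2 ^ card D * (2 * ((cmod v) ^ 4 + 6 * (cmod v)\<^sup>2 * ((cmod (a j))\<^sup>2 + s)
      + 3 * ((cmod (a j))\<^sup>2 + s)\<^sup>2))" by (intro mult_left_mono) auto
    then show ?thesis using insert.hyps by (simp add: mult.assoc)
  qed
  finally show ?case using insert.hyps by (simp add: s_def)
qed simp

lemma rademacher_sum_second_moment:
  assumes "finite D"
  shows "(\<Sum>A\<in>Pow D. (cmod (rademacher_sum D a A))\<^sup>2) = 2 ^ card D * (\<Sum>l\<in>D. (cmod (a l))\<^sup>2)"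
proof -
  have c: "rademacher_sum D (\<lambda>l. cnj (a l)) A = cnj (rademacher_sum D a A)" for A
    by (simp add: rademacher_sum_def if_distrib[of cnj] cong: if_cong)
  have "complex_of_real (\<Sum>A\<in>Pow D. (cmod (rademacher_sum D a A))\<^sup>2)
      = complex_of_real (2 ^ card D * (\<Sum>l\<in>D. (cmod (a l))\<^sup>2))"
    using rademacher_sum_mixed_moment[OF assms, of 0 a 0 "\<lambda>l. cnj (a l)"]
    by (simp add: c flip: complex_norm_square)
  then show ?thesis by (rule of_real_eq_iff[THEN iffD1])
qed

text \<open>
  Chebyshev's inequality against the fourth moment.  The cut at \<open>48 \<sigma>\<close> makes the \<open>L\<^sub>2\<close>-norm of the
  tail at most a quarter of that of the whole sum; this ratio is what lets the improvement of
  constants in Grothendieck's inequality contract.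
\<close>

lemma rademacher_sum_tail:
  fixes a :: "'a \<Rightarrow> complex"
  assumes "finite D"
  defines "\<sigma> \<equiv> (\<Sum>l\<in>D. (cmod (a l))\<^sup>2)"
  shows "(\<Sum>A\<in>Pow D. if (cmod (rademacher_sum D a A))\<^sup>2 \<le> 48 * \<sigma> then 0
            else (cmod (rademacher_sum D a A))\<^sup>2) \<le> 2 ^ card D * \<sigma> / 16"
    (is "?L \<le> _")
proof (cases "\<sigma> = 0")
  case True
  then have "(\<Sum>A\<in>Pow D. (cmod (rademacher_sum D a A))\<^sup>2) = 0"
    using rademacher_sum_second_moment[OF assms(1), of a] by (simp add: \<sigma>_def)
  moreover have "?L \<le> (\<Sum>A\<in>Pow D. (cmod (rademacher_sum D a A))\<^sup>2)"
    by (intro sum_mono) auto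
  ultimately show ?thesis using True by simp
next
  case False
  then have s0: "\<sigma> > 0"
    unfolding \<sigma>_def by (metis sum_nonneg zero_le_power2 less_eq_real_def)
  have "48 * \<sigma> * ?L \<le> (\<Sum>A\<in>Pow D. (cmod (0 + rademacher_sum D a A)) ^ 4)"
    unfolding sum_distrib_left
  proof (intro sum_mono)
    fix A
    have "48 * \<sigma> * z \<le> z\<^sup>2" if "\<not> z \<le> 48 * \<sigma>" "z \<ge> 0" for z :: real
      using that by (simp add: power2_eq_square mult_right_mono)
    from this[of "(cmod (rademacher_sum D a A))\<^sup>2"]
    show "48 * \<sigma> * (if (cmod (rademacher_sum D a A))\<^sup>2 \<le> 48 * \<sigma> then 0
            else (cmod (rademacher_sum D a A))\<^sup>2) \<le> (cmod (0 + rademacher_sum D a A)) ^ 4"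
      by auto
  qed
  also have "\<dots> \<le> 2 ^ card D * (3 * \<sigma>\<^sup>2)"
    using rademacher_sum_fourth_moment[OF assms(1), of 0 a] by (simp add: \<sigma>_def)
  finally have "\<sigma> * (48 * ?L) \<le> \<sigma> * (2 ^ card D * 3 * \<sigma>)"
    by (simp add: power2_eq_square algebra_simps)
  then have "48 * ?L \<le> 2 ^ card D * 3 * \<sigma>"
    using s0 by (rule mult_left_le_imp_le)
  then show ?thesis by (simp add: mult.commute)
qed

text \<open>
  The bilinear form with matrix \<open>x\<close> has norm at most one on \<open>\<ell>\<^sub>\<infinity>(K) \<times> \<ell>\<^sub>r(I)\<close>.
\<close>

definition scalar_bound :: "'k set \<Rightarrow> 'i set \<Rightarrow> real \<Rightarrow> ('k \<Rightarrow> 'i \<Rightarrow> complex) \<Rightarrow> bool" where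
  "scalar_bound K I r x \<longleftrightarrow>
    (\<forall>s b. (\<forall>k\<in>K. cmod (s k) \<le> 1) \<longrightarrow> (\<Sum>i\<in>I. cmod (b i) powr r) \<le> 1 \<longrightarrow>
      cmod (\<Sum>k\<in>K. \<Sum>i\<in>I. x k i * (s k * b i)) \<le> 1)"

text \<open>
  The same form, evaluated at families of vectors of a Hilbert space instead of scalars.  The finite
  sets \<open>D\<close> run through all finite dimensions.  The pairing of vectors is bilinear, without
  complex conjugation.
\<close>

definition hilbert_bound ::
  "'k set \<Rightarrow> 'i set \<Rightarrow> real \<Rightarrow> ('k \<Rightarrow> 'i \<Rightarrow> complex) \<Rightarrow> real \<Rightarrow> bool" where
  "hilbert_bound K I r x C \<longleftrightarrow>
    (\<forall>(D :: nat set) s b. finite D \<longrightarrow> (\<forall>k\<in>K. (\<Sum>l\<in>D. (cmod (s k l))\<^sup>2) \<le> 1) \<longrightarrow>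
      (\<Sum>i\<in>I. (\<Sum>l\<in>D. (cmod (b i l))\<^sup>2) powr (r / 2)) \<le> 1 \<longrightarrow>
      cmod (\<Sum>k\<in>K. \<Sum>i\<in>I. x k i * (\<Sum>l\<in>D. s k l * b i l)) \<le> C)"

text \<open>
  Vectors may have coordinates indexed by any finite set; random sums over signs are vectors
  indexed by the set of all choices of signs.
\<close>

lemma hilbert_boundD:
  fixes D :: "'d set"
  assumes "hilbert_bound K I r x C" "finite D"
    and s: "\<And>k. k \<in> K \<Longrightarrow> (\<Sum>l\<in>D. (cmod (s k l))\<^sup>2) \<le> 1"
    and b: "(\<Sum>i\<in>I. (\<Sum>l\<in>D. (cmod (b i l))\<^sup>2) powr (r / 2)) \<le> 1"
  shows "cmod (\<Sum>k\<in>K. \<Sum>i\<in>I. x k i * (\<Sum>l\<in>D. s k l * b i l)) \<le> C"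
proof -
  obtain h where h: "bij_betw h {..<card D} D"
    using ex_bij_betw_nat_finite[OF assms(2)] by (auto simp: atLeast0LessThan)
  have re: "(\<Sum>l\<in>D. f l) = (\<Sum>j<card D. f (h j))" for f :: "'d \<Rightarrow> 'e::comm_monoid_add"
    by (rule sum.reindex_bij_betw[OF h, symmetric])
  show ?thesis
    using assms(1)[unfolded hilbert_bound_def, rule_format, of "{..<card D}" "\<lambda>k j. s k (h j)" "\<lambda>i j. b i (h j)"]
      s b unfolding re by (simp add: re)
qed

text \<open>
  Replace the vectors \<open>s\<^sub>k\<close> and \<open>b\<^sub>i\<close> by the random sums of their coordinates with independent signs;
  the expectation of the product of two such sums is the pairing of the vectors.  Each sum is split
  into the part where its modulus is at most \<open>\<surd>48\<close> times its \<open>L\<^sub>2\<close>-norm, and a tail.  For the bounded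
  parts the scalar bound applies for every choice of signs and yields 48.  A tail is a vector in
  \<open>L\<^sub>2\<close> over the signs with a quarter of the norm, so a product with a tail is controlled by \<open>C / 4\<close>, using
  the given bound \<open>C\<close> itself.
\<close>

lemma hilbert_bound_improve:
  fixes x :: "'k \<Rightarrow> 'i \<Rightarrow> complex"
  assumes fin: "finite K" "finite I" and r: "r > 0"
    and x: "scalar_bound K I r x"
    and C: "hilbert_bound K I r x C"
  shows "hilbert_bound K I r x (48 + C / 2)"
  unfolding hilbert_bound_def
proof (intro allI impI)
  fix D :: "nat set" and s b
  assume D: "finite D" and s: "\<forall>k\<in>K. (\<Sum>l\<in>D. (cmod (s k l))\<^sup>2) \<le> 1"
    and b: "(\<Sum>i\<in>I. (\<Sum>l\<in>D. (cmod (b i l))\<^sup>2) powr (r / 2)) \<le> 1"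
  define N :: real where "N = 2 ^ card D"
  have N: "N > 0" by (simp add: N_def)
  define \<sigma> where "\<sigma> a = (\<Sum>l\<in>D. (cmod (a l))\<^sup>2)" for a
  have \<sigma>0: "\<sigma> a \<ge> 0" for a by (simp add: \<sigma>_def sum_nonneg)
  define S where "S a A = rademacher_sum D a A" for a A
  define S1 where "S1 a A = (if (cmod (S a A))\<^sup>2 \<le> 48 * \<sigma> a then S a A else 0)" for a A
  define S2 where "S2 a A = S a A - S1 a A" for a A
  define T where "T f g = (\<Sum>A\<in>Pow D. \<Sum>k\<in>K. \<Sum>i\<in>I. x k i * (f (s k) A * g (b i) A))" for f g
  have S1_le: "(cmod (S1 a A))\<^sup>2 \<le> 48 * \<sigma> a" for a A
    using \<sigma>0[of a] by (simp add: S1_def)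
  have S1_sq: "(\<Sum>A\<in>Pow D. (cmod (S1 a A))\<^sup>2) \<le> N * \<sigma> a" for a
  proof -
    have "(\<Sum>A\<in>Pow D. (cmod (S1 a A))\<^sup>2) \<le> (\<Sum>A\<in>Pow D. (cmod (S a A))\<^sup>2)"
      by (intro sum_mono) (simp add: S1_def)
    then show ?thesis
      using rademacher_sum_second_moment[OF D, of a] by (simp add: S_def N_def \<sigma>_def)
  qed
  have S_sq: "(\<Sum>A\<in>Pow D. (cmod (S a A))\<^sup>2) \<le> N * \<sigma> a" for a
    using rademacher_sum_second_moment[OF D, of a] by (simp add: S_def N_def \<sigma>_def)
  have S2_sq: "(\<Sum>A\<in>Pow D. (cmod (S2 a A))\<^sup>2) \<le> N * \<sigma> a / 16" for a
  proof -
    have "(\<Sum>A\<in>Pow D. (cmod (S2 a A))\<^sup>2) = (\<Sum>A\<in>Pow D. if (cmod (rademacher_sum D a A))\<^sup>2 \<le> 48 * \<sigma> a then 0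
            else (cmod (rademacher_sum D a A))\<^sup>2)"
      by (intro sum.cong refl) (simp add: S2_def S1_def S_def)
    then show ?thesis using rademacher_sum_tail[OF D, of a] by (simp add: N_def \<sigma>_def)
  qed
  have \<sigma>s: "\<sigma> (s k) \<le> 1" if "k \<in> K" for k using s that by (simp add: \<sigma>_def)
  have \<sigma>b: "(\<Sum>i\<in>I. \<sigma> (b i) powr (r / 2)) \<le> 1" using b by (simp add: \<sigma>_def)
  have Texp: "N * (\<Sum>k\<in>K. \<Sum>i\<in>I. x k i * (\<Sum>l\<in>D. s k l * b i l)) = T S S"
  proof -
    have "T S S = (\<Sum>k\<in>K. \<Sum>i\<in>I. x k i * (\<Sum>A\<in>Pow D. (0 + S (s k) A) * (0 + S (b i) A)))"
      unfolding T_def sum_distrib_left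
      by (subst sum.swap, intro sum.cong refl, subst sum.swap, simp)
    then show ?thesis
      unfolding S_def rademacher_sum_mixed_moment[OF D]
      by (simp add: N_def sum_distrib_left mult_ac)
  qed
  have "T S S = T S1 S1 + T S2 S1 + T S S2"
    unfolding T_def sum.distrib[symmetric] by (intro sum.cong refl) (simp add: S2_def algebra_simps)
  moreover have "cmod (T S1 S1) \<le> N * 48"
  proof -
    have "cmod (T S1 S1) \<le> (\<Sum>A\<in>Pow D. 48)"
      unfolding T_def
    proof (rule sum_norm_le)
      fix A
      define M where "M = sqrt 48"
      have M: "M > 0" "M * M = 48" by (simp_all add: M_def)
      have "cmod (\<Sum>k\<in>K. \<Sum>i\<in>I. x k i * ((S1 (s k) A / M) * (S1 (b i) A / M))) \<le> 1"
      proof (rule x[unfolded scalar_bound_def, rule_format])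
        show "cmod (S1 (s k) A / M) \<le> 1" if "k \<in> K" for k
        proof -
          have "(cmod (S1 (s k) A))\<^sup>2 \<le> M\<^sup>2"
            using S1_le[of "s k" A] \<sigma>s[OF that] M by (simp add: power2_eq_square)
          then have "cmod (S1 (s k) A) \<le> M" using M(1) by (simp add: power2_le_iff_abs_le)
          then show ?thesis using M(1) by (simp add: norm_divide)
        qed
        have "(\<Sum>i\<in>I. cmod (S1 (b i) A / M) powr r) \<le> (\<Sum>i\<in>I. \<sigma> (b i) powr (r / 2))"
        proof (rule sum_mono)
          fix i
          have "(cmod (S1 (b i) A))\<^sup>2 \<le> M\<^sup>2 * \<sigma> (b i)"
            using S1_le[of "b i" A] M by (simp add: power2_eq_square)
          then have "cmod (S1 (b i) A) \<le> M * sqrt (\<sigma> (b i))"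
            using M(1) by (metis real_le_rsqrt real_sqrt_mult real_sqrt_abs abs_of_pos)
          then have "cmod (S1 (b i) A / M) \<le> sqrt (\<sigma> (b i))"
            using M(1) by (simp add: norm_divide field_simps)
          then have "cmod (S1 (b i) A / M) powr r \<le> sqrt (\<sigma> (b i)) powr r"
            using r by (intro powr_mono2) auto
          also have "\<dots> = \<sigma> (b i) powr (r / 2)"
            using \<sigma>0[of "b i"] by (simp add: powr_half_sqrt[symmetric] powr_powr)
          finally show "cmod (S1 (b i) A / M) powr r \<le> \<sigma> (b i) powr (r / 2)" .
        qed
        then show "(\<Sum>i\<in>I. cmod (S1 (b i) A / M) powr r) \<le> 1" using \<sigma>b by linarith
      qed
      moreover have "(\<Sum>k\<in>K. \<Sum>i\<in>I. x k i * ((S1 (s k) A / M) * (S1 (b i) A / M)))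
          = (\<Sum>k\<in>K. \<Sum>i\<in>I. x k i * (S1 (s k) A * S1 (b i) A)) / 48"
      proof -
        have "y / of_real M * (z / of_real M) = y * z / 48" for y z :: complex
          using M by (simp flip: of_real_mult)
        then show ?thesis
          unfolding sum_divide_distrib by (intro sum.cong refl) (simp only: times_divide_eq_right)
      qed
      ultimately show "cmod (\<Sum>k\<in>K. \<Sum>i\<in>I. x k i * (S1 (s k) A * S1 (b i) A)) \<le> 48"
        by (simp only: norm_divide) simp
    qed
    then show ?thesis by (simp add: N_def card_Pow[OF D])
  qed
  moreover have rest: "cmod (T f g) \<le> N * C / 4"
    if f: "\<And>k. k \<in> K \<Longrightarrow> (\<Sum>A\<in>Pow D. (cmod (f (s k) A))\<^sup>2) \<le> N * u\<^sup>2"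
      and g: "\<And>i. i \<in> I \<Longrightarrow> (\<Sum>A\<in>Pow D. (cmod (g (b i) A))\<^sup>2) \<le> N * w\<^sup>2 * \<sigma> (b i)"
      and uw: "u * w = 1 / 4" "u > 0" "w > 0" for f g u w
  proof -
    have N': "complex_of_real (sqrt N) * complex_of_real (sqrt N) = N"
      using N by (simp flip: of_real_mult)
    have "cmod (\<Sum>k\<in>K. \<Sum>i\<in>I. x k i * (\<Sum>A\<in>Pow D. f (s k) A / (u * sqrt N) * (g (b i) A / (w * sqrt N)))) \<le> C"
    proof (rule hilbert_boundD[OF C])
      show "finite (Pow D)" using D by simp
      show "(\<Sum>A\<in>Pow D. (cmod (f (s k) A / (u * sqrt N)))\<^sup>2) \<le> 1" if "k \<in> K" for k
      proof -
        have "(\<Sum>A\<in>Pow D. (cmod (f (s k) A / (u * sqrt N)))\<^sup>2) = (\<Sum>A\<in>Pow D. (cmod (f (s k) A))\<^sup>2) / (N * u\<^sup>2)"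
          using N uw by (simp add: norm_divide norm_mult power_divide power_mult_distrib sum_divide_distrib mult_ac)
        then show ?thesis using f[OF that] N uw by simp
      qed
      have "(\<Sum>i\<in>I. (\<Sum>A\<in>Pow D. (cmod (g (b i) A / (w * sqrt N)))\<^sup>2) powr (r / 2)) \<le> (\<Sum>i\<in>I. \<sigma> (b i) powr (r / 2))"
      proof (rule sum_mono)
        fix i assume i: "i \<in> I"
        have "(\<Sum>A\<in>Pow D. (cmod (g (b i) A / (w * sqrt N)))\<^sup>2) = (\<Sum>A\<in>Pow D. (cmod (g (b i) A))\<^sup>2) / (N * w\<^sup>2)"
          using N uw by (simp add: norm_divide norm_mult power_divide power_mult_distrib sum_divide_distrib mult_ac)
        also have "\<dots> \<le> \<sigma> (b i)" using g[OF i] N uw by (simp add: divide_le_eq mult_ac)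
        finally show "(\<Sum>A\<in>Pow D. (cmod (g (b i) A / (w * sqrt N)))\<^sup>2) powr (r / 2) \<le> \<sigma> (b i) powr (r / 2)"
          using r by (intro powr_mono2) (auto intro: sum_nonneg)
      qed
      then show "(\<Sum>i\<in>I. (\<Sum>A\<in>Pow D. (cmod (g (b i) A / (w * sqrt N)))\<^sup>2) powr (r / 2)) \<le> 1"
        using \<sigma>b by linarith
    qed
    moreover have "(\<Sum>k\<in>K. \<Sum>i\<in>I. x k i * (\<Sum>A\<in>Pow D. f (s k) A / (u * sqrt N) * (g (b i) A / (w * sqrt N))))
        = T f g * (4 / N)"
    proof -
      have e: "y / (u * sqrt N) * (z / (w * sqrt N)) = y * z * (4 / N)" for y z :: complex
      proof -
        have "(u * sqrt N) * (w * sqrt N) = (u * w) * (sqrt N * sqrt N)"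
          by (simp only: mult_ac)
        also have "\<dots> = N / 4" unfolding uw using N by simp
        finally have "complex_of_real (u * sqrt N) * complex_of_real (w * sqrt N) = of_real (N / 4)"
          by (simp only: of_real_mult[symmetric])
        then show ?thesis using N
          by (simp only: times_divide_times_eq) simp
      qed
      have "T f g * (4 / N) = (\<Sum>k\<in>K. \<Sum>i\<in>I. x k i * (\<Sum>A\<in>Pow D. f (s k) A * g (b i) A * (4 / N)))"
        unfolding T_def sum_distrib_right sum_distrib_left
        by (subst sum.swap, intro sum.cong refl, subst sum.swap, simp add: mult_ac)
      then show ?thesis unfolding e by simp
    qed
    ultimately have "cmod (T f g) * (4 / N) \<le> C"
      using N by (simp add: norm_mult norm_divide)
    then show ?thesis using N by (simp add: field_simps)
  qed
  have "cmod (T S2 S1) \<le> N * C / 4"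
  proof (rule rest[of _ "1/4" _ 1])
    show "(\<Sum>A\<in>Pow D. (cmod (S2 (s k) A))\<^sup>2) \<le> N * (1 / 4)\<^sup>2" if "k \<in> K" for k
    proof -
      have "N * \<sigma> (s k) \<le> N * 1" using \<sigma>s[OF that] N by (intro mult_left_mono) auto
      then show ?thesis using S2_sq[of "s k"] by (simp add: power2_eq_square)
    qed
  qed (use S1_sq in auto)
  moreover have "cmod (T S S2) \<le> N * C / 4"
  proof (rule rest[of _ 1 _ "1/4"])
    show "(\<Sum>A\<in>Pow D. (cmod (S (s k) A))\<^sup>2) \<le> N * 1\<^sup>2" if "k \<in> K" for k
    proof -
      have "N * \<sigma> (s k) \<le> N * 1" using \<sigma>s[OF that] N by (intro mult_left_mono) auto
      then show ?thesis using S_sq[of "s k"] by simp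
    qed
    show "(\<Sum>A\<in>Pow D. (cmod (S2 (b i) A))\<^sup>2) \<le> N * (1 / 4)\<^sup>2 * \<sigma> (b i)" for i
      using S2_sq[of "b i"] by (simp add: power2_eq_square)
  qed auto
  ultimately have "cmod (T S S) \<le> N * 48 + N * C / 4 + N * C / 4"
    by (smt (verit) norm_triangle_ineq)
  then have "N * cmod (\<Sum>k\<in>K. \<Sum>i\<in>I. x k i * (\<Sum>l\<in>D. s k l * b i l)) \<le> N * (48 + C / 2)"
    using N unfolding Texp[symmetric] by (simp add: norm_mult algebra_simps)
  then show "cmod (\<Sum>k\<in>K. \<Sum>i\<in>I. x k i * (\<Sum>l\<in>D. s k l * b i l)) \<le> 48 + C / 2"
    using N by simp
qed

lemma Cauchy_Schwarz_cmod:
  "cmod (\<Sum>l\<in>D. a l * b l) \<le> sqrt (\<Sum>l\<in>D. (cmod (a l))\<^sup>2) * sqrt (\<Sum>l\<in>D. (cmod (b l))\<^sup>2)"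
proof -
  have "cmod (\<Sum>l\<in>D. a l * b l) \<le> (\<Sum>l\<in>D. \<bar>cmod (a l)\<bar> * \<bar>cmod (b l)\<bar>)"
    by (rule sum_norm_le) (simp add: norm_mult)
  also have "\<dots> \<le> L2_set (\<lambda>l. cmod (a l)) D * L2_set (\<lambda>l. cmod (b l)) D"
    by (rule L2_set_mult_ineq)
  finally show ?thesis by (simp add: L2_set_def)
qed

lemma hilbert_bound_trivial:
  assumes fin: "finite I" and r: "r > 0"
  shows "hilbert_bound K I r x (\<Sum>k\<in>K. \<Sum>i\<in>I. cmod (x k i))"
  unfolding hilbert_bound_def
proof (intro allI impI)
  fix D :: "nat set" and s b
  assume D: "finite D" and s: "\<forall>k\<in>K. (\<Sum>l\<in>D. (cmod (s k l))\<^sup>2) \<le> 1"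
    and b: "(\<Sum>i\<in>I. (\<Sum>l\<in>D. (cmod (b i l))\<^sup>2) powr (r / 2)) \<le> 1"
  show "cmod (\<Sum>k\<in>K. \<Sum>i\<in>I. x k i * (\<Sum>l\<in>D. s k l * b i l)) \<le> (\<Sum>k\<in>K. \<Sum>i\<in>I. cmod (x k i))"
  proof (intro sum_norm_le)
    fix k i assume k: "k \<in> K" and i: "i \<in> I"
    have "(\<Sum>l\<in>D. (cmod (b i l))\<^sup>2) powr (r / 2) \<le> (\<Sum>i\<in>I. (\<Sum>l\<in>D. (cmod (b i l))\<^sup>2) powr (r / 2))"
      using i fin by (intro member_le_sum) auto
    then have "(\<Sum>l\<in>D. (cmod (b i l))\<^sup>2) powr (r / 2) \<le> 1" using b by linarith
    then have "(\<Sum>l\<in>D. (cmod (b i l))\<^sup>2) \<le> 1"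
      using r gr_one_powr[of "(\<Sum>l\<in>D. (cmod (b i l))\<^sup>2)" "r / 2"] by fastforce
    then have "sqrt (\<Sum>l\<in>D. (cmod (s k l))\<^sup>2) * sqrt (\<Sum>l\<in>D. (cmod (b i l))\<^sup>2) \<le> 1 * 1"
      using s k by (intro mult_mono) (auto intro: sum_nonneg)
    then have "cmod (\<Sum>l\<in>D. s k l * b i l) \<le> 1"
      using Cauchy_Schwarz_cmod[of "s k" "b i" D] by linarith
    then show "cmod (x k i * (\<Sum>l\<in>D. s k l * b i l)) \<le> cmod (x k i)"
      by (simp add: norm_mult mult_left_le)
  qed
qed

text \<open>
  The constant 96 is the fixed point of \<open>C \<mapsto> 48 + C / 2\<close>, and the iteration starts from the
  sum of the moduli of all entries.
\<close>

theorem grothendieck_inequality: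
  fixes x :: "'k \<Rightarrow> 'i \<Rightarrow> complex"
  assumes fin: "finite K" "finite I" and r: "r > 0"
    and x: "scalar_bound K I r x"
  shows "hilbert_bound K I r x 96"
proof -
  define C0 where "C0 = (\<Sum>k\<in>K. \<Sum>i\<in>I. cmod (x k i))"
  have iter: "hilbert_bound K I r x (96 + (C0 - 96) * (1 / 2) ^ j)" for j
  proof (induction j)
    case 0 then show ?case using hilbert_bound_trivial[OF fin(2) r] by (simp add: C0_def)
  next
    case (Suc j)
    have "48 + (96 + (C0 - 96) * (1 / 2) ^ j) / 2 = 96 + (C0 - 96) * (1 / 2) ^ Suc j"
      by (simp add: field_simps)
    then show ?case using hilbert_bound_improve[OF fin r x Suc] by metis
  qed
  have lim: "(\<lambda>j. 96 + (C0 - 96) * (1 / 2) ^ j) \<longlonglongrightarrow> 96 + (C0 - 96) * 0"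
    by (intro tendsto_intros LIMSEQ_realpow_zero) auto
  show ?thesis
    unfolding hilbert_bound_def
  proof (intro allI impI)
    fix D :: "nat set" and s b
    assume "finite D" "\<forall>k\<in>K. (\<Sum>l\<in>D. (cmod (s k l))\<^sup>2) \<le> 1"
      "(\<Sum>i\<in>I. (\<Sum>l\<in>D. (cmod (b i l))\<^sup>2) powr (r / 2)) \<le> 1"
    then have "cmod (\<Sum>k\<in>K. \<Sum>i\<in>I. x k i * (\<Sum>l\<in>D. s k l * b i l)) \<le> 96 + (C0 - 96) * (1 / 2) ^ j" for j
      using iter[of j] unfolding hilbert_bound_def by blast
    then show "cmod (\<Sum>k\<in>K. \<Sum>i\<in>I. x k i * (\<Sum>l\<in>D. s k l * b i l)) \<le> 96"
      using LIMSEQ_le_const[OF lim] by auto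
  qed
qed

section \<open>A minimax theorem\<close>


lemma max_zero_add_sq:
  fixes u v :: real
  shows "(max 0 (u + v))\<^sup>2 \<le> (max 0 u)\<^sup>2 + 2 * v * max 0 u + v\<^sup>2"
proof (cases "u + v \<le> 0")
  case True
  have "(max 0 u)\<^sup>2 + 2 * v * max 0 u + v\<^sup>2 = (max 0 u + v)\<^sup>2"
    by (simp add: power2_eq_square algebra_simps)
  then show ?thesis using True by simp
next
  case False
  then have "(max 0 (u + v))\<^sup>2 \<le> (max 0 u + v)\<^sup>2"
    by (intro power_mono) auto
  then show ?thesis by (simp add: power2_eq_square algebra_simps)
qed

text \<open>
  Minimise the sum of the squared violations \<open>max 0 (- g\<^sub>j)\<close> over \<open>K\<close>.  Use the violations at the
  minimiser \<open>x\<close> as weights \<open>\<mu>\<close>; there is a point \<open>y\<close> where the weighted sum of the \<open>g\<^sub>j\<close> is nonnegative.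
  Moving from \<open>x\<close> a little towards \<open>y\<close> would decrease the minimum to first order, unless it is zero.
\<close>

lemma minimax_finite:
  fixes K :: "'a::topological_space set" and g :: "'j \<Rightarrow> 'a \<Rightarrow> real"
  assumes K: "compact K"
    and cont: "\<And>j. continuous_on K (g j)"
    and concave: "\<And>x y h. x \<in> K \<Longrightarrow> y \<in> K \<Longrightarrow> 0 \<le> h \<Longrightarrow> h \<le> 1 \<Longrightarrow>
        \<exists>z\<in>K. \<forall>j. (1 - h) * g j x + h * g j y \<le> g j z"
    and pos: "\<And>J \<mu>. finite J \<Longrightarrow> (\<And>j. 0 \<le> \<mu> j) \<Longrightarrow> \<exists>x\<in>K. 0 \<le> (\<Sum>j\<in>J. \<mu> j * g j x)"
    and J: "finite J"
  shows "\<exists>x\<in>K. \<forall>j\<in>J. 0 \<le> g j x"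
proof -
  define \<Phi> where "\<Phi> x = (\<Sum>j\<in>J. (max 0 (- g j x))\<^sup>2)" for x
  have "K \<noteq> {}" using pos[of "{}" "\<lambda>_. 0"] by auto
  moreover have "continuous_on K \<Phi>"
    unfolding \<Phi>_def by (intro continuous_intros cont)
  ultimately obtain x where x: "x \<in> K" and min: "\<And>z. z \<in> K \<Longrightarrow> \<Phi> x \<le> \<Phi> z"
    using continuous_attains_inf[OF K] by blast
  define \<mu> where "\<mu> j = max 0 (- g j x)" for j
  have "0 \<le> \<mu> j" for j by (simp add: \<mu>_def)
  then obtain y where y: "y \<in> K" "0 \<le> (\<Sum>j\<in>J. \<mu> j * g j y)"
    using pos[OF J] by blast
  define L where "L = (\<Sum>j\<in>J. (g j y - g j x)\<^sup>2)"
  have L0: "L \<ge> 0" by (simp add: L_def sum_nonneg)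
  have \<Phi>x: "\<Phi> x = (\<Sum>j\<in>J. - (\<mu> j * g j x))"
    unfolding \<Phi>_def \<mu>_def by (intro sum.cong refl) (simp add: max_def power2_eq_square)
  have "\<Phi> x \<le> \<Phi> x - 2 * h * \<Phi> x + h\<^sup>2 * L" if h: "0 \<le> h" "h \<le> 1" for h
  proof -
    obtain z where z: "z \<in> K" "\<And>j. (1 - h) * g j x + h * g j y \<le> g j z"
      using concave[OF x y(1) h] by blast
    have "\<Phi> x \<le> \<Phi> z" by (rule min[OF z(1)])
    also have "\<dots> \<le> (\<Sum>j\<in>J. (\<mu> j)\<^sup>2 + 2 * (- (h * (g j y - g j x))) * \<mu> j + (- (h * (g j y - g j x)))\<^sup>2)"
      unfolding \<Phi>_def
    proof (rule sum_mono)
      fix j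
      have "max 0 (- g j z) \<le> max 0 (- g j x + - (h * (g j y - g j x)))"
        using z(2)[of j] by (auto simp: algebra_simps)
      then have "(max 0 (- g j z))\<^sup>2 \<le> (max 0 (- g j x + - (h * (g j y - g j x))))\<^sup>2"
        by (intro power_mono) auto
      also have "\<dots> \<le> (\<mu> j)\<^sup>2 + 2 * (- (h * (g j y - g j x))) * \<mu> j + (- (h * (g j y - g j x)))\<^sup>2"
        unfolding \<mu>_def by (rule max_zero_add_sq)
      finally show "(max 0 (- g j z))\<^sup>2
          \<le> (\<mu> j)\<^sup>2 + 2 * (- (h * (g j y - g j x))) * \<mu> j + (- (h * (g j y - g j x)))\<^sup>2" .
    qed
    also have "\<dots> = \<Phi> x - 2 * h * ((\<Sum>j\<in>J. \<mu> j * g j y) + (\<Sum>j\<in>J. - (\<mu> j * g j x))) + h\<^sup>2 * L"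
      unfolding L_def \<Phi>_def \<mu>_def[symmetric] sum_distrib_left sum.distrib[symmetric] sum_subtractf[symmetric]
      by (intro sum.cong refl) (simp add: power2_eq_square algebra_simps)
    also have "\<dots> \<le> \<Phi> x - 2 * h * \<Phi> x + h\<^sup>2 * L"
      unfolding \<Phi>x[symmetric] using y(2) h by (simp add: mult_left_mono)
    finally show ?thesis .
  qed
  then have bound: "2 * h * \<Phi> x \<le> h\<^sup>2 * L" if "0 \<le> h" "h \<le> 1" for h
    using that by fastforce
  have \<Phi>0: "\<Phi> x \<ge> 0" unfolding \<Phi>_def by (simp add: sum_nonneg)
  have "\<Phi> x = 0"
  proof (rule ccontr)
    assume "\<Phi> x \<noteq> 0"
    then have \<Phi>p: "\<Phi> x > 0" using \<Phi>0 by simp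
    define h where "h = min 1 (\<Phi> x / (L + 1))"
    have h: "0 < h" "h \<le> 1" and "h \<le> \<Phi> x / (L + 1)"
      using \<Phi>p L0 by (auto simp: h_def)
    then have h3: "h * (L + 1) \<le> \<Phi> x" using L0 by (simp add: pos_le_divide_eq)
    have "h * (2 * \<Phi> x) \<le> h * (h * L)"
      using bound[of h] h by (simp add: power2_eq_square mult_ac)
    then have "2 * \<Phi> x \<le> h * L" using h(1) by simp
    then show False using h h3 \<Phi>p by (simp add: algebra_simps)
  qed
  then have "\<forall>j\<in>J. (max 0 (- g j x))\<^sup>2 = 0"
    unfolding \<Phi>_def using J by (simp add: sum_nonneg_eq_0_iff)
  then have "\<forall>j\<in>J. 0 \<le> g j x" by (auto simp: max_def split: if_splits)
  then show ?thesis using x by blast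
qed

text \<open>
  Ky Fan's form of the minimax theorem: a common point for all \<open>j\<close> comes from those for
  finitely many \<open>j\<close> by compactness.
\<close>

theorem minimax:
  fixes K :: "'a::t2_space set" and g :: "'j \<Rightarrow> 'a \<Rightarrow> real"
  assumes K: "compact K"
    and cont: "\<And>j. continuous_on K (g j)"
    and concave: "\<And>x y h. x \<in> K \<Longrightarrow> y \<in> K \<Longrightarrow> 0 \<le> h \<Longrightarrow> h \<le> 1 \<Longrightarrow>
        \<exists>z\<in>K. \<forall>j. (1 - h) * g j x + h * g j y \<le> g j z"
    and pos: "\<And>J \<mu>. finite J \<Longrightarrow> (\<And>j. 0 \<le> \<mu> j) \<Longrightarrow> \<exists>x\<in>K. 0 \<le> (\<Sum>j\<in>J. \<mu> j * g j x)"
  shows "\<exists>x\<in>K. \<forall>j. 0 \<le> g j x"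
proof -
  define A where "A j = {x \<in> K. 0 \<le> g j x}" for j
  have "closed (A j)" for j
  proof -
    have "A j = K \<inter> g j -` {0..}" by (auto simp: A_def)
    then show ?thesis
      using continuous_closed_preimage[OF cont[of j] compact_imp_closed[OF K] closed_atLeast] by simp
  qed
  moreover have "K \<inter> \<Inter> B \<noteq> {}" if B: "finite B" "B \<subseteq> range A" for B
  proof -
    obtain J where J: "finite J" "B = A ` J" using finite_subset_image[OF B] by blast
    have "\<exists>x\<in>K. \<forall>j\<in>J. 0 \<le> g j x"
      by (rule minimax_finite[OF K cont concave pos J(1)])
    then obtain x where "x \<in> K" "\<forall>j\<in>J. 0 \<le> g j x" by blast
    then have "x \<in> K \<inter> \<Inter> B" by (auto simp: J A_def)
    then show ?thesis by blast
  qed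
  ultimately have "K \<inter> \<Inter> (range A) \<noteq> {}"
    using K[unfolded compact_fip, rule_format, of "range A"] by blast
  then show ?thesis by (auto simp: A_def)
qed

section \<open>Factorization through Hilbert space\<close>

text \<open>
  Coordinates outside \<open>K\<close> are free in the unit interval, so that this is a closed subset of a
  product of compact intervals.
\<close>

definition prob_vectors :: "'k set \<Rightarrow> ('k \<Rightarrow> real) set" where
  "prob_vectors K = {u. (\<forall>k. 0 \<le> u k \<and> u k \<le> 1) \<and> (\<Sum>k\<in>K. u k) = 1}"

lemma compact_prob_vectors: "compact (prob_vectors K)"
proof -
  have "compactin (product_topology (\<lambda>_. euclidean) UNIV) (PiE UNIV (\<lambda>_::'a. {0..1::real}))"
    by (subst compactin_PiE) (auto simp: compactin_euclidean_iff)
  then have "compact (PiE UNIV (\<lambda>_::'a. {0..1::real}))"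
    by (simp add: euclidean_product_topology compactin_euclidean_iff)
  moreover have "closed {u::'a \<Rightarrow> real. (\<Sum>k\<in>K. u k) = 1}"
    by (intro closed_Collect_eq continuous_intros continuous_on_product_coordinates)
  ultimately have "compact (PiE UNIV (\<lambda>_::'a. {0..1::real}) \<inter> {u::'a \<Rightarrow> real. (\<Sum>k\<in>K. u k) = 1})"
    by (rule compact_Int_closed)
  moreover have "PiE UNIV (\<lambda>_::'a. {0..1::real}) \<inter> {u::'a \<Rightarrow> real. (\<Sum>k\<in>K. u k) = 1} = prob_vectors K"
    by (auto simp: prob_vectors_def PiE_iff)
  ultimately show ?thesis by simp
qed

lemma convex_prob_vectors:
  assumes "u \<in> prob_vectors K" "v \<in> prob_vectors K" "0 \<le> h" "h \<le> 1"
  shows "(\<lambda>k. (1 - h) * u k + h * v k) \<in> prob_vectors K"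
proof -
  have "(1 - h) * u k + h * v k \<le> (1 - h) * 1 + h * 1" for k
    using assms by (intro add_mono mult_left_mono) (auto simp: prob_vectors_def)
  then show ?thesis
    using assms by (auto simp: prob_vectors_def sum.distrib simp flip: sum_distrib_left)
qed

lemma hilbert_bound_scaled:
  fixes D :: "'d set"
  assumes C: "hilbert_bound K I r x C" "finite D" and r: "r > 0"
    and \<sigma>: "\<sigma> > 0" "\<And>k. k \<in> K \<Longrightarrow> (\<Sum>l\<in>D. (cmod (s k l))\<^sup>2) \<le> \<sigma>"
    and \<beta>: "\<beta> > 0" "(\<Sum>i\<in>I. (\<Sum>l\<in>D. (cmod (b i l))\<^sup>2) powr (r / 2)) \<le> \<beta> powr (r / 2)"
  shows "cmod (\<Sum>k\<in>K. \<Sum>i\<in>I. x k i * (\<Sum>l\<in>D. s k l * b i l)) \<le> C * (sqrt \<sigma> * sqrt \<beta>)"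
proof -
  have "cmod (\<Sum>k\<in>K. \<Sum>i\<in>I. x k i * (\<Sum>l\<in>D. s k l / sqrt \<sigma> * (b i l / sqrt \<beta>))) \<le> C"
  proof (rule hilbert_boundD[OF C])
    have sc: "(\<Sum>l\<in>D. (cmod (a l / sqrt u))\<^sup>2) = (\<Sum>l\<in>D. (cmod (a l))\<^sup>2) / u" if "u > 0" for a :: "'d \<Rightarrow> complex" and u
      using that by (simp add: norm_divide power_divide sum_divide_distrib)
    show "(\<Sum>l\<in>D. (cmod (s k l / sqrt \<sigma>))\<^sup>2) \<le> 1" if "k \<in> K" for k
      unfolding sc[OF \<sigma>(1)] using \<sigma> that by simp
    have "(\<Sum>i\<in>I. (\<Sum>l\<in>D. (cmod (b i l / sqrt \<beta>))\<^sup>2) powr (r / 2))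
        = (\<Sum>i\<in>I. (\<Sum>l\<in>D. (cmod (b i l))\<^sup>2) powr (r / 2)) / \<beta> powr (r / 2)"
      unfolding sc[OF \<beta>(1)] sum_divide_distrib[of _ I]
      using \<beta>(1) by (intro sum.cong refl powr_divide)
    also have "\<dots> \<le> 1" using \<beta> by (simp add: divide_le_eq)
    finally show "(\<Sum>i\<in>I. (\<Sum>l\<in>D. (cmod (b i l / sqrt \<beta>))\<^sup>2) powr (r / 2)) \<le> 1" .
  qed
  moreover have "(\<Sum>k\<in>K. \<Sum>i\<in>I. x k i * (\<Sum>l\<in>D. s k l / sqrt \<sigma> * (b i l / sqrt \<beta>)))
      = (\<Sum>k\<in>K. \<Sum>i\<in>I. x k i * (\<Sum>l\<in>D. s k l * b i l)) / (sqrt \<sigma> * sqrt \<beta>)"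
    unfolding sum_divide_distrib sum_distrib_left
    by (intro sum.cong refl) simp
  ultimately have "cmod (\<Sum>k\<in>K. \<Sum>i\<in>I. x k i * (\<Sum>l\<in>D. s k l * b i l)) / (sqrt \<sigma> * sqrt \<beta>) \<le> C"
    using \<sigma>(1) \<beta>(1) by (simp only: norm_divide norm_mult norm_of_real) simp
  moreover have "sqrt \<sigma> * sqrt \<beta> > 0" using \<sigma>(1) \<beta>(1) by simp
  ultimately show ?thesis by (simp only: pos_divide_le_eq)
qed

lemma concave_powr:
  fixes a b h e :: real
  assumes "0 \<le> a" "0 \<le> b" "0 \<le> h" "h \<le> 1" "0 < e" "e \<le> 1"
  shows "(1 - h) * a powr e + h * b powr e \<le> ((1 - h) * a + h * b) powr e"
proof -
  consider "a = 0" | "b = 0" | "0 < a" "0 < b" using assms by fastforce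
  then show ?thesis
  proof cases
    case 1
    have "h powr 1 \<le> h powr e" using assms by (intro powr_mono') auto
    then have "h * b powr e \<le> h powr e * b powr e"
      using assms by (intro mult_right_mono) auto
    then show ?thesis using assms 1 by (simp add: powr_mult)
  next
    case 2
    have "(1 - h) powr 1 \<le> (1 - h) powr e" using assms by (intro powr_mono') auto
    then have "(1 - h) * a powr e \<le> (1 - h) powr e * a powr e"
      using assms by (intro mult_right_mono) auto
    then show ?thesis using assms 2 by (simp add: powr_mult)
  next
    case 3
    have "convex_on {0<..} (\<lambda>u::real. u powr (1 / e))"
      using assms by (intro powr_convex) auto
    from convex_onD[OF this, of h "a powr e" "b powr e"]
    have "((1 - h) * a powr e + h * b powr e) powr (1 / e) \<le> (1 - h) * a + h * b"
      using assms 3 by (simp add: powr_powr)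
    then have "(((1 - h) * a powr e + h * b powr e) powr (1 / e)) powr e \<le> ((1 - h) * a + h * b) powr e"
      using assms by (intro powr_mono2) auto
    then show ?thesis using assms by (simp add: powr_powr)
  qed
qed

text \<open>
  For a finite family of pairs \<open>(s, b)\<close> with nonnegative weights, read as vectors indexed by the family, the Hilbert
  space bound and the inequality of means give
  \<open>Re (\<Sum> x s b) \<le> C (max\<^sub>k S\<^sub>k + (\<Sum>\<^sub>i B\<^sub>i\<^sup>q)\<^sup>\<theta>)\<close> with \<open>q = 1 / \<theta>\<close>, where \<open>S\<^sub>k\<close> and \<open>B\<^sub>i\<close> are the squared
  norms of these vectors.  Both terms on the right are maxima over probability vectors, of
  \<open>\<Sum> u\<^sub>k S\<^sub>k\<close> and of the concave function \<open>\<Sum> t\<^sub>i\<^sup>1\<^sup>-\<^sup>\<theta> B\<^sub>i\<close>.  The minimax theorem makes one choice of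
  \<open>u\<close> and \<open>t\<close> serve all pairs.
\<close>

theorem factorization:
  fixes x :: "'k::countable \<Rightarrow> 'i::countable \<Rightarrow> complex"
  assumes fin: "finite K" "finite I" "K \<noteq> {}" "I \<noteq> {}" and \<theta>: "0 < \<theta>" "\<theta> < 1"
    and C: "hilbert_bound K I (2 / \<theta>) x (2 * C)"
  shows "\<exists>u\<in>prob_vectors K. \<exists>t\<in>prob_vectors I. \<forall>s b.
    Re (\<Sum>k\<in>K. \<Sum>i\<in>I. x k i * (s k * b i))
      \<le> C * ((\<Sum>k\<in>K. u k * (cmod (s k))\<^sup>2) + (\<Sum>i\<in>I. t i powr (1 - \<theta>) * (cmod (b i))\<^sup>2))"
proof -
  define q where "q = 1 / \<theta>"
  have q: "q > 1" "2 / \<theta> / 2 = q" "2 / \<theta> > 0" using \<theta> by (auto simp: q_def)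
  have C0: "C \<ge> 0"
    using C[unfolded hilbert_bound_def, rule_format, of "{}" "\<lambda>_ _. 0" "\<lambda>_ _. 0"] by simp
  define g :: "('k \<Rightarrow> complex) \<times> ('i \<Rightarrow> complex) \<Rightarrow> ('k \<Rightarrow> real) \<times> ('i \<Rightarrow> real) \<Rightarrow> real"
    where "g j y = C * ((\<Sum>k\<in>K. fst y k * (cmod (fst j k))\<^sup>2)
        + (\<Sum>i\<in>I. snd y i powr (1 - \<theta>) * (cmod (snd j i))\<^sup>2))
      - Re (\<Sum>k\<in>K. \<Sum>i\<in>I. x k i * (fst j k * snd j i))" for j y
  have "\<exists>y\<in>prob_vectors K \<times> prob_vectors I. \<forall>j. 0 \<le> g j y"
  proof (rule minimax[of "prob_vectors K \<times> prob_vectors I" g])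
    show "compact (prob_vectors K \<times> prob_vectors I)"
      by (intro compact_Times compact_prob_vectors)
    show "continuous_on (prob_vectors K \<times> prob_vectors I) (g j)" for j
    proof -
      have c1: "continuous_on S (\<lambda>y. fst y k)" for S :: "(('k \<Rightarrow> real) \<times> ('i \<Rightarrow> real)) set" and k
        using continuous_on_product_then_coordinatewise[OF continuous_on_fst[OF continuous_on_id]] .
      have c2: "continuous_on S (\<lambda>y. snd y i)" for S :: "(('k \<Rightarrow> real) \<times> ('i \<Rightarrow> real)) set" and i
        using continuous_on_product_then_coordinatewise[OF continuous_on_snd[OF continuous_on_id]] .
      have c3: "continuous_on (prob_vectors K \<times> prob_vectors I) (\<lambda>y. snd y i powr (1 - \<theta>))" for i
        by (intro continuous_on_powr' c2 continuous_on_const) (use \<theta> in \<open>auto simp: prob_vectors_def\<close>)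
      show ?thesis unfolding g_def by (intro continuous_intros c1 c3)
    qed
    show "\<exists>z\<in>prob_vectors K \<times> prob_vectors I. \<forall>j. (1 - h) * g j y + h * g j y' \<le> g j z"
      if y: "y \<in> prob_vectors K \<times> prob_vectors I" and y': "y' \<in> prob_vectors K \<times> prob_vectors I"
        and h: "0 \<le> h" "h \<le> 1" for y y' h
    proof (intro bexI allI)
      let ?z = "(\<lambda>k. (1 - h) * fst y k + h * fst y' k, \<lambda>i. (1 - h) * snd y i + h * snd y' i)"
      show "?z \<in> prob_vectors K \<times> prob_vectors I"
        using y y' h by (auto intro!: convex_prob_vectors)
      fix j
      define R where "R = Re (\<Sum>k\<in>K. \<Sum>i\<in>I. x k i * (fst j k * snd j i))"
      have "(1 - h) * (\<Sum>i\<in>I. snd y i powr (1 - \<theta>) * (cmod (snd j i))\<^sup>2)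
          + h * (\<Sum>i\<in>I. snd y' i powr (1 - \<theta>) * (cmod (snd j i))\<^sup>2)
          = (\<Sum>i\<in>I. ((1 - h) * snd y i powr (1 - \<theta>) + h * snd y' i powr (1 - \<theta>)) * (cmod (snd j i))\<^sup>2)"
        unfolding sum_distrib_left sum.distrib[symmetric]
        by (intro sum.cong refl) (simp add: algebra_simps)
      also have "\<dots> \<le> (\<Sum>i\<in>I. snd ?z i powr (1 - \<theta>) * (cmod (snd j i))\<^sup>2)"
        using y y' h \<theta>
        by (intro sum_mono mult_right_mono) (auto intro!: concave_powr simp: prob_vectors_def)
      finally have B: "(1 - h) * (\<Sum>i\<in>I. snd y i powr (1 - \<theta>) * (cmod (snd j i))\<^sup>2)
          + h * (\<Sum>i\<in>I. snd y' i powr (1 - \<theta>) * (cmod (snd j i))\<^sup>2)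
          \<le> (\<Sum>i\<in>I. snd ?z i powr (1 - \<theta>) * (cmod (snd j i))\<^sup>2)" .
      have A: "(1 - h) * (\<Sum>k\<in>K. fst y k * (cmod (fst j k))\<^sup>2) + h * (\<Sum>k\<in>K. fst y' k * (cmod (fst j k))\<^sup>2)
          = (\<Sum>k\<in>K. fst ?z k * (cmod (fst j k))\<^sup>2)"
        unfolding sum_distrib_left sum.distrib[symmetric]
        by (intro sum.cong refl) (simp add: algebra_simps)
      have "(1 - h) * g j y + h * g j y' =
          C * (((1 - h) * (\<Sum>k\<in>K. fst y k * (cmod (fst j k))\<^sup>2) + h * (\<Sum>k\<in>K. fst y' k * (cmod (fst j k))\<^sup>2))
            + ((1 - h) * (\<Sum>i\<in>I. snd y i powr (1 - \<theta>) * (cmod (snd j i))\<^sup>2)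
          + h * (\<Sum>i\<in>I. snd y' i powr (1 - \<theta>) * (cmod (snd j i))\<^sup>2))) - R"
        by (simp only: g_def R_def[symmetric]) (simp add: algebra_simps)
      also have "\<dots> \<le> g j ?z"
        unfolding g_def R_def[symmetric] A using B C0 by (intro diff_right_mono mult_left_mono add_left_mono)
      finally show "(1 - h) * g j y + h * g j y' \<le> g j ?z" .
    qed
    show "\<exists>y\<in>prob_vectors K \<times> prob_vectors I. 0 \<le> (\<Sum>j\<in>J. \<mu> j * g j y)"
      if J: "finite J" and \<mu>: "\<And>j. 0 \<le> \<mu> j"
      for J :: "(('k \<Rightarrow> complex) \<times> ('i \<Rightarrow> complex)) set" and \<mu>
    proof -
      define s where "s k j = complex_of_real (sqrt (\<mu> j)) * fst j k" for k and j :: "('k \<Rightarrow> complex) \<times> ('i \<Rightarrow> complex)"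
      define b where "b i j = complex_of_real (sqrt (\<mu> j)) * snd j i" for i and j :: "('k \<Rightarrow> complex) \<times> ('i \<Rightarrow> complex)"
      define S where "S k = (\<Sum>j\<in>J. (cmod (s k j))\<^sup>2)" for k
      define B where "B i = (\<Sum>j\<in>J. (cmod (b i j))\<^sup>2)" for i
      have S0: "S k \<ge> 0" and B0: "B i \<ge> 0" for k i by (simp_all add: S_def B_def sum_nonneg)
      define V where "V = (\<Sum>k\<in>K. \<Sum>i\<in>I. x k i * (\<Sum>j\<in>J. s k j * b i j))"
      have sq: "complex_of_real (sqrt (\<mu> j)) * complex_of_real (sqrt (\<mu> j)) = of_real (\<mu> j)" for j
        using \<mu>[of j] by (simp flip: of_real_mult)
      have sum_g: "(\<Sum>j\<in>J. \<mu> j * g j y) = C * ((\<Sum>k\<in>K. fst y k * S k) + (\<Sum>i\<in>I. snd y i powr (1 - \<theta>) * B i)) - Re V" for y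
      proof -
        have 1: "(\<Sum>j\<in>J. \<mu> j * (\<Sum>k\<in>K. fst y k * (cmod (fst j k))\<^sup>2)) = (\<Sum>k\<in>K. fst y k * S k)"
          unfolding S_def sum_distrib_left
          by (subst sum.swap, intro sum.cong refl) (use \<mu> in \<open>simp add: s_def norm_mult power_mult_distrib\<close>)
        have 2: "(\<Sum>j\<in>J. \<mu> j * (\<Sum>i\<in>I. snd y i powr (1 - \<theta>) * (cmod (snd j i))\<^sup>2)) = (\<Sum>i\<in>I. snd y i powr (1 - \<theta>) * B i)"
          unfolding B_def sum_distrib_left
          by (subst sum.swap, intro sum.cong refl) (use \<mu> in \<open>simp add: b_def norm_mult power_mult_distrib\<close>)
        have "(\<Sum>j\<in>J. of_real (\<mu> j) * (\<Sum>k\<in>K. \<Sum>i\<in>I. x k i * (fst j k * snd j i))) = V"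
        proof -
          have "V = (\<Sum>k\<in>K. \<Sum>j\<in>J. \<Sum>i\<in>I. x k i * (s k j * b i j))"
            unfolding V_def sum_distrib_left by (intro sum.cong refl sum.swap)
          also have "\<dots> = (\<Sum>j\<in>J. \<Sum>k\<in>K. \<Sum>i\<in>I. x k i * (s k j * b i j))"
            by (rule sum.swap)
          also have "\<dots> = (\<Sum>j\<in>J. of_real (\<mu> j) * (\<Sum>k\<in>K. \<Sum>i\<in>I. x k i * (fst j k * snd j i)))"
            unfolding sum_distrib_left s_def b_def sq[symmetric]
            by (intro sum.cong refl) (simp only: mult_ac)
          finally show ?thesis by simp
        qed
        from this[symmetric] have 3: "(\<Sum>j\<in>J. \<mu> j * Re (\<Sum>k\<in>K. \<Sum>i\<in>I. x k i * (fst j k * snd j i))) = Re V"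
          by simp
        have "(\<Sum>j\<in>J. \<mu> j * g j y) = C * ((\<Sum>j\<in>J. \<mu> j * (\<Sum>k\<in>K. fst y k * (cmod (fst j k))\<^sup>2))
            + (\<Sum>j\<in>J. \<mu> j * (\<Sum>i\<in>I. snd y i powr (1 - \<theta>) * (cmod (snd j i))\<^sup>2)))
            - (\<Sum>j\<in>J. \<mu> j * Re (\<Sum>k\<in>K. \<Sum>i\<in>I. x k i * (fst j k * snd j i)))"
          unfolding sum_distrib_left[of C] sum.distrib[symmetric] sum_subtractf[symmetric] g_def
          by (intro sum.cong refl) (simp only: ring_distribs mult.left_commute)
        then show ?thesis unfolding 1 2 3 .
      qed
      have "Max (S ` K) \<in> S ` K" using fin by (intro Max_in) auto
      then obtain k0 where k0: "k0 \<in> K" "S k0 = Max (S ` K)" by fastforce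
      then have k0_max: "S k \<le> S k0" if "k \<in> K" for k using that fin by simp
      \<comment> \<open>The first maximum is attained at a point mass.\<close>
      define u where "u k = (if k = k0 then 1 else 0 :: real)" for k
      have u: "u \<in> prob_vectors K" "(\<Sum>k\<in>K. u k * S k) = S k0"
        using k0(1) fin by (auto simp: prob_vectors_def u_def if_distrib[of "\<lambda>z. z * _"] cong: if_cong)
      define Z where "Z = (\<Sum>i\<in>I. B i powr q)"
      have Z0: "Z \<ge> 0" by (simp add: Z_def sum_nonneg)
      obtain t where t: "t \<in> prob_vectors I" "(\<Sum>i\<in>I. t i powr (1 - \<theta>) * B i) = Z powr \<theta>"
      proof (cases "Z = 0")
        case True
        then have "B i = 0" if "i \<in> I" for i
          using that fin by (simp add: Z_def sum_nonneg_eq_0_iff)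
        moreover obtain i0 where "i0 \<in> I" using fin by blast
        then have "(\<lambda>i. if i = i0 then 1 else 0) \<in> prob_vectors I"
          using fin by (auto simp: prob_vectors_def)
        ultimately show ?thesis using True by (intro that) auto
      next
        case False
        then have Z: "Z > 0" using Z0 by simp
        \<comment> \<open>The case of equality in the inequality of Hoelder.\<close>
        define t where "t i = (if i \<in> I then B i powr q / Z else 0)" for i
        have le: "B i powr q \<le> Z" if "i \<in> I" for i
          unfolding Z_def using that fin by (intro member_le_sum) auto
        have "(\<Sum>i\<in>I. t i) = (\<Sum>i\<in>I. B i powr q) / Z"
          unfolding sum_divide_distrib by (intro sum.cong) (auto simp: t_def)
        then have "t \<in> prob_vectors I"
          using Z le by (auto simp: prob_vectors_def t_def Z_def[symmetric])
        moreover have "(\<Sum>i\<in>I. t i powr (1 - \<theta>) * B i) = (\<Sum>i\<in>I. B i powr q / Z powr (1 - \<theta>))"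
        proof (intro sum.cong refl)
          fix i assume i: "i \<in> I"
          show "t i powr (1 - \<theta>) * B i = B i powr q / Z powr (1 - \<theta>)"
          proof (cases "B i = 0")
            case False
            then have "B i > 0" using B0[of i] by simp
            then have "(B i powr q) powr (1 - \<theta>) * B i = B i powr (q * (1 - \<theta>) + 1)"
              by (simp add: powr_powr powr_add)
            also have "q * (1 - \<theta>) + 1 = q" using \<theta> by (simp add: q_def field_simps)
            finally show ?thesis using i Z by (simp add: t_def powr_divide)
          qed simp
        qed
        moreover have "(\<Sum>i\<in>I. B i powr q / Z powr (1 - \<theta>)) = Z powr \<theta>"
          unfolding sum_divide_distrib[symmetric] Z_def[symmetric] using Z
          by (simp add: powr_diff)
        ultimately show ?thesis by (intro that) auto
      qed
      have "Re V \<le> C * (S k0 + Z powr \<theta>)"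
      proof (cases "S k0 > 0 \<and> Z > 0")
        case True
        have "(Z powr \<theta>) powr q = Z" using True \<theta> by (simp add: q_def powr_powr)
        then have "cmod V \<le> 2 * C * (sqrt (S k0) * sqrt (Z powr \<theta>))"
          unfolding V_def using True k0_max q
          by (intro hilbert_bound_scaled[OF C J]) (auto simp: S_def[symmetric] B_def[symmetric] Z_def[symmetric])
        also have "\<dots> \<le> C * (S k0 + Z powr \<theta>)"
        proof -
          have "2 * (sqrt (S k0) * sqrt (Z powr \<theta>)) \<le> S k0 + Z powr \<theta>"
            using arith_geo_mean_sqrt[of "S k0" "Z powr \<theta>"] S0[of k0] by (simp add: real_sqrt_mult)
          from mult_left_mono[OF this C0] show ?thesis by (simp only: mult_ac)
        qed
        finally show ?thesis using complex_Re_le_cmod[of V] by linarith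
      next
        case False
        have "V = 0"
        proof (cases "S k0 = 0")
          case True
          then have "S k = 0" if "k \<in> K" for k using k0_max[OF that] S0[of k] by simp
          then have "s k j = 0" if "k \<in> K" "j \<in> J" for k j
            using that J by (simp add: S_def sum_nonneg_eq_0_iff)
          then show ?thesis by (simp add: V_def)
        next
          case F2: False
          then have "Z = 0" using False S0[of k0] Z0 by auto
          then have "B i = 0" if "i \<in> I" for i
            using that fin by (simp add: Z_def sum_nonneg_eq_0_iff)
          then have "b i j = 0" if "i \<in> I" "j \<in> J" for i j
            using that J by (simp add: B_def sum_nonneg_eq_0_iff)
          then show ?thesis by (simp add: V_def)
        qed
        then show ?thesis using C0 S0[of k0] by simp
      qed
      then have "0 \<le> (\<Sum>j\<in>J. \<mu> j * g j (u, t))"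
        unfolding sum_g by (simp add: u t)
      then show ?thesis using u t by blast
    qed
  qed
  then obtain u t where ut: "u \<in> prob_vectors K" "t \<in> prob_vectors I" "\<And>s b. 0 \<le> g (s, b) (u, t)"
    by auto
  show ?thesis
    using ut(3) by (intro bexI[OF _ ut(1)] bexI[OF _ ut(2)] allI) (fastforce simp: g_def)
qed

definition l2_bounded :: "'k set \<Rightarrow> 'i set \<Rightarrow> real \<Rightarrow> ('k \<Rightarrow> 'i \<Rightarrow> complex) \<Rightarrow> bool" where
  "l2_bounded K I M w \<longleftrightarrow>
    (\<forall>b. (\<Sum>k\<in>K. (cmod (\<Sum>i\<in>I. w k i * b i))\<^sup>2) \<le> M\<^sup>2 * (\<Sum>i\<in>I. (cmod (b i))\<^sup>2))"

text \<open>
  Adding \<open>1 / card K\<close> and \<open>1 / card I\<close> to the weights keeps the inequality of \<open>factorization\<close> and makes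
  them positive, so that they can be divided out of \<open>x\<close>.  The bound for the quotient \<open>w\<close> on Hilbert space follows by
  testing with a multiple of the conjugate of \<open>w b\<close>.
\<close>

theorem maurey_factorization:
  fixes x :: "'k::countable \<Rightarrow> 'i::countable \<Rightarrow> complex"
  assumes fin: "finite K" "finite I" "K \<noteq> {}" "I \<noteq> {}" and \<theta>: "0 < \<theta>" "\<theta> < 1"
    and x: "scalar_bound K I (2 / \<theta>) x"
  shows "\<exists>u t w. (\<forall>k\<in>K. 0 < u k) \<and> (\<forall>i\<in>I. 0 < t i) \<and> (\<Sum>k\<in>K. u k) \<le> 2 \<and> (\<Sum>i\<in>I. t i) \<le> 2 \<and>
    (\<forall>k\<in>K. \<forall>i\<in>I. x k i = w k i * of_real (sqrt (u k) * t i powr ((1 - \<theta>) / 2))) \<and>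
    l2_bounded K I 96 w"
proof -
  have "hilbert_bound K I (2 / \<theta>) x (2 * 48)"
    using grothendieck_inequality[OF fin(1,2) _ x] \<theta> by simp
  from factorization[OF fin \<theta> this]
  obtain u t where u: "u \<in> prob_vectors K" and t: "t \<in> prob_vectors I"
    and ut: "\<And>s b. Re (\<Sum>k\<in>K. \<Sum>i\<in>I. x k i * (s k * b i))
      \<le> 48 * ((\<Sum>k\<in>K. u k * (cmod (s k))\<^sup>2) + (\<Sum>i\<in>I. t i powr (1 - \<theta>) * (cmod (b i))\<^sup>2))"
    by blast
  define u' where "u' k = u k + 1 / card K" for k
  define t' where "t' i = t i + 1 / card I" for i
  have pos: "card K > 0" "card I > 0" using fin by (auto simp: card_gt_0_iff)
  have u': "u' k > 0" "u k \<le> u' k" for k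
    using u pos by (auto simp: u'_def prob_vectors_def intro!: add_nonneg_pos)
  have t': "t' i > 0" "t i powr (1 - \<theta>) \<le> t' i powr (1 - \<theta>)" for i
    using t pos \<theta> by (auto simp: t'_def prob_vectors_def intro!: add_nonneg_pos powr_mono2)
  have sums: "(\<Sum>k\<in>K. u' k) = 2" "(\<Sum>i\<in>I. t' i) = 2"
    using u t pos by (auto simp: u'_def t'_def prob_vectors_def sum.distrib)
  define w where "w k i = x k i / (of_real (sqrt (u' k)) * of_real (t' i powr ((1 - \<theta>) / 2)))" for k i
  have w: "x k i = w k i * of_real (sqrt (u' k) * t' i powr ((1 - \<theta>) / 2))" for k i
    using u'(1)[of k] t'(1)[of i] by (simp add: w_def)
  have form: "Re (\<Sum>k\<in>K. \<Sum>i\<in>I. w k i * (s k * b i)) \<le> 48 * ((\<Sum>k\<in>K. (cmod (s k))\<^sup>2) + (\<Sum>i\<in>I. (cmod (b i))\<^sup>2))" for s b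
  proof -
    have "Re (\<Sum>k\<in>K. \<Sum>i\<in>I. w k i * (s k * b i))
        = Re (\<Sum>k\<in>K. \<Sum>i\<in>I. x k i * (s k / of_real (sqrt (u' k)) * (b i / of_real (t' i powr ((1 - \<theta>) / 2)))))"
      by (simp add: w_def)
    also have "\<dots> \<le> 48 * ((\<Sum>k\<in>K. u k * (cmod (s k / of_real (sqrt (u' k))))\<^sup>2)
        + (\<Sum>i\<in>I. t i powr (1 - \<theta>) * (cmod (b i / of_real (t' i powr ((1 - \<theta>) / 2))))\<^sup>2))"
      by (rule ut)
    also have "\<dots> \<le> 48 * ((\<Sum>k\<in>K. (cmod (s k))\<^sup>2) + (\<Sum>i\<in>I. (cmod (b i))\<^sup>2))"
    proof (intro mult_left_mono add_mono sum_mono)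
      fix k
      have "u k * (cmod (s k / of_real (sqrt (u' k))))\<^sup>2 = u k / u' k * (cmod (s k))\<^sup>2"
        using u'(1)[of k] by (simp add: norm_divide power_divide)
      also have "\<dots> \<le> 1 * (cmod (s k))\<^sup>2"
        using u'[of k] by (intro mult_right_mono) auto
      finally show "u k * (cmod (s k / of_real (sqrt (u' k))))\<^sup>2 \<le> (cmod (s k))\<^sup>2" by simp
    next
      fix i
      have "(t' i powr ((1 - \<theta>) / 2))\<^sup>2 = t' i powr (1 - \<theta>)"
        using t'(1)[of i] by (simp add: powr_power diff_divide_distrib)
      then have "t i powr (1 - \<theta>) * (cmod (b i / of_real (t' i powr ((1 - \<theta>) / 2))))\<^sup>2
          = t i powr (1 - \<theta>) / t' i powr (1 - \<theta>) * (cmod (b i))\<^sup>2"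
        by (simp add: norm_divide power_divide)
      also have "\<dots> \<le> 1 * (cmod (b i))\<^sup>2"
        using t'[of i] by (intro mult_right_mono) auto
      finally show "t i powr (1 - \<theta>) * (cmod (b i / of_real (t' i powr ((1 - \<theta>) / 2))))\<^sup>2 \<le> (cmod (b i))\<^sup>2"
        by simp
    qed simp
    finally show ?thesis .
  qed
  have "(\<Sum>k\<in>K. (cmod (\<Sum>i\<in>I. w k i * b i))\<^sup>2) \<le> 96\<^sup>2 * (\<Sum>i\<in>I. (cmod (b i))\<^sup>2)" for b
  proof -
    define c where "c k = (\<Sum>i\<in>I. w k i * b i)" for k
    define Q where "Q = (\<Sum>k\<in>K. (cmod (c k))\<^sup>2)"
    have "(\<Sum>k\<in>K. \<Sum>i\<in>I. w k i * (of_real (1 / 96) * cnj (c k) * b i)) = (\<Sum>k\<in>K. of_real (1 / 96) * (c k * cnj (c k)))"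
      unfolding c_def sum_distrib_right sum_distrib_left by (intro sum.cong refl) (simp add: mult_ac)
    also have "\<dots> = of_real (1 / 96 * Q)"
      by (simp add: Q_def sum_distrib_left complex_norm_square[symmetric] del: of_real_power)
    finally have "1 / 96 * Q \<le> 48 * ((\<Sum>k\<in>K. (cmod (of_real (1 / 96) * cnj (c k)))\<^sup>2) + (\<Sum>i\<in>I. (cmod (b i))\<^sup>2))"
      using form[of "\<lambda>k. of_real (1 / 96) * cnj (c k)" b] by (simp only: Re_complex_of_real)
    also have "(\<Sum>k\<in>K. (cmod (of_real (1 / 96) * cnj (c k)))\<^sup>2) = (1 / 96)\<^sup>2 * Q"
      by (simp add: Q_def norm_mult norm_divide power_mult_distrib power_divide sum_divide_distrib)
    finally show ?thesis
      unfolding c_def[symmetric] Q_def[symmetric] by (simp add: power2_eq_square)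
  qed
  then have "l2_bounded K I 96 w" by (simp only: l2_bounded_def) blast
  then show ?thesis
    using u'(1) t'(1) sums w
    by (intro exI[of _ u'] exI[of _ t'] exI[of _ w] conjI ballI allI) auto
qed

section \<open>Averages over signs and Gaussian averages\<close>


text \<open>
  The mean of \<open>h\<close> over all \<open>v \<plusminus> u\<^sub>1 \<plusminus> \<dots> \<plusminus> u\<^sub>n\<close>, as a recursion in the base point \<open>v\<close>.
\<close>

primrec sign_avg :: "('v::ab_group_add \<Rightarrow> real) \<Rightarrow> 'v list \<Rightarrow> 'v \<Rightarrow> real" where
  "sign_avg h [] v = h v"
| "sign_avg h (u # us) v = (sign_avg h us (v + u) + sign_avg h us (v - u)) / 2"

definition std_normal :: "real measure" where
  "std_normal = density lborel (\<lambda>t. ennreal (std_normal_density t))"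

lemma sets_std_normal [measurable_cong, simp]: "sets std_normal = sets borel"
  by (simp add: std_normal_def)

lemma space_std_normal [simp]: "space std_normal = UNIV"
  by (simp add: std_normal_def)

lemma prob_space_std_normal: "prob_space std_normal"
  unfolding std_normal_def by (rule prob_space_normal_density) simp

lemma nn_integral_std_normal:
  "f \<in> borel_measurable borel \<Longrightarrow>
    (\<integral>\<^sup>+t. f t \<partial>std_normal) = (\<integral>\<^sup>+t. ennreal (std_normal_density t) * f t \<partial>lborel)"
  unfolding std_normal_def by (subst nn_integral_density) auto

lemma nn_integral_std_normal_uminus:
  assumes [measurable]: "f \<in> borel_measurable borel"
  shows "(\<integral>\<^sup>+t. f (- t) \<partial>std_normal) = (\<integral>\<^sup>+t. f t \<partial>std_normal)"
proof -
  have "(\<integral>\<^sup>+t. ennreal (std_normal_density t) * f t \<partial>lborel)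
      = (\<integral>\<^sup>+t. ennreal (std_normal_density (- t)) * f (- t) \<partial>lborel)"
    using nn_integral_real_affine[of "\<lambda>t. ennreal (std_normal_density t) * f t" "-1" 0] by simp
  then show ?thesis by (simp add: nn_integral_std_normal std_normal_density_def)
qed

lemma nn_integral_shear:
  fixes f :: "real \<Rightarrow> real \<Rightarrow> ennreal"
  assumes f [measurable]: "(\<lambda>(a, b). f a b) \<in> borel_measurable (borel \<Otimes>\<^sub>M borel)"
  shows "(\<integral>\<^sup>+a. \<integral>\<^sup>+b. f a (b + k * a) \<partial>lborel \<partial>lborel) = (\<integral>\<^sup>+a. \<integral>\<^sup>+b. f a b \<partial>lborel \<partial>lborel)"
    and "(\<integral>\<^sup>+a. \<integral>\<^sup>+b. f (a + k * b) b \<partial>lborel \<partial>lborel) = (\<integral>\<^sup>+a. \<integral>\<^sup>+b. f a b \<partial>lborel \<partial>lborel)"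
proof -
  have f1: "f a \<in> borel_measurable borel" for a
    using measurable_compose[OF _ f, of "\<lambda>b. (a, b)" borel] by simp
  have f2: "(\<lambda>a. f a b) \<in> borel_measurable borel" for b
    using measurable_compose[OF _ f, of "\<lambda>a. (a, b)" borel] by simp
  show "(\<integral>\<^sup>+a. \<integral>\<^sup>+b. f a (b + k * a) \<partial>lborel \<partial>lborel) = (\<integral>\<^sup>+a. \<integral>\<^sup>+b. f a b \<partial>lborel \<partial>lborel)"
  proof (rule nn_integral_cong)
    fix a
    show "(\<integral>\<^sup>+b. f a (b + k * a) \<partial>lborel) = (\<integral>\<^sup>+b. f a b \<partial>lborel)"
      using nn_integral_real_affine[OF f1[of a], of 1 "k * a"] by (simp add: add.commute)
  qed
  have sw: "(\<integral>\<^sup>+a. \<integral>\<^sup>+b. g a b \<partial>lborel \<partial>lborel) = (\<integral>\<^sup>+b. \<integral>\<^sup>+a. g a b \<partial>lborel \<partial>lborel)"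
    if "(\<lambda>(a, b). g a b) \<in> borel_measurable (borel \<Otimes>\<^sub>M borel)" for g :: "real \<Rightarrow> real \<Rightarrow> ennreal"
    using lborel_pair.Fubini'[of g] that by simp
  have "(\<integral>\<^sup>+a. \<integral>\<^sup>+b. f (a + k * b) b \<partial>lborel \<partial>lborel) = (\<integral>\<^sup>+b. \<integral>\<^sup>+a. f (a + k * b) b \<partial>lborel \<partial>lborel)"
  proof (rule sw)
    have "(\<lambda>x. (fst x + k * snd x, snd x)) \<in> borel \<Otimes>\<^sub>M borel \<rightarrow>\<^sub>M borel \<Otimes>\<^sub>M (borel :: real measure)"
      by measurable
    from measurable_compose[OF this f]
    show "(\<lambda>(a, b). f (a + k * b) b) \<in> borel_measurable (borel \<Otimes>\<^sub>M borel)"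
      by (simp add: case_prod_unfold)
  qed
  also have "\<dots> = (\<integral>\<^sup>+b. \<integral>\<^sup>+a. f a b \<partial>lborel \<partial>lborel)"
  proof (rule nn_integral_cong)
    fix b
    show "(\<integral>\<^sup>+a. f (a + k * b) b \<partial>lborel) = (\<integral>\<^sup>+a. f a b \<partial>lborel)"
      using nn_integral_real_affine[OF f2[of b], of 1 "k * b"] by (simp add: add.commute)
  qed
  also have "\<dots> = (\<integral>\<^sup>+a. \<integral>\<^sup>+b. f a b \<partial>lborel \<partial>lborel)" by (rule sw[OF f, symmetric])
  finally show "(\<integral>\<^sup>+a. \<integral>\<^sup>+b. f (a + k * b) b \<partial>lborel \<partial>lborel) = (\<integral>\<^sup>+a. \<integral>\<^sup>+b. f a b \<partial>lborel \<partial>lborel)" .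
qed

text \<open>
  A rotation is the product of three shears, each of which preserves Lebesgue measure because
  translations of the line do.
\<close>

lemma nn_integral_rotation:
  fixes f :: "real \<Rightarrow> real \<Rightarrow> ennreal"
  assumes f: "(\<lambda>(a, b). f a b) \<in> borel_measurable (borel \<Otimes>\<^sub>M borel)"
    and cs: "c\<^sup>2 + s\<^sup>2 = 1" "s \<noteq> 0"
  shows "(\<integral>\<^sup>+a. \<integral>\<^sup>+b. f (c * a - s * b) (s * a + c * b) \<partial>lborel \<partial>lborel)
    = (\<integral>\<^sup>+a. \<integral>\<^sup>+b. f a b \<partial>lborel \<partial>lborel)"
proof -
  define k where "k = (c - 1) / s"
  have comp: "(\<lambda>(a, b). f (g1 a b) (g2 a b)) \<in> borel_measurable (borel \<Otimes>\<^sub>M borel)"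
    if "(\<lambda>(a, b). g1 a b) \<in> borel_measurable (borel \<Otimes>\<^sub>M borel)"
      "(\<lambda>(a, b). g2 a b) \<in> borel_measurable (borel \<Otimes>\<^sub>M borel)" for g1 g2
  proof -
    have "(\<lambda>x. (case x of (a, b) \<Rightarrow> g1 a b, case x of (a, b) \<Rightarrow> g2 a b)) \<in> borel \<Otimes>\<^sub>M borel \<rightarrow>\<^sub>M borel \<Otimes>\<^sub>M borel"
      using that by (rule measurable_Pair)
    from measurable_compose[OF this f] show ?thesis by (simp add: case_prod_unfold)
  qed
  have s1: "1 + s * k = c" using cs by (simp add: k_def)
  have s2: "k * (1 + c) = - s"
  proof -
    have "k * (1 + c) = (c\<^sup>2 - 1) / s" by (simp add: k_def power2_eq_square algebra_simps)
    also have "c\<^sup>2 - 1 = - (s * s)" using cs(1) by (simp add: power2_eq_square algebra_simps)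
    finally show ?thesis using cs(2) by simp
  qed
  have e1: "s * (a + k * b) + b = s * a + c * b" for a b
    using s1 by (metis add.commute add.left_commute distrib_left distrib_right mult.assoc mult_1)
  have e2: "a + k * b + k * (s * a + c * b) = c * a - s * b" for a b
  proof -
    have "a + k * b + k * (s * a + c * b) = (1 + s * k) * a + (k * (1 + c)) * b"
      by (simp add: algebra_simps)
    then show ?thesis unfolding s1 s2 by simp
  qed
  have "(\<integral>\<^sup>+a. \<integral>\<^sup>+b. f a b \<partial>lborel \<partial>lborel) = (\<integral>\<^sup>+a. \<integral>\<^sup>+b. f (a + k * b) b \<partial>lborel \<partial>lborel)"
    by (rule nn_integral_shear(2)[OF f, symmetric])
  also have "\<dots> = (\<integral>\<^sup>+a. \<integral>\<^sup>+b. f (a + k * (b + s * a)) (b + s * a) \<partial>lborel \<partial>lborel)"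
    by (rule nn_integral_shear(1)[symmetric]) (rule comp, measurable)
  also have "\<dots> = (\<integral>\<^sup>+a. \<integral>\<^sup>+b. f (a + k * b + k * (b + s * (a + k * b))) (b + s * (a + k * b)) \<partial>lborel \<partial>lborel)"
    by (rule nn_integral_shear(2)[symmetric]) (rule comp, measurable)
  also have "\<dots> = (\<integral>\<^sup>+a. \<integral>\<^sup>+b. f (c * a - s * b) (s * a + c * b) \<partial>lborel \<partial>lborel)"
    by (simp only: add.commute[of _ "s * _"] e1 e2)
  finally show ?thesis by simp
qed

lemma std_normal_rotation:
  fixes f :: "real \<Rightarrow> real \<Rightarrow> ennreal"
  assumes f [measurable]: "(\<lambda>(a, b). f a b) \<in> borel_measurable (borel \<Otimes>\<^sub>M borel)"
    and cs: "c\<^sup>2 + s\<^sup>2 = 1" "s \<noteq> 0"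
  shows "(\<integral>\<^sup>+a. \<integral>\<^sup>+b. f (c * a - s * b) (s * a + c * b) \<partial>std_normal \<partial>std_normal)
    = (\<integral>\<^sup>+a. \<integral>\<^sup>+b. f a b \<partial>std_normal \<partial>std_normal)"
proof -
  let ?\<phi> = "\<lambda>t. ennreal (std_normal_density t)"
  have expand: "(\<integral>\<^sup>+a. \<integral>\<^sup>+b. g a b \<partial>std_normal \<partial>std_normal)
      = (\<integral>\<^sup>+a. \<integral>\<^sup>+b. ?\<phi> a * ?\<phi> b * g a b \<partial>lborel \<partial>lborel)"
    if g [measurable]: "(\<lambda>(a, b). g a b) \<in> borel_measurable (borel \<Otimes>\<^sub>M borel)" for g
  proof -
    have g1 [measurable]: "g a \<in> borel_measurable borel" for a
      using measurable_compose[OF _ g, of "\<lambda>b. (a, b)" borel] by simp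
    have [measurable]: "(\<lambda>a. \<integral>\<^sup>+b. ?\<phi> b * g a b \<partial>lborel) \<in> borel_measurable borel"
      by (rule lborel.borel_measurable_nn_integral) measurable
    show ?thesis
      by (simp add: nn_integral_std_normal nn_integral_cmult[symmetric] mult.assoc)
  qed
  have rot: "?\<phi> (c * a - s * b) * ?\<phi> (s * a + c * b) = ?\<phi> a * ?\<phi> b" for a b
  proof -
    have "(c * a - s * b)\<^sup>2 + (s * a + c * b)\<^sup>2 = (c\<^sup>2 + s\<^sup>2) * (a\<^sup>2 + b\<^sup>2)"
      by (simp add: power2_eq_square algebra_simps)
    then have e: "(c * a - s * b)\<^sup>2 + (s * a + c * b)\<^sup>2 = a\<^sup>2 + b\<^sup>2" unfolding cs by simp
    have "exp (- (c * a - s * b)\<^sup>2 / 2) * exp (- (s * a + c * b)\<^sup>2 / 2) = exp (- ((c * a - s * b)\<^sup>2 + (s * a + c * b)\<^sup>2) / 2)"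
      by (simp add: exp_add[symmetric] add_divide_distrib diff_divide_distrib)
    also have "\<dots> = exp (- a\<^sup>2 / 2) * exp (- b\<^sup>2 / 2)"
      unfolding e by (simp add: exp_add[symmetric] add_divide_distrib diff_divide_distrib)
    finally show ?thesis
      by (simp add: std_normal_density_def ennreal_mult[symmetric])
  qed
  have "(\<integral>\<^sup>+a. \<integral>\<^sup>+b. f (c * a - s * b) (s * a + c * b) \<partial>std_normal \<partial>std_normal)
      = (\<integral>\<^sup>+a. \<integral>\<^sup>+b. ?\<phi> a * ?\<phi> b * f (c * a - s * b) (s * a + c * b) \<partial>lborel \<partial>lborel)"
  proof (rule expand)
    have "(\<lambda>(a, b). (c * a - s * b, s * a + c * b)) \<in> borel \<Otimes>\<^sub>M borel \<rightarrow>\<^sub>M borel \<Otimes>\<^sub>M borel" by measurable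
    from measurable_compose[OF this f]
    show "(\<lambda>(a, b). f (c * a - s * b) (s * a + c * b)) \<in> borel_measurable (borel \<Otimes>\<^sub>M borel)"
      by (simp add: case_prod_unfold)
  qed
  also have "\<dots> = (\<integral>\<^sup>+a. \<integral>\<^sup>+b. ?\<phi> (c * a - s * b) * ?\<phi> (s * a + c * b) * f (c * a - s * b) (s * a + c * b) \<partial>lborel \<partial>lborel)"
    unfolding rot ..
  also have "\<dots> = (\<integral>\<^sup>+a. \<integral>\<^sup>+b. ?\<phi> a * ?\<phi> b * f a b \<partial>lborel \<partial>lborel)"
    by (rule nn_integral_rotation[OF _ cs, where f = "\<lambda>a b. ?\<phi> a * ?\<phi> b * f a b"]) measurable
  also have "\<dots> = (\<integral>\<^sup>+a. \<integral>\<^sup>+b. f a b \<partial>std_normal \<partial>std_normal)" by (rule expand[OF f, symmetric])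
  finally show ?thesis .
qed

definition smul :: "real \<Rightarrow> (nat \<Rightarrow> real) \<Rightarrow> nat \<Rightarrow> real" where
  "smul t u = (\<lambda>k. t * u k)"

lemma smul_apply [simp]: "smul t u k = t * u k"
  by (simp add: smul_def)

text \<open>
  The expectation of \<open>h (v + g\<^sub>1 u\<^sub>1 + \<dots> + g\<^sub>n u\<^sub>n)\<close> for independent standard normal variables \<open>g\<^sub>i\<close>.  As an
  iterated integral it can be changed at two neighbouring list entries without touching the others.
\<close>

primrec gauss_avg :: "((nat \<Rightarrow> real) \<Rightarrow> ennreal) \<Rightarrow> (nat \<Rightarrow> real) list \<Rightarrow> (nat \<Rightarrow> real) \<Rightarrow> ennreal" where
  "gauss_avg h [] v = h v"
| "gauss_avg h (u # us) v = (\<integral>\<^sup>+t. gauss_avg h us (v + smul t u) \<partial>std_normal)"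

lemma measurable_fun_coord:
  fixes f :: "'a \<Rightarrow> nat \<Rightarrow> real"
  assumes "f \<in> borel_measurable M"
  shows "(\<lambda>x. f x i) \<in> borel_measurable M"
  using measurable_compose[OF assms, of "\<lambda>v. v i" borel]
  by (simp add: borel_measurable_continuous_onI continuous_on_product_coordinates)

lemma measurable_plus_smul:
  assumes "f \<in> borel_measurable M" "g \<in> borel_measurable M"
  shows "(\<lambda>x. f x + smul (g x) u) \<in> borel_measurable M"
proof (rule measurable_coordinatewise_then_product)
  fix i
  show "(\<lambda>x. (f x + smul (g x) u) i) \<in> borel_measurable M"
    using measurable_fun_coord[OF assms(1), of i] assms(2) by simp
qed

lemma measurable_gauss_avg:
  assumes h: "h \<in> borel_measurable borel"
  shows "gauss_avg h us \<in> borel_measurable borel"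
proof (induction us)
  case Nil
  have "gauss_avg h [] = h" by (simp add: fun_eq_iff)
  then show ?case using h by simp
next
  case (Cons u us)
  interpret N: prob_space std_normal by (rule prob_space_std_normal)
  have "(\<lambda>x. fst x + smul (snd x) u) \<in> (borel :: (nat \<Rightarrow> real) measure) \<Otimes>\<^sub>M std_normal \<rightarrow>\<^sub>M borel"
    by (rule measurable_plus_smul) (auto intro: measurable_fst measurable_snd'')
  from measurable_compose[OF this Cons]
  have "(\<lambda>v. \<integral>\<^sup>+t. gauss_avg h us (v + smul t u) \<partial>std_normal) \<in> borel_measurable borel"
    by (intro N.borel_measurable_nn_integral) (unfold case_prod_unfold)
  moreover have "gauss_avg h (u # us) = (\<lambda>v. \<integral>\<^sup>+t. gauss_avg h us (v + smul t u) \<partial>std_normal)"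
    by (simp add: fun_eq_iff)
  ultimately show ?case by simp
qed

lemma measurable_line:
  assumes "H \<in> borel_measurable borel"
  shows "(\<lambda>t. H (v + smul t u)) \<in> borel_measurable borel"
  by (rule measurable_compose[OF measurable_plus_smul assms]) auto

lemma gauss_avg_rotate:
  assumes h: "h \<in> borel_measurable borel" and cs: "c\<^sup>2 + s\<^sup>2 = 1" "s \<noteq> 0"
  shows "gauss_avg h ((smul c u + smul s w) # (smul c w - smul s u) # us) v = gauss_avg h (u # w # us) v"
proof -
  have m: "(\<lambda>(a, b). gauss_avg h us (v + smul a u + smul b w)) \<in> borel_measurable (borel \<Otimes>\<^sub>M borel)"
    unfolding case_prod_unfold
    by (rule measurable_compose[OF measurable_plus_smul measurable_gauss_avg[OF h]],
        rule measurable_plus_smul) auto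
  have e: "v + smul a (smul c u + smul s w) + smul b (smul c w - smul s u)
      = v + smul (c * a - s * b) u + smul (s * a + c * b) w" for a b
    by (simp add: fun_eq_iff algebra_simps)
  show ?thesis
    using std_normal_rotation[OF m cs] by (simp only: gauss_avg.simps e)
qed

lemma gauss_avg_zero: "gauss_avg h (0 # us) v = gauss_avg h us v"
proof -
  interpret prob_space std_normal by (rule prob_space_std_normal)
  have "smul t 0 = 0" for t by (simp add: fun_eq_iff)
  then show ?thesis by (simp add: emeasure_space_1[simplified])
qed

text \<open>
Rotate the pair \<open>(u, 0)\<close>; the zero vector contributes nothing to the average.
\<close>

lemma gauss_avg_split:
  assumes h: "h \<in> borel_measurable borel" and \<tau>: "\<tau>\<^sup>2 < 1"
  shows "gauss_avg h (smul \<tau> u # smul (sqrt (1 - \<tau>\<^sup>2)) u # us) v = gauss_avg h (u # us) v"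
proof -
  have "gauss_avg h ((smul \<tau> u + smul (- sqrt (1 - \<tau>\<^sup>2)) 0) # (smul \<tau> 0 - smul (- sqrt (1 - \<tau>\<^sup>2)) u) # us) v
      = gauss_avg h (u # 0 # us) v"
    using \<tau> by (intro gauss_avg_rotate h) auto
  moreover have "smul \<tau> u + smul (- sqrt (1 - \<tau>\<^sup>2)) 0 = smul \<tau> u"
    "smul \<tau> 0 - smul (- sqrt (1 - \<tau>\<^sup>2)) u = smul (sqrt (1 - \<tau>\<^sup>2)) u"
    by (simp_all add: fun_eq_iff)
  ultimately have "gauss_avg h (smul \<tau> u # smul (sqrt (1 - \<tau>\<^sup>2)) u # us) v = gauss_avg h (u # 0 # us) v"
    by (simp del: gauss_avg.simps)
  also have "\<dots> = gauss_avg h (u # us) v"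
    by (simp only: gauss_avg.simps(2)[of _ u] gauss_avg_zero)
  finally show ?thesis .
qed

text \<open>
Jensen's inequality: the distribution of \<open>g\<close> is symmetric and \<open>h\<close> is convex at midpoints.
\<close>

lemma gauss_avg_ge:
  assumes h: "h \<in> borel_measurable borel"
    and conv: "\<And>v u. 2 * h v \<le> h (v + u) + h (v - u)"
  shows "h v \<le> gauss_avg h us v"
proof (induction us arbitrary: v)
  case (Cons u us)
  interpret prob_space std_normal by (rule prob_space_std_normal)
  have m: "(\<lambda>t. h (v + smul t u)) \<in> borel_measurable borel" by (rule measurable_line[OF h])
  have m': "(\<lambda>t. h (v + smul (- t) u)) \<in> borel_measurable borel"
    using measurable_compose[OF _ m, of uminus borel] by simp
  have "2 * h v = (\<integral>\<^sup>+t. 2 * h v \<partial>std_normal)"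
    by (simp add: emeasure_space_1[simplified])
  also have "\<dots> \<le> (\<integral>\<^sup>+t. h (v + smul t u) + h (v + smul (- t) u) \<partial>std_normal)"
  proof (rule nn_integral_mono)
    fix t
    have "v + smul (- t) u = v - smul t u" by (simp add: fun_eq_iff)
    then show "2 * h v \<le> h (v + smul t u) + h (v + smul (- t) u)"
      using conv[of v "smul t u"] by simp
  qed
  also have "\<dots> = 2 * (\<integral>\<^sup>+t. h (v + smul t u) \<partial>std_normal)"
    using m m' nn_integral_std_normal_uminus[OF m] by (simp add: nn_integral_add mult_2)
  finally have "h v \<le> (\<integral>\<^sup>+t. h (v + smul t u) \<partial>std_normal)"
    by (simp add: ennreal_mult_le_mult_iff)
  also have "\<dots> \<le> gauss_avg h (u # us) v"
    by (simp add: nn_integral_mono Cons)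
  finally show ?case .
qed simp

section \<open>Gaussian averages of contracted families\<close>


text \<open>
  Each entry carries a vector together with its row of coefficients.  Rotating neighbouring entries,
  vectors and rows simultaneously, from the end of the list to its front moves the whole
  column \<open>i\<close> of coefficients into the first entry.  A rotation of two entries preserves every sum over the
  list of a quadratic expression in the entries; this covers the linear combinations of the vectors
  and the norms of the combinations of the columns.
\<close>

lemma givens_elimination:
  fixes ps :: "((nat \<Rightarrow> real) \<times> ('i \<Rightarrow> real)) list"
  assumes h: "h \<in> borel_measurable borel" and "ps \<noteq> []"
  shows "\<exists>q qs. (\<forall>v. gauss_avg h (map fst (q # qs)) v = gauss_avg h (map fst ps) v) \<and>
      (\<forall>x\<in>set qs. snd x i = 0) \<and>
      (\<forall>j k. (\<Sum>x\<leftarrow>q # qs. snd x j * fst x k) = (\<Sum>x\<leftarrow>ps. snd x j * fst x k)) \<and>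
      (\<forall>I b. (\<Sum>x\<leftarrow>q # qs. (\<Sum>j\<in>I. b j * snd x j)\<^sup>2) = (\<Sum>x\<leftarrow>ps. (\<Sum>j\<in>I. b j * snd x j)\<^sup>2))"
  using assms(2)
proof (induction ps)
  case (Cons p ps)
  show ?case
  proof (cases "ps = []")
    case True
    then show ?thesis by (intro exI[of _ p] exI[of _ "[]"]) simp
  next
    case False
    from Cons.IH[OF False] obtain q qs where
      g: "\<And>v. gauss_avg h (map fst (q # qs)) v = gauss_avg h (map fst ps) v"
      and z: "\<And>x. x \<in> set qs \<Longrightarrow> snd x i = 0"
      and s1: "\<And>j k. (\<Sum>x\<leftarrow>q # qs. snd x j * fst x k) = (\<Sum>x\<leftarrow>ps. snd x j * fst x k)"
      and s2: "\<And>I b. (\<Sum>x\<leftarrow>q # qs. (\<Sum>j\<in>I. b j * snd x j)\<^sup>2) = (\<Sum>x\<leftarrow>ps. (\<Sum>j\<in>I. b j * snd x j)\<^sup>2)"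
      by blast
    have gp: "gauss_avg h (map fst (p # q # qs)) v = gauss_avg h (map fst (p # ps)) v" for v
      using g by simp
    show ?thesis
    proof (cases "snd q i = 0")
      case True
      show ?thesis
        by (intro exI[of _ p] exI[of _ "q # qs"]) (use True z gp s1 s2 in auto)
    next
      case nz: False
      define \<rho> where "\<rho> = sqrt ((snd p i)\<^sup>2 + (snd q i)\<^sup>2)"
      have \<rho>2: "\<rho>\<^sup>2 = (snd p i)\<^sup>2 + (snd q i)\<^sup>2" by (simp add: \<rho>_def)
      have \<rho>: "\<rho> > 0" using nz by (simp add: \<rho>_def add_nonneg_pos)
      define c where "c = snd p i / \<rho>"
      define s where "s = snd q i / \<rho>"
      have cs: "c\<^sup>2 + s\<^sup>2 = 1"
        using \<rho> by (simp add: c_def s_def power_divide flip: add_divide_distrib \<rho>2)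
      have s0: "s \<noteq> 0" using nz \<rho> by (simp add: s_def)
      define p' where "p' = (smul c (fst p) + smul s (fst q), \<lambda>j. c * snd p j + s * snd q j)"
      define q' where "q' = (smul c (fst q) - smul s (fst p), \<lambda>j. c * snd q j - s * snd p j)"
      have bil: "(c * a + s * b) * (c * a' + s * b') + (c * b - s * a) * (c * b' - s * a') = a * a' + b * b'" for a b a' b'
      proof -
        have "(c * a + s * b) * (c * a' + s * b') + (c * b - s * a) * (c * b' - s * a') = (c\<^sup>2 + s\<^sup>2) * (a * a' + b * b')"
          by (simp add: power2_eq_square algebra_simps)
        then show ?thesis using cs by simp
      qed
      have 1: "gauss_avg h (map fst (p' # q' # qs)) v = gauss_avg h (map fst (p # ps)) v" for v
        using gauss_avg_rotate[OF h cs s0, of "fst p" "fst q" "map fst qs" v] gp[of v]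
        by (simp add: p'_def q'_def del: gauss_avg.simps)
      have 2: "snd x i = 0" if "x \<in> set (q' # qs)" for x
        using that z[of x] by (auto simp: q'_def c_def s_def)
      have 3: "(\<Sum>x\<leftarrow>p' # q' # qs. snd x j * fst x k) = (\<Sum>x\<leftarrow>p # ps. snd x j * fst x k)" for j k
        using s1[of j k] bil[of "snd p j" "snd q j" "fst p k" "fst q k"] by (simp add: p'_def q'_def)
      have 4: "(\<Sum>x\<leftarrow>p' # q' # qs. (\<Sum>j\<in>I. b j * snd x j)\<^sup>2) = (\<Sum>x\<leftarrow>p # ps. (\<Sum>j\<in>I. b j * snd x j)\<^sup>2)" for I b
      proof -
        have "(\<Sum>j\<in>I. b j * snd p' j) = c * (\<Sum>j\<in>I. b j * snd p j) + s * (\<Sum>j\<in>I. b j * snd q j)"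
          by (simp add: p'_def sum_distrib_left sum.distrib algebra_simps)
        moreover have "(\<Sum>j\<in>I. b j * snd q' j) = c * (\<Sum>j\<in>I. b j * snd q j) - s * (\<Sum>j\<in>I. b j * snd p j)"
          by (simp add: q'_def sum_distrib_left sum_subtractf algebra_simps)
        ultimately show ?thesis
          using s2[of b I] bil[of "\<Sum>j\<in>I. b j * snd p j" "\<Sum>j\<in>I. b j * snd q j" "\<Sum>j\<in>I. b j * snd p j" "\<Sum>j\<in>I. b j * snd q j"]
          by (simp add: power2_eq_square)
      qed
      show ?thesis
        by (intro exI[of _ p'] exI[of _ "q' # qs"] conjI allI ballI 1 3 4) (rule 2)
    qed
  qed
qed simp

text \<open>
  Treat one column \<open>i\<close> at a time.  After the elimination the combination with coefficients from
  column \<open>i\<close> is \<open>\<tau>\<close> times the first vector \<open>u\<close>, and \<open>\<tau>\<^sup>2 \<le> \<rho> < 1\<close>.  The Gaussian average does not change when \<open>u\<close>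
  is split into \<open>\<tau> u\<close> and \<open>\<gamma> u\<close> with \<open>\<gamma>\<^sup>2 = 1 - \<tau>\<^sup>2\<close>.  The first of these is the wanted combination; \<open>\<gamma> u\<close> replaces
  \<open>u\<close>, with its row divided by \<open>\<gamma>\<close>, and the remaining columns still form a matrix with squared norm at most \<open>\<rho>\<close>.  When no
  column is left, the leftover vectors can be dropped by Jensen's inequality.
\<close>

theorem gauss_avg_contraction:
  fixes ps :: "((nat \<Rightarrow> real) \<times> ('i \<Rightarrow> real)) list"
  assumes h: "h \<in> borel_measurable borel"
    and conv: "\<And>v u. 2 * h v \<le> h (v + u) + h (v - u)"
    and \<rho>: "\<rho> < 1"
    and "ps \<noteq> []" "distinct js"
    and "\<And>b. (\<Sum>x\<leftarrow>ps. (\<Sum>j\<in>set js. b j * snd x j)\<^sup>2) \<le> \<rho> * (\<Sum>j\<in>set js. (b j)\<^sup>2)"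
  shows "gauss_avg h (map (\<lambda>j k. \<Sum>x\<leftarrow>ps. snd x j * fst x k) js) v \<le> gauss_avg h (map fst ps) v"
  using assms(4-)
proof (induction js arbitrary: ps v)
  case Nil
  then show ?case using gauss_avg_ge[OF h conv] by simp
next
  case (Cons i js)
  from givens_elimination[OF h Cons.prems(1), of i] obtain q qs where
      g: "\<And>v. gauss_avg h (map fst (q # qs)) v = gauss_avg h (map fst ps) v"
      and z: "\<And>x. x \<in> set qs \<Longrightarrow> snd x i = 0"
      and s1: "\<And>j k. (\<Sum>x\<leftarrow>q # qs. snd x j * fst x k) = (\<Sum>x\<leftarrow>ps. snd x j * fst x k)"
      and s2: "\<And>I b. (\<Sum>x\<leftarrow>q # qs. (\<Sum>j\<in>I. b j * snd x j)\<^sup>2) = (\<Sum>x\<leftarrow>ps. (\<Sum>j\<in>I. b j * snd x j)\<^sup>2)"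
    by blast
  have i: "i \<notin> set js" using Cons.prems(2) by simp
  define \<tau> where "\<tau> = snd q i"
  define \<gamma> where "\<gamma> = sqrt (1 - \<tau>\<^sup>2)"
  have ins: "(\<Sum>x\<leftarrow>q # qs. (\<beta> * snd x i + (\<Sum>j\<in>set js. b j * snd x j))\<^sup>2) \<le> \<rho> * (\<beta>\<^sup>2 + (\<Sum>j\<in>set js. (b j)\<^sup>2))" for \<beta> b
  proof -
    have e: "(\<Sum>j\<in>set (i # js). (b(i := \<beta>)) j * snd x j) = \<beta> * snd x i + (\<Sum>j\<in>set js. b j * snd x j)" for x :: "(nat \<Rightarrow> real) \<times> ('i \<Rightarrow> real)"
      using i by (simp, intro sum.cong) auto
    have e2: "(\<Sum>j\<in>set (i # js). ((b(i := \<beta>)) j)\<^sup>2) = \<beta>\<^sup>2 + (\<Sum>j\<in>set js. (b j)\<^sup>2)"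
      using i by (simp, intro sum.cong) auto
    show ?thesis
      using Cons.prems(3)[of "b(i := \<beta>)"] s2[of "b(i := \<beta>)" "set (i # js)"] unfolding e e2 by linarith
  qed
  have rest0: "(\<Sum>x\<leftarrow>qs. (\<beta> * snd x i + (\<Sum>j\<in>set js. b j * snd x j))\<^sup>2) = (\<Sum>x\<leftarrow>qs. (\<Sum>j\<in>set js. b j * snd x j)\<^sup>2)" for \<beta> b
    using z by (intro arg_cong[where f = sum_list] map_cong) auto
  have nonneg: "(\<Sum>x\<leftarrow>qs. (\<Sum>j\<in>set js. b j * snd x j)\<^sup>2) \<ge> 0" for b
    by (rule sum_list_nonneg) auto
  have "\<tau>\<^sup>2 \<le> \<rho>"
    using ins[of 1 "\<lambda>_. 0"] rest0[of 1 "\<lambda>_. 0"] by (simp add: \<tau>_def o_def)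
  then have \<tau>: "\<tau>\<^sup>2 < 1" using \<rho> by simp
  then have \<gamma>: "\<gamma> > 0" "\<gamma>\<^sup>2 = 1 - \<tau>\<^sup>2" by (simp_all add: \<gamma>_def)
  define q' where "q' = (smul \<gamma> (fst q), \<lambda>j. snd q j / \<gamma>)"
  have cols: "(\<Sum>x\<leftarrow>q' # qs. snd x j * fst x k) = (\<Sum>x\<leftarrow>ps. snd x j * fst x k)" for j k
    using s1[of j k] \<gamma>(1) by (simp add: q'_def)
  have zi: "(\<lambda>k. \<Sum>x\<leftarrow>ps. snd x i * fst x k) = smul \<tau> (fst q)"
  proof
    fix k
    have "(\<Sum>x\<leftarrow>qs. snd x i * fst x k) = 0"
    proof -
      have "map (\<lambda>x. snd x i * fst x k) qs = map (\<lambda>_. 0) qs" using z by simp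
      then show ?thesis by (simp only: sum_list_0)
    qed
    then show "(\<Sum>x\<leftarrow>ps. snd x i * fst x k) = smul \<tau> (fst q) k"
      unfolding s1[symmetric] by (simp add: \<tau>_def)
  qed
  have quad: "(\<Sum>x\<leftarrow>q' # qs. (\<Sum>j\<in>set js. b j * snd x j)\<^sup>2) \<le> \<rho> * (\<Sum>j\<in>set js. (b j)\<^sup>2)" for b
  proof -
    define c where "c = (\<Sum>j\<in>set js. b j * snd q j)"
    define R where "R = (\<Sum>x\<leftarrow>qs. (\<Sum>j\<in>set js. b j * snd x j)\<^sup>2)"
    \<comment> \<open>With this multiple of column \<open>i\<close> added, the first entry becomes \<open>c / \<gamma>\<^sup>2\<close>.\<close>
    define \<beta> where "\<beta> = c * \<tau> / \<gamma>\<^sup>2"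
    have "(\<beta> * \<tau> + c)\<^sup>2 + R \<le> \<rho> * (\<beta>\<^sup>2 + (\<Sum>j\<in>set js. (b j)\<^sup>2))"
      using ins[of \<beta> b] rest0[of \<beta> b] by (simp add: \<tau>_def c_def R_def)
    moreover have "\<beta> * \<tau> + c = c / \<gamma>\<^sup>2"
    proof -
      have "\<beta> * \<tau> + c = c * (\<tau>\<^sup>2 + \<gamma>\<^sup>2) / \<gamma>\<^sup>2"
        using \<gamma>(1) by (simp add: \<beta>_def field_simps power2_eq_square)
      then show ?thesis using \<gamma>(2) by simp
    qed
    moreover have "c\<^sup>2 / \<gamma>\<^sup>2 \<le> (c / \<gamma>\<^sup>2)\<^sup>2 - \<rho> * \<beta>\<^sup>2"
    proof -
      have "\<rho> * \<beta>\<^sup>2 \<le> 1 * \<beta>\<^sup>2" using \<rho> by (intro mult_right_mono) auto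
      moreover have "(c / \<gamma>\<^sup>2)\<^sup>2 - \<beta>\<^sup>2 = c\<^sup>2 * (1 - \<tau>\<^sup>2) / (\<gamma>\<^sup>2)\<^sup>2"
        by (simp add: \<beta>_def power_divide power_mult_distrib right_diff_distrib diff_divide_distrib)
      moreover have "\<dots> = c\<^sup>2 / \<gamma>\<^sup>2"
        unfolding \<gamma>(2)[symmetric] using \<gamma>(1) by (simp add: power2_eq_square)
      ultimately show ?thesis by linarith
    qed
    ultimately have "c\<^sup>2 / \<gamma>\<^sup>2 + R \<le> \<rho> * (\<Sum>j\<in>set js. (b j)\<^sup>2)"
      by (simp add: distrib_left)
    moreover have "(\<Sum>j\<in>set js. b j * snd q' j) = c / \<gamma>"
      by (simp add: q'_def c_def sum_divide_distrib)
    ultimately show ?thesis by (simp add: R_def power_divide)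
  qed
  have "gauss_avg h (map (\<lambda>j k. \<Sum>x\<leftarrow>ps. snd x j * fst x k) (i # js)) v
      = (\<integral>\<^sup>+t. gauss_avg h (map (\<lambda>j k. \<Sum>x\<leftarrow>q' # qs. snd x j * fst x k) js) (v + smul t (smul \<tau> (fst q))) \<partial>std_normal)"
    by (simp only: cols) (simp only: list.map gauss_avg.simps zi)
  also have "\<dots> \<le> (\<integral>\<^sup>+t. gauss_avg h (map fst (q' # qs)) (v + smul t (smul \<tau> (fst q))) \<partial>std_normal)"
    using Cons.prems(2) quad by (intro nn_integral_mono Cons.IH) auto
  also have "\<dots> = gauss_avg h (smul \<tau> (fst q) # smul \<gamma> (fst q) # map fst qs) v"
    by (simp add: q'_def)
  also have "\<dots> = gauss_avg h (map fst ps) v"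
    unfolding \<gamma>_def gauss_avg_split[OF h \<tau>] g[symmetric] by simp
  finally show ?case .
qed

lemma std_normal_first_abs_moment:
  "integrable std_normal (\<lambda>t. \<bar>t\<bar>)" "(\<integral>t. \<bar>t\<bar> \<partial>std_normal) = sqrt (2 / pi)"
proof -
  have b: "has_bochner_integral lborel (\<lambda>t. std_normal_density t *\<^sub>R \<bar>t\<bar>) (sqrt (2 / pi))"
    using std_normal_moment_abs_odd[of 0] by simp
  have d: "has_bochner_integral std_normal (\<lambda>t. \<bar>t\<bar>) (sqrt (2 / pi))"
    unfolding std_normal_def by (rule has_bochner_integral_density[OF _ _ _ b]) auto
  show "integrable std_normal (\<lambda>t. \<bar>t\<bar>)" "(\<integral>t. \<bar>t\<bar> \<partial>std_normal) = sqrt (2 / pi)"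
    using d by (auto simp: has_bochner_integral_iff)
qed

lemma nn_integral_std_normal_square: "(\<integral>\<^sup>+t. ennreal (t\<^sup>2) \<partial>std_normal) = 1"
proof -
  have b: "has_bochner_integral lborel (\<lambda>t. std_normal_density t * t\<^sup>2) 1"
    using std_normal_moment_even[of 1] by (simp add: fact_2)
  have "(\<integral>\<^sup>+t. ennreal (t\<^sup>2) \<partial>std_normal) = (\<integral>\<^sup>+t. ennreal (std_normal_density t * t\<^sup>2) \<partial>lborel)"
    by (subst nn_integral_std_normal) (auto simp: ennreal_mult)
  also have "\<dots> = ennreal 1"
    using nn_integral_eq_integral[of lborel "\<lambda>t. std_normal_density t * t\<^sup>2"] b
    by (simp add: has_bochner_integral_iff)
  finally show ?thesis by simp
qed

text \<open>
  Jensen's inequality for \<open>\<bar>g\<bar>\<close>, whose mean is \<open>\<surd>(2 / \<pi>)\<close>, applied to the even part of \<open>k\<close>.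
\<close>

lemma convex_std_normal:
  fixes k :: "real \<Rightarrow> real"
  assumes k: "convex_on UNIV k" and nn: "\<And>t. k t \<ge> 0"
  shows "ennreal ((k (sqrt (2 / pi)) + k (- sqrt (2 / pi))) / 2) \<le> (\<integral>\<^sup>+t. ennreal (k t) \<partial>std_normal)"
proof (cases "(\<integral>\<^sup>+t. ennreal (k t) \<partial>std_normal) = \<infinity>")
  case False
  interpret prob_space std_normal by (rule prob_space_std_normal)
  have "continuous_on UNIV k" by (rule convex_on_continuous[OF _ k]) simp
  then have km [measurable]: "k \<in> borel_measurable borel" by (rule borel_measurable_continuous_onI)
  define K where "K t = (k t + k (- t)) / 2" for t
  have Kabs: "K \<bar>t\<bar> = K t" for t by (auto simp: K_def abs_if)
  have "convex_on UNIV (\<lambda>t. k (- t))"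
  proof (rule convex_onI)
    fix t x y :: real assume "0 < t" "t < 1"
    then show "k (- ((1 - t) *\<^sub>R x + t *\<^sub>R y)) \<le> (1 - t) * k (- x) + t * k (- y)"
      using convex_onD[OF k, of t "- x" "- y"] by simp
  qed simp
  then have Kc: "convex_on UNIV K"
    unfolding K_def using convex_on_add[OF k] by (intro convex_on_cdiv) auto
  have m1: "(\<lambda>t. ennreal (k t)) \<in> borel_measurable borel" by measurable
  have i1: "integrable std_normal k"
    using False nn by (intro integrableI_nonneg) (auto simp: less_top)
  have i2: "integrable std_normal (\<lambda>t. k (- t))"
    using False nn nn_integral_std_normal_uminus[OF m1] by (intro integrableI_nonneg) (auto simp: less_top)
  have iK: "integrable std_normal (\<lambda>t. K \<bar>t\<bar>)"
    using i1 i2 by (simp only: Kabs) (simp add: K_def)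
  have "K (expectation (\<lambda>t. \<bar>t\<bar>)) \<le> expectation (\<lambda>t. K \<bar>t\<bar>)"
    by (rule jensens_inequality[OF std_normal_first_abs_moment(1) _ _ iK Kc]) auto
  also have "expectation (\<lambda>t. K \<bar>t\<bar>) = (expectation k + expectation (\<lambda>t. k (- t))) / 2"
    using i1 i2 by (simp only: Kabs) (simp add: K_def)
  also have "expectation (\<lambda>t. k (- t)) = expectation k"
    using nn_integral_std_normal_uminus[OF m1] nn
    by (simp add: integral_eq_nn_integral)
  finally have "K (sqrt (2 / pi)) \<le> expectation k" by (simp add: std_normal_first_abs_moment)
  then show ?thesis
    using nn_integral_eq_integral[OF i1] nn by (simp add: K_def ennreal_leI)
qed simp

section \<open>Type 2 for Gaussian averages\<close>


lemma convex_line_sign_avg: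
  fixes h :: "(nat \<Rightarrow> real) \<Rightarrow> real"
  assumes "\<And>v u. convex_on UNIV (\<lambda>t. h (v + smul t u))"
  shows "convex_on UNIV (\<lambda>t. sign_avg h us (v + smul t u))"
proof (induction us arbitrary: v)
  case (Cons w us)
  have e: "v + smul t u + w = (v + w) + smul t u" "v + smul t u - w = (v - w) + smul t u" for t
    by (simp_all add: fun_eq_iff)
  show ?case
    unfolding sign_avg.simps e by (intro convex_on_cdiv convex_on_add Cons) auto
qed (use assms in simp)

lemma sign_avg_nonneg:
  assumes "\<And>v. h v \<ge> 0"
  shows "sign_avg h us v \<ge> 0"
  using assms by (induction us arbitrary: v) (auto intro!: add_nonneg_nonneg)

text \<open>
  A standard normal variable has conditional mean \<open>\<plusminus>\<surd>(2 / \<pi>)\<close> given its sign, so convexity allows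
  each sign to be replaced by a Gaussian variable, one at a time.
\<close>

lemma sign_avg_le_gauss_avg:
  fixes h :: "(nat \<Rightarrow> real) \<Rightarrow> real"
  assumes conv: "\<And>v u. convex_on UNIV (\<lambda>t. h (v + smul t u))" and nn: "\<And>v. h v \<ge> 0"
  shows "ennreal (sign_avg h (map (smul (sqrt (2 / pi))) us) v) \<le> gauss_avg (\<lambda>x. ennreal (h x)) us v"
proof (induction us arbitrary: v)
  case (Cons u us)
  define k where "k t = sign_avg h (map (smul (sqrt (2 / pi))) us) (v + smul t u)" for t
  have "v + smul (- sqrt (2 / pi)) u = v - smul (sqrt (2 / pi)) u" by (simp add: fun_eq_iff)
  then have "sign_avg h (map (smul (sqrt (2 / pi))) (u # us)) v = (k (sqrt (2 / pi)) + k (- sqrt (2 / pi))) / 2"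
    by (simp add: k_def)
  also have "ennreal \<dots> \<le> (\<integral>\<^sup>+t. ennreal (k t) \<partial>std_normal)"
    unfolding k_def by (intro convex_std_normal convex_line_sign_avg conv sign_avg_nonneg nn)
  also have "\<dots> \<le> gauss_avg (\<lambda>x. ennreal (h x)) (u # us) v"
    unfolding k_def gauss_avg.simps by (intro nn_integral_mono Cons)
  finally show ?case .
qed simp

lemma sign_avg_homogeneous:
  fixes h :: "(nat \<Rightarrow> real) \<Rightarrow> real"
  assumes hom: "\<And>t v. h (smul t v) = t\<^sup>2 * h v"
  shows "sign_avg h (map (smul \<kappa>) us) (smul \<kappa> v) = \<kappa>\<^sup>2 * sign_avg h us v"
proof (induction us arbitrary: v)
  case (Cons u us)
  have "smul \<kappa> v + smul \<kappa> u = smul \<kappa> (v + u)" "smul \<kappa> v - smul \<kappa> u = smul \<kappa> (v - u)"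
    by (simp_all add: fun_eq_iff algebra_simps)
  then show ?case by (simp only: list.map sign_avg.simps Cons distrib_left times_divide_eq_right)
qed (simp only: list.map sign_avg.simps hom)

lemma measurable_sign_avg:
  fixes h :: "(nat \<Rightarrow> real) \<Rightarrow> real"
  assumes h: "h \<in> borel_measurable borel"
  shows "sign_avg h us \<in> borel_measurable borel"
proof (induction us)
  case Nil
  have "sign_avg h [] = h" by (simp add: fun_eq_iff)
  then show ?case using h by simp
next
  case (Cons u us)
  have "(\<lambda>v. v + smul c u) \<in> borel \<rightarrow>\<^sub>M borel" for c
    by (rule measurable_plus_smul) auto
  note m = measurable_compose[OF this Cons]
  have "(\<lambda>v. (sign_avg h us (v + smul 1 u) + sign_avg h us (v + smul (- 1) u)) / 2) \<in> borel_measurable borel"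
    by (intro borel_measurable_divide borel_measurable_add m borel_measurable_const)
  moreover have "v + smul 1 u = v + u" "v + smul (- 1) u = v - u" for v
    by (simp_all add: fun_eq_iff)
  moreover have "sign_avg h (u # us) = (\<lambda>v. (sign_avg h us (v + u) + sign_avg h us (v - u)) / 2)"
    by (simp add: fun_eq_iff)
  ultimately show ?case by simp
qed

lemma gauss_avg_sign_avg_Cons:
  fixes h :: "(nat \<Rightarrow> real) \<Rightarrow> real"
  assumes h: "h \<in> borel_measurable borel" and nn: "\<And>v. h v \<ge> 0"
  shows "2 * gauss_avg (\<lambda>x. ennreal (sign_avg h (r # rs) x)) us v
    = gauss_avg (\<lambda>x. ennreal (sign_avg h rs x)) us (v + r) + gauss_avg (\<lambda>x. ennreal (sign_avg h rs x)) us (v - r)"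
proof (induction us arbitrary: v)
  case Nil
  have half: "2 * ennreal ((a + b) / 2) = ennreal a + ennreal b" if "a \<ge> 0" "b \<ge> 0" for a b
  proof -
    have "2 * ennreal ((a + b) / 2) = ennreal (2 * ((a + b) / 2))"
      using that by (subst ennreal_mult) auto
    also have "2 * ((a + b) / 2) = a + b" by simp
    finally show ?thesis using that by (simp only: ennreal_plus)
  qed
  show ?case unfolding gauss_avg.simps sign_avg.simps by (intro half sign_avg_nonneg nn)
next
  case (Cons u us)
  let ?G = "gauss_avg (\<lambda>x. ennreal (sign_avg h rs x)) us"
  let ?H = "gauss_avg (\<lambda>x. ennreal (sign_avg h (r # rs) x)) us"
  have mG: "?G \<in> borel_measurable borel" and mH: "?H \<in> borel_measurable borel"
    by (auto intro!: measurable_gauss_avg measurable_compose[OF measurable_sign_avg[OF h]] simp del: sign_avg.simps)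
  have e: "v + smul t u + r = (v + r) + smul t u" "v + smul t u - r = (v - r) + smul t u" for t
    by (simp_all add: fun_eq_iff)
  have "2 * gauss_avg (\<lambda>x. ennreal (sign_avg h (r # rs) x)) (u # us) v = (\<integral>\<^sup>+t. 2 * ?H (v + smul t u) \<partial>std_normal)"
    using measurable_line[OF mH, of v u] by (simp add: nn_integral_cmult del: sign_avg.simps)
  also have "\<dots> = (\<integral>\<^sup>+t. ?G ((v + r) + smul t u) + ?G ((v - r) + smul t u) \<partial>std_normal)"
    unfolding Cons e ..
  also have "\<dots> = gauss_avg (\<lambda>x. ennreal (sign_avg h rs x)) (u # us) (v + r)
      + gauss_avg (\<lambda>x. ennreal (sign_avg h rs x)) (u # us) (v - r)"
    using measurable_line[OF mG, of "v + r" u] measurable_line[OF mG, of "v - r" u]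
    by (simp add: nn_integral_add)
  finally show ?case .
qed

text \<open>
  The variables \<open>g\<close> and \<open>\<epsilon> g\<close> have the same distribution when \<open>\<epsilon>\<close> is an independent sign.
\<close>

lemma gauss_avg_symmetrize:
  fixes h :: "(nat \<Rightarrow> real) \<Rightarrow> real"
  assumes h: "h \<in> borel_measurable borel" and nn: "\<And>v. h v \<ge> 0"
  shows "gauss_avg (\<lambda>x. ennreal (sign_avg h rs x)) (u # us) 0
    = (\<integral>\<^sup>+t. gauss_avg (\<lambda>x. ennreal (sign_avg h (smul t u # rs) x)) us 0 \<partial>std_normal)"
proof -
  let ?G = "gauss_avg (\<lambda>x. ennreal (sign_avg h rs x)) us"
  have mG: "?G \<in> borel_measurable borel"
    by (auto intro!: measurable_gauss_avg measurable_compose[OF measurable_sign_avg[OF h]] simp del: sign_avg.simps)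
  have m: "(\<lambda>t. ?G (0 + smul t u)) \<in> borel_measurable borel" by (rule measurable_line[OF mG])
  have m': "(\<lambda>t. ?G (0 + smul (- t) u)) \<in> borel_measurable borel"
    using measurable_compose[OF _ m, of uminus borel] by simp
  have two: "2 * gauss_avg (\<lambda>x. ennreal (sign_avg h (smul t u # rs) x)) us 0 = ?G (0 + smul t u) + ?G (0 + smul (- t) u)" for t
  proof -
    have "0 + smul (- t) u = 0 - smul t u" by (simp add: fun_eq_iff)
    then show ?thesis using gauss_avg_sign_avg_Cons[OF h nn, of "smul t u" rs us 0] by simp
  qed
  have half: "gauss_avg (\<lambda>x. ennreal (sign_avg h (smul t u # rs) x)) us 0 = (?G (0 + smul t u) + ?G (0 + smul (- t) u)) / 2" for t
    unfolding two[symmetric] by (simp add: ennreal_mult_divide_eq mult.commute[of 2] del: sign_avg.simps)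
  have "(\<integral>\<^sup>+t. gauss_avg (\<lambda>x. ennreal (sign_avg h (smul t u # rs) x)) us 0 \<partial>std_normal)
      = (\<integral>\<^sup>+t. ?G (0 + smul t u) + ?G (0 + smul (- t) u) \<partial>std_normal) / 2"
    unfolding half using m m' by (intro nn_integral_divide) auto
  also have "\<dots> = (2 * (\<integral>\<^sup>+t. ?G (0 + smul t u) \<partial>std_normal)) / 2"
    using m m' nn_integral_std_normal_uminus[OF m] by (simp add: nn_integral_add mult_2)
  also have "\<dots> = gauss_avg (\<lambda>x. ennreal (sign_avg h rs x)) (u # us) 0"
    by (simp add: ennreal_mult_divide_eq mult.commute[of 2])
  finally show ?thesis by simp
qed

text \<open>
  Turning the Gaussian variables one after the other into signs with random coefficients leaves a sign
  average, to which the hypothesis applies, and \<open>g\<^sup>2\<close> has mean one.  The list \<open>rs\<close> holds the vectors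
  that have been treated already.
\<close>

lemma gauss_avg_type_2:
  fixes h :: "(nat \<Rightarrow> real) \<Rightarrow> real"
  assumes h: "h \<in> borel_measurable borel" and nn: "\<And>v. h v \<ge> 0"
    and hom: "\<And>t v. h (smul t v) = t\<^sup>2 * h v"
    and C: "C \<ge> 0" and type: "\<And>us. sign_avg h us 0 \<le> C * (\<Sum>u\<leftarrow>us. h u)"
  shows "gauss_avg (\<lambda>x. ennreal (sign_avg h rs x)) us 0 \<le> ennreal (C * ((\<Sum>u\<leftarrow>rs. h u) + (\<Sum>u\<leftarrow>us. h u)))"
proof (induction us arbitrary: rs)
  case Nil
  show ?case using ennreal_leI[OF type[of rs]] by (simp only: gauss_avg.simps list.map sum_list.Nil add_0_right)
next
  case (Cons u us)
  interpret prob_space std_normal by (rule prob_space_std_normal)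
  define R where "R = (\<Sum>u\<leftarrow>rs. h u) + (\<Sum>u\<leftarrow>us. h u)"
  have R: "R \<ge> 0" unfolding R_def by (intro add_nonneg_nonneg sum_list_nonneg) (auto simp: nn)
  have "gauss_avg (\<lambda>x. ennreal (sign_avg h rs x)) (u # us) 0
      = (\<integral>\<^sup>+t. gauss_avg (\<lambda>x. ennreal (sign_avg h (smul t u # rs) x)) us 0 \<partial>std_normal)"
    by (rule gauss_avg_symmetrize[OF h nn])
  also have "\<dots> \<le> (\<integral>\<^sup>+t. ennreal (C * h u) * ennreal (t\<^sup>2) + ennreal (C * R) \<partial>std_normal)"
  proof (rule nn_integral_mono)
    fix t
    have "C * ((\<Sum>u\<leftarrow>smul t u # rs. h u) + (\<Sum>u\<leftarrow>us. h u)) = C * h u * t\<^sup>2 + C * R"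
      by (simp add: hom R_def algebra_simps)
    moreover have "ennreal (C * h u * t\<^sup>2 + C * R) = ennreal (C * h u) * ennreal (t\<^sup>2) + ennreal (C * R)"
      using C R nn[of u] by (simp add: ennreal_plus ennreal_mult)
    ultimately show "gauss_avg (\<lambda>x. ennreal (sign_avg h (smul t u # rs) x)) us 0 \<le> ennreal (C * h u) * ennreal (t\<^sup>2) + ennreal (C * R)"
      using Cons[of "smul t u # rs"] by (simp only:)
  qed
  also have "\<dots> = ennreal (C * h u) + ennreal (C * R)"
    by (simp add: nn_integral_add nn_integral_cmult nn_integral_std_normal_square emeasure_space_1[simplified])
  also have "\<dots> = ennreal (C * ((\<Sum>u\<leftarrow>rs. h u) + (\<Sum>u\<leftarrow>u # us. h u)))"
  proof -
    have "ennreal (C * h u) + ennreal (C * R) = ennreal (C * h u + C * R)"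
      using C R nn[of u] by (intro ennreal_plus[symmetric]) auto
    then show ?thesis by (simp add: R_def algebra_simps)
  qed
  finally show ?case .
qed

text \<open>
  From signs to Gaussian variables, through the contraction, and back to type 2.  The factor \<open>\<pi> / 2\<close> is
  lost in the first step.
\<close>

theorem sign_avg_type_2_contraction:
  fixes h :: "(nat \<Rightarrow> real) \<Rightarrow> real" and ps :: "((nat \<Rightarrow> real) \<times> ('i \<Rightarrow> real)) list"
  assumes h: "h \<in> borel_measurable borel" and nn: "\<And>v. h v \<ge> 0"
    and hom: "\<And>t v. h (smul t v) = t\<^sup>2 * h v"
    and conv: "\<And>v u. convex_on UNIV (\<lambda>t. h (v + smul t u))"
    and C: "C \<ge> 0" and type: "\<And>us. sign_avg h us 0 \<le> C * (\<Sum>u\<leftarrow>us. h u)"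
    and \<rho>: "\<rho> < 1" and ps: "ps \<noteq> []" and js: "distinct js"
    and A: "\<And>b. (\<Sum>x\<leftarrow>ps. (\<Sum>j\<in>set js. b j * snd x j)\<^sup>2) \<le> \<rho> * (\<Sum>j\<in>set js. (b j)\<^sup>2)"
  shows "sign_avg h (map (\<lambda>j k. \<Sum>x\<leftarrow>ps. snd x j * fst x k) js) 0 \<le> pi / 2 * C * (\<Sum>x\<leftarrow>ps. h (fst x))"
proof -
  define us where "us = map (\<lambda>j k. \<Sum>x\<leftarrow>ps. snd x j * fst x k) js"
  have hm: "(\<lambda>x. ennreal (h x)) \<in> borel_measurable borel" using h by measurable
  have mid: "2 * ennreal (h v) \<le> ennreal (h (v + u)) + ennreal (h (v - u))" for v u
  proof -
    have "h (v + smul 0 u) \<le> (1 / 2) * h (v + smul (- 1) u) + (1 / 2) * h (v + smul 1 u)"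
      using convex_onD[OF conv[of v u], of "1/2" "- 1" 1] by simp
    moreover have "v + smul 0 u = v" "v + smul 1 u = v + u" "v + smul (- 1) u = v - u"
      by (simp_all add: fun_eq_iff)
    ultimately have "2 * h v \<le> h (v + u) + h (v - u)" by simp
    then have "ennreal (2 * h v) \<le> ennreal (h (v + u) + h (v - u))" by (rule ennreal_leI)
    then show ?thesis using nn by (simp add: ennreal_mult ennreal_plus)
  qed
  have S: "(\<Sum>x\<leftarrow>ps. h (fst x)) \<ge> 0" by (rule sum_list_nonneg) (auto simp: nn)
  have z: "smul \<kappa> 0 = 0" for \<kappa> by (simp add: fun_eq_iff)
  have "ennreal (2 / pi * sign_avg h us 0) = ennreal (sign_avg h (map (smul (sqrt (2 / pi))) us) 0)"
    using sign_avg_homogeneous[OF hom, of "sqrt (2 / pi)" us 0] by (simp add: z)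
  also have "\<dots> \<le> gauss_avg (\<lambda>x. ennreal (h x)) us 0"
    by (rule sign_avg_le_gauss_avg[OF conv nn])
  also have "\<dots> \<le> gauss_avg (\<lambda>x. ennreal (h x)) (map fst ps) 0"
    unfolding us_def by (rule gauss_avg_contraction[OF hm mid \<rho> ps js A])
  also have "\<dots> \<le> ennreal (C * (\<Sum>x\<leftarrow>ps. h (fst x)))"
    using gauss_avg_type_2[OF h nn hom C type, of "[]" "map fst ps"] by (simp add: o_def)
  finally have "2 / pi * sign_avg h us 0 \<le> C * (\<Sum>x\<leftarrow>ps. h (fst x))"
    using C S by (simp add: ennreal_le_iff)
  then show ?thesis unfolding us_def by (simp add: field_simps)
qed

section \<open>Rademacher functions\<close>


lemma rademacher_Suc_left:
  "rademacher (Suc i) t = rademacher i (2 * t)"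
  by (simp add: rademacher_def algebra_simps)

lemma rademacher_Suc_right:
  assumes "i \<ge> 1"
  shows "rademacher (Suc i) t = rademacher i (2 * t - 1)"
proof -
  obtain j where i: "i = Suc j" using assms by (cases i) auto
  have "sin (2 ^ Suc i * pi * t) = sin (2 ^ i * pi * (2 * t - 1) + 2 * real (2 ^ j) * pi)"
    by (rule arg_cong[where f = sin]) (simp add: i algebra_simps)
  also have "\<dots> = sin (2 ^ i * pi * (2 * t - 1))"
    unfolding sin_add sin_2npi cos_2npi by simp
  finally show ?thesis by (simp add: rademacher_def)
qed

lemma rademacher_1:
  "0 < t \<Longrightarrow> t < 1 / 2 \<Longrightarrow> rademacher (Suc 0) t = 1"
  "1 / 2 < t \<Longrightarrow> t < 1 \<Longrightarrow> rademacher (Suc 0) t = - 1"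
proof -
  assume t: "0 < t" "t < 1 / 2"
  then have "2 * pi * t < pi" by (simp add: field_simps)
  then have "sin (2 * pi * t) > 0" using t by (intro sin_gt_zero) auto
  then show "rademacher (Suc 0) t = 1" by (simp add: rademacher_def)
next
  assume t: "1 / 2 < t" "t < 1"
  then have "pi < 2 * pi * t" "2 * pi * t < 2 * pi" by (simp_all add: field_simps)
  then have "sin (2 * pi * t) < 0" by (intro sin_lt_zero)
  then show "rademacher (Suc 0) t = - 1" by (simp add: rademacher_def)
qed

text \<open>
  On the two halves of the unit interval the first Rademacher function is constant and the next ones
  are rescaled copies of the preceding ones: \<open>r\<^sub>i\<^sub>+\<^sub>1(t) = r\<^sub>i(2 t) = r\<^sub>i(2 t - 1)\<close>.  This is the recursion of
  \<open>sign_avg\<close>, except at the points 0, 1/2 and 1, where the first Rademacher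
  function vanishes.
\<close>

theorem has_bochner_integral_rademacher:
  fixes h :: "'v::complex_vector \<Rightarrow> real"
  shows "has_bochner_integral lborel
    (\<lambda>t. indicator {0..1} t *\<^sub>R h (v + (\<Sum>i=1..n. of_real (rademacher i t) *\<^sub>C x i)))
    (sign_avg h (map x [1..<Suc n]) v)"
proof (induction n arbitrary: x v)
  case 0
  have "has_bochner_integral lborel (\<lambda>t::real. indicator {0..1} t *\<^sub>R h v) (measure lborel {0..1::real} *\<^sub>R h v)"
    by (rule has_bochner_integral_scaleR_left, rule has_bochner_integral_real_indicator) auto
  then show ?case by simp
next
  case (Suc n)
  define x' where "x' i = x (Suc i)" for i
  define f where "f t = indicator {0..1} t *\<^sub>R h (v + (\<Sum>i=1..Suc n. of_real (rademacher i t) *\<^sub>C x i))" for t :: real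
  define g where "g w t = indicator {0..1} t *\<^sub>R h (w + (\<Sum>i=1..n. of_real (rademacher i t) *\<^sub>C x' i))" for w and t :: real
  have g: "has_bochner_integral lborel (g w) (sign_avg h (map x' [1..<Suc n]) w)" for w
    unfolding g_def by (rule Suc.IH)
  have "has_bochner_integral lborel (\<lambda>t. g (v + x 1) (0 + 2 * t)) (sign_avg h (map x' [1..<Suc n]) (v + x 1) /\<^sub>R \<bar>2\<bar>)"
    by (subst lborel_has_bochner_integral_real_affine_iff[symmetric]) (simp_all add: g[unfolded One_nat_def] del: upt_Suc)
  moreover have "has_bochner_integral lborel (\<lambda>t. g (v - x 1) (- 1 + 2 * t)) (sign_avg h (map x' [1..<Suc n]) (v - x 1) /\<^sub>R \<bar>2\<bar>)"
    by (subst lborel_has_bochner_integral_real_affine_iff[symmetric]) (simp_all add: g[unfolded One_nat_def] del: upt_Suc)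
  ultimately have G0: "has_bochner_integral lborel (\<lambda>t. g (v + x 1) (0 + 2 * t) + g (v - x 1) (- 1 + 2 * t))
      (sign_avg h (map x' [1..<Suc n]) (v + x 1) /\<^sub>R \<bar>2\<bar> + sign_avg h (map x' [1..<Suc n]) (v - x 1) /\<^sub>R \<bar>2\<bar>)"
    (is "has_bochner_integral _ ?G _")
    by (rule has_bochner_integral_add)
  have list: "map x [1..<Suc (Suc n)] = x 1 # map x' [1..<Suc n]"
    unfolding x'_def by (simp add: upt_conv_Cons map_Suc_upt[symmetric] del: upt_Suc)
  have "a /\<^sub>R \<bar>2\<bar> + b /\<^sub>R \<bar>2\<bar> = (a + b) / 2" for a b :: real by simp
  then have G: "has_bochner_integral lborel ?G (sign_avg h (map x [1..<Suc (Suc n)]) v)"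
    using G0 unfolding list sign_avg.simps by metis
  have shift: "(\<Sum>i=1..Suc n. of_real (rademacher i t) *\<^sub>C x i)
      = of_real (rademacher (Suc 0) t) *\<^sub>C x 1 + (\<Sum>i=1..n. of_real (rademacher (Suc i) t) *\<^sub>C x' i)" for t
    by (simp add: sum.atLeast_Suc_atMost sum.shift_bounds_cl_Suc_ivl x'_def del: sum.cl_ivl_Suc)
  have eq: "f t = ?G t" if "t \<noteq> 0" "t \<noteq> 1 / 2" "t \<noteq> 1" for t
  proof -
    have "(t < 0 \<or> t > 1) \<or> (0 < t \<and> t < 1 / 2) \<or> (1 / 2 < t \<and> t < 1)" using that by linarith
    then consider "t < 0 \<or> t > 1" | "0 < t" "t < 1 / 2" | "1 / 2 < t" "t < 1" by blast
    then show ?thesis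
    proof cases
      case 1
      then show ?thesis by (auto simp: f_def g_def)
    next
      case 2
      then show ?thesis
        unfolding f_def g_def shift rademacher_1(1)[OF 2]
        by (simp add: rademacher_Suc_left add.assoc scaleC_one)
    next
      case 3
      have "(\<Sum>i=1..n. of_real (rademacher (Suc i) t) *\<^sub>C x' i) = (\<Sum>i=1..n. of_real (rademacher i (- 1 + 2 * t)) *\<^sub>C x' i)"
        by (intro sum.cong refl) (simp add: rademacher_Suc_right)
      moreover have "v + (complex_of_real (- 1) *\<^sub>C a + S) = v - a + S" for a S
        by (simp add: complex_vector.scale_minus_left scaleC_one algebra_simps)
      moreover have "g (v + x 1) (0 + 2 * t) = 0" "indicator {0..1} t = (1::real)" "indicator {0..1} (- 1 + 2 * t) = (1::real)"
        using 3 by (auto simp: g_def)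
      ultimately show ?thesis
        unfolding f_def shift rademacher_1(2)[OF 3] by (simp only: g_def add_0_left)
    qed
  qed
  have mG: "?G \<in> borel_measurable lborel" using G by (auto simp: has_bochner_integral_iff)
  have "f = (\<lambda>t. if t = 0 then f 0 else if t = 1 / 2 then f (1 / 2) else if t = 1 then f 1 else ?G t)"
    by (rule ext) (use eq in \<open>auto simp only: split: if_split\<close>)
  also have "\<dots> \<in> borel_measurable lborel" using mG by measurable
  finally have mf: "f \<in> borel_measurable lborel" .
  have "AE t in lborel. f t = ?G t"
    using AE_lborel_singleton[of 0] AE_lborel_singleton[of "1 / 2"] AE_lborel_singleton[of 1]
    by eventually_elim (rule eq)
  then have "has_bochner_integral lborel f (sign_avg h (map x [1..<Suc (Suc n)]) v)"
    using has_bochner_integral_cong_AE[OF mf mG] G by simp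
  then show ?case unfolding f_def .
qed

section \<open>Normed spaces on subspaces\<close>


locale normed_carrier =
  fixes E :: "'v::complex_vector normed"
  assumes normed: "normed_space E"
begin

lemma subspace: "complex_vector.subspace (car E)"
  using normed by (simp add: normed_space_def)

lemmas zero_car [simp, intro] = complex_vector.subspace_0[OF subspace]
  and add_car [simp, intro] = complex_vector.subspace_add[OF subspace]
  and diff_car [simp, intro] = complex_vector.subspace_diff[OF subspace]
  and scale_car [simp, intro] = complex_vector.subspace_scale[OF subspace]
  and sum_car = complex_vector.subspace_sum[OF subspace]

lemma nrm_scale: "x \<in> car E \<Longrightarrow> nrm E (c *\<^sub>C x) = cmod c * nrm E x"
  using normed by (simp add: normed_space_def)

lemma nrm_add: "x \<in> car E \<Longrightarrow> y \<in> car E \<Longrightarrow> nrm E (x + y) \<le> nrm E x + nrm E y"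
  using normed by (simp add: normed_space_def)

lemma nrm_ge_0 [simp]: "x \<in> car E \<Longrightarrow> 0 \<le> nrm E x"
  by (rule normed_space_nrm_nonneg[OF normed])

lemma nrm_0 [simp]: "nrm E 0 = 0"
  using nrm_scale[OF zero_car, of 0] by simp

lemma nrm_minus: "x \<in> car E \<Longrightarrow> nrm E (- x) = nrm E x"
  using nrm_scale[of x "- 1"] by (simp add: complex_vector.scale_minus_left scaleC_one)

lemma nrm_diff_commute: "x \<in> car E \<Longrightarrow> y \<in> car E \<Longrightarrow> nrm E (x - y) = nrm E (y - x)"
  using nrm_minus[of "x - y"] by simp

lemma nrm_le_add_diff: "x \<in> car E \<Longrightarrow> y \<in> car E \<Longrightarrow> nrm E x \<le> nrm E y + nrm E (x - y)"
  using nrm_add[of y "x - y"] by simp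

lemma nrm_triangle3:
  "x \<in> car E \<Longrightarrow> y \<in> car E \<Longrightarrow> z \<in> car E \<Longrightarrow> nrm E (x - z) \<le> nrm E (x - y) + nrm E (y - z)"
  using nrm_add[of "x - y" "y - z"] by simp

lemma nrm_sum:
  "(\<And>i. i \<in> I \<Longrightarrow> f i \<in> car E) \<Longrightarrow> nrm E (\<Sum>i\<in>I. f i) \<le> (\<Sum>i\<in>I. nrm E (f i))"
proof (induction I rule: infinite_finite_induct)
  case (insert i I)
  have "nrm E (f i + (\<Sum>i\<in>I. f i)) \<le> nrm E (f i) + nrm E (\<Sum>i\<in>I. f i)"
    using insert.prems by (intro nrm_add sum_car) auto
  then show ?case using insert by fastforce
qed simp_all

lemma nrm_sum_signs:
  assumes x: "\<And>i. i \<in> I \<Longrightarrow> x i \<in> car E" and e: "\<And>i. i \<in> I \<Longrightarrow> \<bar>e i\<bar> \<le> 1"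
  shows "nrm E (\<Sum>i\<in>I. of_real (e i) *\<^sub>C x i) \<le> (\<Sum>i\<in>I. nrm E (x i))"
proof -
  have "nrm E (\<Sum>i\<in>I. of_real (e i) *\<^sub>C x i) \<le> (\<Sum>i\<in>I. nrm E (of_real (e i) *\<^sub>C x i))"
    by (intro nrm_sum scale_car x)
  also have "\<dots> \<le> (\<Sum>i\<in>I. nrm E (x i))"
    using x e by (intro sum_mono) (simp add: nrm_scale mult_left_le_one_le)
  finally show ?thesis .
qed

lemma metric: "Metric_space (car E) (norm_dist E)"
  by (rule Metric_space_norm_dist[OF normed])

sublocale M: Metric_space "car E" "norm_dist E"
  rewrites "Metric_space.mtopology (car E) (norm_dist E) = norm_topology E"
  by (rule metric) (simp add: norm_topology_def)

lemma topspace_norm [simp]: "topspace (norm_topology E) = car E"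
  by (rule M.topspace_mtopology)

lemma limitin_norm_iff:
  "limitin (norm_topology E) f l F \<longleftrightarrow>
    l \<in> car E \<and> (\<forall>\<^sub>F x in F. f x \<in> car E) \<and> ((\<lambda>x. nrm E (f x - l)) \<longlongrightarrow> 0) F"
proof -
  have "((\<lambda>x. norm_dist E (f x) l) \<longlongrightarrow> 0) F \<longleftrightarrow> ((\<lambda>x. nrm E (f x - l)) \<longlongrightarrow> 0) F"
    if "l \<in> car E" "\<forall>\<^sub>F x in F. f x \<in> car E"
    by (rule tendsto_cong) (use that in \<open>auto elim!: eventually_mono simp: norm_dist_def\<close>)
  then show ?thesis
    using M.limitin_metric_dist_null[of f l F] by blast
qed

lemma continuous_map_norm_iff:
  fixes S :: "'b::topological_space set"
  shows "continuous_map (top_of_set S) (norm_topology E) f \<longleftrightarrow>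
    (\<forall>x\<in>S. f x \<in> car E) \<and> (\<forall>x\<in>S. ((\<lambda>y. nrm E (f y - f x)) \<longlongrightarrow> 0) (at x within S))"
proof -
  have "atin_within euclidean x S = at x within S" for x
    by (simp add: atin_within_def at_within_def nhdsin_def nhds_def)
  then have at: "atin (top_of_set S) x = at x within S" if "x \<in> S" for x
    using that by (simp add: atin_subtopology_within)
  have ev: "(\<forall>x\<in>S. f x \<in> car E) \<Longrightarrow> \<forall>\<^sub>F y in at x within S. f y \<in> car E" for x
    by (auto simp: eventually_at_filter)
  have "continuous_map (top_of_set S) (norm_topology E) f \<longleftrightarrow>
      (\<forall>x\<in>S. limitin (norm_topology E) f (f x) (at x within S))"
    by (simp add: continuous_map_atin at)
  then show ?thesis
    using ev by (auto simp: limitin_norm_iff)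
qed

lemma limitin_add:
  assumes "limitin (norm_topology E) f a F" "limitin (norm_topology E) g b F"
  shows "limitin (norm_topology E) (\<lambda>x. f x + g x) (a + b) F"
proof -
  from assms have ab: "a \<in> car E" "b \<in> car E"
    and ev: "\<forall>\<^sub>F x in F. f x \<in> car E" "\<forall>\<^sub>F x in F. g x \<in> car E"
    and lim: "((\<lambda>x. nrm E (f x - a)) \<longlongrightarrow> 0) F" "((\<lambda>x. nrm E (g x - b)) \<longlongrightarrow> 0) F"
    by (auto simp: limitin_norm_iff)
  have "((\<lambda>x. nrm E (f x + g x - (a + b))) \<longlongrightarrow> 0) F"
  proof (rule tendsto_sandwich[OF _ _ tendsto_const])
    show "\<forall>\<^sub>F x in F. 0 \<le> nrm E (f x + g x - (a + b))"
      using ev by eventually_elim (use ab in auto)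
    show "\<forall>\<^sub>F x in F. nrm E (f x + g x - (a + b)) \<le> nrm E (f x - a) + nrm E (g x - b)"
      using ev
    proof eventually_elim
      case (elim x)
      then show ?case using nrm_add[of "f x - a" "g x - b"] ab by (simp add: algebra_simps)
    qed
    show "((\<lambda>x. nrm E (f x - a) + nrm E (g x - b)) \<longlongrightarrow> 0) F"
      using tendsto_add[OF lim] by simp
  qed
  moreover have "\<forall>\<^sub>F x in F. f x + g x \<in> car E" using ev by eventually_elim auto
  ultimately show ?thesis using ab by (auto simp: limitin_norm_iff)
qed

lemma limitin_scale:
  assumes "(c \<longlongrightarrow> d) F" "limitin (norm_topology E) f a F"
  shows "limitin (norm_topology E) (\<lambda>x. c x *\<^sub>C f x) (d *\<^sub>C a) F"
proof -
  from assms have a: "a \<in> car E" and ev: "\<forall>\<^sub>F x in F. f x \<in> car E"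
    and lim: "((\<lambda>x. nrm E (f x - a)) \<longlongrightarrow> 0) F"
    by (auto simp: limitin_norm_iff)
  have "((\<lambda>x. nrm E (c x *\<^sub>C f x - d *\<^sub>C a)) \<longlongrightarrow> 0) F"
  proof (rule tendsto_sandwich[OF _ _ tendsto_const])
    show "\<forall>\<^sub>F x in F. 0 \<le> nrm E (c x *\<^sub>C f x - d *\<^sub>C a)"
      using ev by eventually_elim (use a in auto)
    show "\<forall>\<^sub>F x in F. nrm E (c x *\<^sub>C f x - d *\<^sub>C a) \<le> cmod (c x) * nrm E (f x - a) + cmod (c x - d) * nrm E a"
      using ev
    proof eventually_elim
      case (elim x)
      have "c x *\<^sub>C f x - d *\<^sub>C a = c x *\<^sub>C (f x - a) + (c x - d) *\<^sub>C a"
        by (simp add: complex_vector.scale_right_diff_distrib complex_vector.scale_left_diff_distrib)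
      then show ?case
        using nrm_add[of "c x *\<^sub>C (f x - a)" "(c x - d) *\<^sub>C a"] elim a by (simp add: nrm_scale)
    qed
    show "((\<lambda>x. cmod (c x) * nrm E (f x - a) + cmod (c x - d) * nrm E a) \<longlongrightarrow> 0) F"
      using assms(1) lim by (auto intro!: tendsto_eq_intros)
  qed
  moreover have "\<forall>\<^sub>F x in F. c x *\<^sub>C f x \<in> car E" using ev by eventually_elim auto
  ultimately show ?thesis using a by (auto simp: limitin_norm_iff)
qed

lemma limitin_const': "a \<in> car E \<Longrightarrow> limitin (norm_topology E) (\<lambda>_. a) a F"
  by (simp add: limitin_norm_iff)

end

section \<open>Type 2 and operators on Hilbert space\<close>


lemma sign_avg_map:
  fixes \<Lambda> :: "'a::ab_group_add \<Rightarrow> 'b::ab_group_add"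
  assumes "\<And>u v. \<Lambda> (u + v) = \<Lambda> u + \<Lambda> v" "\<And>u v. \<Lambda> (u - v) = \<Lambda> u - \<Lambda> v"
  shows "sign_avg h (map \<Lambda> us) (\<Lambda> v) = sign_avg (\<lambda>u. h (\<Lambda> u)) us v"
  by (induction us arbitrary: v) (simp_all flip: assms)

definition rademacher_comb :: "nat \<Rightarrow> (nat \<Rightarrow> 'v::complex_vector) \<Rightarrow> real \<Rightarrow> 'v" where
  "rademacher_comb n v t = (\<Sum>i=1..n. of_real (rademacher i t) *\<^sub>C v i)"

lemma rademacher_average_sq:
  "(rademacher_average E n v)\<^sup>2 = (LINT t:{0..1}|lborel. (nrm E (rademacher_comb n v t))\<^sup>2)"
  "(rademacher_average E n v)\<^sup>2 = sign_avg (\<lambda>x. (nrm E x)\<^sup>2) (map v [1..<Suc n]) 0"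
proof -
  let ?S = "sign_avg (\<lambda>x. (nrm E x)\<^sup>2) (map v [1..<Suc n]) 0"
  have L: "(LINT t:{0..1}|lborel. (nrm E (rademacher_comb n v t))\<^sup>2) = ?S"
    using has_bochner_integral_rademacher[where h = "\<lambda>x. (nrm E x)\<^sup>2" and v = 0 and n = n and x = v]
    by (simp add: set_lebesgue_integral_def has_bochner_integral_iff rademacher_comb_def del: upt_Suc)
  have "?S \<ge> 0"
    unfolding L[symmetric] set_lebesgue_integral_def by (intro integral_nonneg_AE) auto
  then show "(rademacher_average E n v)\<^sup>2 = ?S"
    unfolding rademacher_average_def rademacher_comb_def[symmetric] L by simp
  then show "(rademacher_average E n v)\<^sup>2 = (LINT t:{0..1}|lborel. (nrm E (rademacher_comb n v t))\<^sup>2)"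
    unfolding L .
qed

text \<open>
  Inequalities that hold for every \<open>t\<close> pass to the averages; all integrands take finitely many
  values almost everywhere, so they are integrable.
\<close>

lemma rademacher_average_sq_le:
  assumes "\<And>t. (nrm E (rademacher_comb n v t))\<^sup>2 \<le> d + (\<Sum>j\<in>J. c j * (nrm F (rademacher_comb n (w j) t))\<^sup>2)"
  shows "(rademacher_average E n v)\<^sup>2 \<le> d + (\<Sum>j\<in>J. c j * (rademacher_average F n (w j))\<^sup>2)"
proof -
  have int: "set_integrable lborel {0..1} (\<lambda>t. (nrm N (rademacher_comb n u t))\<^sup>2)"
    for N :: "'c::complex_vector normed" and u
    using has_bochner_integral_rademacher[where h = "\<lambda>x. (nrm N x)\<^sup>2" and v = 0 and n = n and x = u]
    by (simp add: set_integrable_def has_bochner_integral_iff rademacher_comb_def del: upt_Suc)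
  have int': "set_integrable lborel {0..1} (\<lambda>t. (nrm E (rademacher_comb n v t))\<^sup>2)"
    using has_bochner_integral_rademacher[where h = "\<lambda>x. (nrm E x)\<^sup>2" and v = 0 and n = n and x = v]
    by (simp add: set_integrable_def has_bochner_integral_iff rademacher_comb_def del: upt_Suc)
  have const: "set_integrable lborel {0..1::real} (\<lambda>_. d)" by (simp add: set_integrable_def)
  have int_term: "set_integrable lborel {0..1} (\<lambda>t. c j * (nrm F (rademacher_comb n (w j) t))\<^sup>2)" for j
    by (intro set_integrable_mult_right int)
  have int_sum: "set_integrable lborel {0..1} (\<lambda>t. \<Sum>j\<in>J. c j * (nrm F (rademacher_comb n (w j) t))\<^sup>2)"
    unfolding set_integrable_def scaleR_sum_right
    by (intro Bochner_Integration.integrable_sum int_term[unfolded set_integrable_def])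
  have "(rademacher_average E n v)\<^sup>2
      \<le> (LINT t:{0..1}|lborel. d + (\<Sum>j\<in>J. c j * (nrm F (rademacher_comb n (w j) t))\<^sup>2))"
    unfolding rademacher_average_sq(1) by (intro set_integral_mono int' set_integral_add(1) const int_sum assms)
  also have "\<dots> = d + (LINT t:{0..1}|lborel. (\<Sum>j\<in>J. c j * (nrm F (rademacher_comb n (w j) t))\<^sup>2))"
    by (subst set_integral_add(2)[OF const int_sum]) (simp add: set_lebesgue_integral_def)
  also have "(LINT t:{0..1}|lborel. (\<Sum>j\<in>J. c j * (nrm F (rademacher_comb n (w j) t))\<^sup>2))
      = (\<Sum>j\<in>J. LINT t:{0..1}|lborel. c j * (nrm F (rademacher_comb n (w j) t))\<^sup>2)"
    unfolding set_lebesgue_integral_def scaleR_sum_right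
    by (intro Bochner_Integration.integral_sum int_term[unfolded set_integrable_def])
  finally show ?thesis by (simp add: rademacher_average_sq(1))
qed

context normed_carrier
begin

definition lin_comb :: "nat \<Rightarrow> (nat \<Rightarrow> 'v) \<Rightarrow> (nat \<Rightarrow> real) \<Rightarrow> 'v" where
  "lin_comb m y \<xi> = (\<Sum>k<m. complex_of_real (\<xi> k) *\<^sub>C y k)"

lemma lin_comb_car: "(\<And>k. k < m \<Longrightarrow> y k \<in> car E) \<Longrightarrow> lin_comb m y \<xi> \<in> car E"
  unfolding lin_comb_def by (intro sum_car) auto

lemma lin_comb_add: "lin_comb m y (u + v) = lin_comb m y u + lin_comb m y v"
  by (simp add: lin_comb_def complex_vector.scale_left_distrib sum.distrib)

lemma lin_comb_diff: "lin_comb m y (u - v) = lin_comb m y u - lin_comb m y v"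
  by (simp add: lin_comb_def complex_vector.scale_left_diff_distrib sum_subtractf)

lemma lin_comb_smul: "lin_comb m y (smul t u) = complex_of_real t *\<^sub>C lin_comb m y u"
  by (simp add: lin_comb_def complex_vector.scale_sum_right)

lemma continuous_nrm_lin_comb:
  assumes y: "\<And>k. k < m \<Longrightarrow> y k \<in> car E"
  shows "continuous_on UNIV (\<lambda>\<xi>. nrm E (lin_comb m y \<xi>))"
  unfolding continuous_on_def
proof (intro ballI)
  fix \<xi> :: "nat \<Rightarrow> real"
  have "((\<lambda>\<zeta>. nrm E (lin_comb m y \<zeta>) - nrm E (lin_comb m y \<xi>)) \<longlongrightarrow> 0) (at \<xi>)"
  proof (rule Lim_null_comparison)
    show "\<forall>\<^sub>F \<zeta> in at \<xi>. norm (nrm E (lin_comb m y \<zeta>) - nrm E (lin_comb m y \<xi>)) \<le> (\<Sum>k<m. \<bar>\<zeta> k - \<xi> k\<bar> * nrm E (y k))"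
    proof (intro always_eventually allI)
      fix \<zeta>
      have "nrm E (lin_comb m y (\<zeta> - \<xi>)) \<le> (\<Sum>k<m. nrm E (complex_of_real ((\<zeta> - \<xi>) k) *\<^sub>C y k))"
        unfolding lin_comb_def using y by (intro nrm_sum) auto
      also have "\<dots> = (\<Sum>k<m. \<bar>\<zeta> k - \<xi> k\<bar> * nrm E (y k))"
        using y by (intro sum.cong refl) (simp add: nrm_scale flip: of_real_diff)
      finally have d: "nrm E (lin_comb m y \<zeta> - lin_comb m y \<xi>) \<le> (\<Sum>k<m. \<bar>\<zeta> k - \<xi> k\<bar> * nrm E (y k))"
        by (simp only: lin_comb_diff)
      have c: "lin_comb m y \<zeta> \<in> car E" "lin_comb m y \<xi> \<in> car E" using y by (auto intro: lin_comb_car)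
      show "norm (nrm E (lin_comb m y \<zeta>) - nrm E (lin_comb m y \<xi>)) \<le> (\<Sum>k<m. \<bar>\<zeta> k - \<xi> k\<bar> * nrm E (y k))"
        using d nrm_le_add_diff[OF c] nrm_le_add_diff[OF c(2,1)] nrm_diff_commute[OF c] by auto
    qed
    have "((\<lambda>\<zeta>. \<zeta> k) \<longlongrightarrow> \<xi> k) (at \<xi>)" for k
      using continuous_on_product_coordinates[of k, where 'b = real] by (auto simp: continuous_on_def)
    then have "((\<lambda>\<zeta>. \<Sum>k<m. \<bar>\<zeta> k - \<xi> k\<bar> * nrm E (y k)) \<longlongrightarrow> (\<Sum>k<m. \<bar>\<xi> k - \<xi> k\<bar> * nrm E (y k))) (at \<xi>)"
      by (intro tendsto_intros)
    then show "((\<lambda>\<zeta>. \<Sum>k<m. \<bar>\<zeta> k - \<xi> k\<bar> * nrm E (y k)) \<longlongrightarrow> 0) (at \<xi>)" by simp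
  qed
  then show "((\<lambda>\<zeta>. nrm E (lin_comb m y \<zeta>)) \<longlongrightarrow> nrm E (lin_comb m y \<xi>)) (at \<xi> within UNIV)"
    by (simp add: LIM_zero_iff)
qed

lemma convex_nrm_sq_line:
  assumes "a \<in> car E" "b \<in> car E"
  shows "convex_on UNIV (\<lambda>t::real. (nrm E (a + complex_of_real t *\<^sub>C b))\<^sup>2)"
proof (rule convex_onI)
  fix t x y :: real assume t: "0 < t" "t < 1"
  define X where "X = nrm E (a + complex_of_real x *\<^sub>C b)"
  define Y where "Y = nrm E (a + complex_of_real y *\<^sub>C b)"
  have c: "a + complex_of_real s *\<^sub>C b \<in> car E" for s using assms by auto
  have "a + complex_of_real ((1 - t) *\<^sub>R x + t *\<^sub>R y) *\<^sub>C b
      = complex_of_real (1 - t) *\<^sub>C (a + complex_of_real x *\<^sub>C b) + complex_of_real t *\<^sub>C (a + complex_of_real y *\<^sub>C b)"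
  proof -
    have "complex_of_real (1 - t) *\<^sub>C a + complex_of_real t *\<^sub>C a = a"
      by (simp add: scaleC_one flip: complex_vector.scale_left_distrib)
    moreover have "complex_of_real ((1 - t) *\<^sub>R x + t *\<^sub>R y) *\<^sub>C b
        = complex_of_real (1 - t) *\<^sub>C complex_of_real x *\<^sub>C b + complex_of_real t *\<^sub>C complex_of_real y *\<^sub>C b"
      by (simp add: complex_vector.scale_left_distrib)
    moreover have "complex_of_real (1 - t) *\<^sub>C (a + complex_of_real x *\<^sub>C b) + complex_of_real t *\<^sub>C (a + complex_of_real y *\<^sub>C b)
        = (complex_of_real (1 - t) *\<^sub>C a + complex_of_real t *\<^sub>C a)
          + (complex_of_real (1 - t) *\<^sub>C complex_of_real x *\<^sub>C b + complex_of_real t *\<^sub>C complex_of_real y *\<^sub>C b)"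
      by (simp only: complex_vector.scale_right_distrib ac_simps)
    ultimately show ?thesis by (simp only:)
  qed
  then have "nrm E (a + complex_of_real ((1 - t) *\<^sub>R x + t *\<^sub>R y) *\<^sub>C b) \<le> (1 - t) * X + t * Y"
    using nrm_add[OF scale_car[OF c] scale_car[OF c], of "complex_of_real (1 - t)" x "complex_of_real t" y] t
    by (simp only: nrm_scale[OF c] norm_of_real X_def Y_def abs_of_nonneg diff_ge_0_iff_ge less_imp_le)
  then have "(nrm E (a + complex_of_real ((1 - t) *\<^sub>R x + t *\<^sub>R y) *\<^sub>C b))\<^sup>2 \<le> ((1 - t) * X + t * Y)\<^sup>2"
    by (intro power_mono nrm_ge_0[OF c])
  also have "\<dots> \<le> (1 - t) * X\<^sup>2 + t * Y\<^sup>2"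
    using convex_onD[OF convex_power2, of t X Y] t by simp
  finally show "(nrm E (a + complex_of_real ((1 - t) *\<^sub>R x + t *\<^sub>R y) *\<^sub>C b))\<^sup>2
    \<le> (1 - t) * (nrm E (a + complex_of_real x *\<^sub>C b))\<^sup>2 + t * (nrm E (a + complex_of_real y *\<^sub>C b))\<^sup>2"
    by (simp only: X_def Y_def)
qed simp

lemma type_2_sign_avg:
  assumes c: "c > 0" "\<And>n x. (\<forall>i\<in>{1..n}. x i \<in> car E) \<Longrightarrow>
        rademacher_average E n x \<le> c * sqrt (\<Sum>i=1..n. (nrm E (x i))\<^sup>2)"
    and vs: "set vs \<subseteq> car E"
  shows "sign_avg (\<lambda>v. (nrm E v)\<^sup>2) vs 0 \<le> c\<^sup>2 * (\<Sum>v\<leftarrow>vs. (nrm E v)\<^sup>2)"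
proof -
  define n where "n = length vs"
  define x where "x i = vs ! (i - 1)" for i
  have vs_eq: "vs = map x [1..<Suc n]"
    by (rule nth_equalityI) (auto simp: n_def x_def simp del: upt_Suc)
  have xc: "\<forall>i\<in>{1..n}. x i \<in> car E" using vs unfolding vs_eq by (auto simp del: upt_Suc)
  have s: "(\<Sum>v\<leftarrow>vs. (nrm E v)\<^sup>2) = (\<Sum>i=1..n. (nrm E (x i))\<^sup>2)"
    unfolding vs_eq map_map
    by (subst sum_list_distinct_conv_sum_set) (simp_all add: atLeastLessThanSuc_atLeastAtMost del: upt_Suc)
  have "rademacher_average E n x \<le> c * sqrt (\<Sum>i=1..n. (nrm E (x i))\<^sup>2)" by (rule c(2)[OF xc])
  moreover have "rademacher_average E n x \<ge> 0"
    unfolding rademacher_average_def set_lebesgue_integral_def by (intro real_sqrt_ge_zero integral_nonneg_AE) auto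
  ultimately have "(rademacher_average E n x)\<^sup>2 \<le> (c * sqrt (\<Sum>i=1..n. (nrm E (x i))\<^sup>2))\<^sup>2"
    by (intro power_mono) auto
  also have "\<dots> = c\<^sup>2 * (\<Sum>i=1..n. (nrm E (x i))\<^sup>2)"
    by (simp add: power_mult_distrib sum_nonneg)
  finally show ?thesis
    unfolding s rademacher_average_sq(2) vs_eq[symmetric] .
qed

text \<open>
  All vectors involved are combinations of the \<open>y\<^sub>k\<close>, so the squared norm can be pulled back to
  coefficient sequences, where it is continuous and Gaussian averages make sense.
\<close>

lemma type_2_real_contraction:
  fixes m :: nat
  assumes c: "c > 0" "\<And>n x. (\<forall>i\<in>{1..n}. x i \<in> car E) \<Longrightarrow>
        rademacher_average E n x \<le> c * sqrt (\<Sum>i=1..n. (nrm E (x i))\<^sup>2)"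
    and y: "\<And>k. k < m \<Longrightarrow> y k \<in> car E" and m: "m > 0"
    and A: "\<And>b. (\<Sum>k<m. (\<Sum>i=1..n. A k i * b i)\<^sup>2) \<le> \<rho> * (\<Sum>i=1..n. (b i)\<^sup>2)" and \<rho>: "\<rho> < 1"
  shows "(rademacher_average E n (\<lambda>i. \<Sum>k<m. complex_of_real (A k i) *\<^sub>C y k))\<^sup>2
      \<le> pi / 2 * c\<^sup>2 * (\<Sum>k<m. (nrm E (y k))\<^sup>2)"
proof -
  define h where "h \<xi> = (nrm E (lin_comb m y \<xi>))\<^sup>2" for \<xi>
  define e where "e k = (\<lambda>l::nat. if l = k then 1 else 0 :: real)" for k :: nat
  define ps where "ps = map (\<lambda>k. (e k, \<lambda>i. A k i)) [0..<m]"
  have y': "\<And>k. k < m \<Longrightarrow> y k \<in> car E" by (rule y)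
  have lc: "lin_comb m y \<xi> \<in> car E" for \<xi> using y by (rule lin_comb_car)
  have ps_sum: "(\<Sum>x\<leftarrow>ps. f x) = (\<Sum>k<m. f (e k, \<lambda>i. A k i))" for f :: "_ \<Rightarrow> real"
    unfolding ps_def map_map o_def interv_sum_list_conv_sum_set_nat by (simp add: atLeast0LessThan)
  have he: "lin_comb m y (e k) = y k" if "k < m" for k
  proof -
    have "lin_comb m y (e k) = (\<Sum>l<m. if l = k then y k else 0)"
      unfolding lin_comb_def e_def by (intro sum.cong refl) (auto simp: scaleC_one)
    then show ?thesis using that by simp
  qed
  have col: "lin_comb m y (\<lambda>k. \<Sum>x\<leftarrow>ps. snd x i * fst x k) = (\<Sum>k<m. complex_of_real (A k i) *\<^sub>C y k)" for i
  proof -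
    have "(\<Sum>l<m. A l i * (if k = l then 1 else 0)) = A k i" if "k < m" for k
      using that by (simp add: if_distrib[of "\<lambda>z. _ * z"] cong: if_cong)
    then show ?thesis by (simp add: lin_comb_def ps_sum e_def)
  qed
  have "sign_avg h (map (\<lambda>j k. \<Sum>x\<leftarrow>ps. snd x j * fst x k) [1..<Suc n]) 0 \<le> pi / 2 * c\<^sup>2 * (\<Sum>x\<leftarrow>ps. h (fst x))"
  proof (rule sign_avg_type_2_contraction)
    have "(\<lambda>\<xi>. nrm E (lin_comb m y \<xi>)) \<in> borel_measurable borel"
      using continuous_nrm_lin_comb[OF y] by (intro borel_measurable_continuous_onI) auto
    then show "h \<in> borel_measurable borel" unfolding h_def by measurable
    show "h v \<ge> 0" for v by (simp add: h_def)
    show "h (smul t v) = t\<^sup>2 * h v" for t v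
      by (simp add: h_def lin_comb_smul nrm_scale[OF lc] power_mult_distrib)
    show "convex_on UNIV (\<lambda>t. h (v + smul t u))" for v u
      unfolding h_def lin_comb_add lin_comb_smul by (rule convex_nrm_sq_line[OF lc lc])
    show "c\<^sup>2 \<ge> 0" by simp
    show "sign_avg h us 0 \<le> c\<^sup>2 * (\<Sum>u\<leftarrow>us. h u)" for us
    proof -
      have "lin_comb m y 0 = 0" by (simp add: lin_comb_def)
      then have "sign_avg h us 0 = sign_avg (\<lambda>v. (nrm E v)\<^sup>2) (map (lin_comb m y) us) 0"
        using sign_avg_map[of "lin_comb m y" "\<lambda>v. (nrm E v)\<^sup>2" us 0] by (simp add: lin_comb_add lin_comb_diff h_def[abs_def])
      also have "\<dots> \<le> c\<^sup>2 * (\<Sum>v\<leftarrow>map (lin_comb m y) us. (nrm E v)\<^sup>2)"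
        using lc by (intro type_2_sign_avg c) auto
      finally show ?thesis by (simp add: h_def o_def)
    qed
    show "\<rho> < 1" by (rule \<rho>)
    show "ps \<noteq> []" using m by (simp add: ps_def)
    show "distinct [1..<Suc n]" by (rule distinct_upt)
    show "(\<Sum>x\<leftarrow>ps. (\<Sum>j\<in>set [1..<Suc n]. b j * snd x j)\<^sup>2) \<le> \<rho> * (\<Sum>j\<in>set [1..<Suc n]. (b j)\<^sup>2)" for b
      using A[of b] unfolding ps_sum set_upt atLeastLessThanSuc_atLeastAtMost by (simp add: mult.commute)
  qed
  also have "(\<Sum>x\<leftarrow>ps. h (fst x)) = (\<Sum>k<m. (nrm E (y k))\<^sup>2)"
    unfolding ps_sum by (intro sum.cong refl) (simp add: h_def he)
  also have "sign_avg h (map (\<lambda>j k. \<Sum>x\<leftarrow>ps. snd x j * fst x k) [1..<Suc n]) 0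
      = (rademacher_average E n (\<lambda>i. \<Sum>k<m. complex_of_real (A k i) *\<^sub>C y k))\<^sup>2"
  proof -
    have z: "lin_comb m y 0 = 0" by (simp add: lin_comb_def)
    show ?thesis
      unfolding rademacher_average_sq(2) col[symmetric]
      using sign_avg_map[of "lin_comb m y" "\<lambda>v. (nrm E v)\<^sup>2" "map (\<lambda>j k. \<Sum>x\<leftarrow>ps. snd x j * fst x k) [1..<Suc n]" 0]
      unfolding z map_map by (simp only: lin_comb_add lin_comb_diff h_def[abs_def] o_def)
  qed
  finally show ?thesis .
qed

text \<open>
  The real and imaginary parts of \<open>w\<close> are bounded by \<open>M\<close> on real sequences.  Division by \<open>2 M\<close>
  turns them into contractions with squared norm at most \<open>1 / 4\<close>.
\<close>

theorem type_2_contraction: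
  assumes "type_2 E"
  shows "\<exists>C>0. \<forall>(m::nat) n w y M. m > 0 \<longrightarrow> M > 0 \<longrightarrow> (\<forall>k<m. y k \<in> car E) \<longrightarrow>
      l2_bounded {..<m} {1..n} M w \<longrightarrow>
      (rademacher_average E n (\<lambda>i. \<Sum>k<m. w k i *\<^sub>C y k))\<^sup>2 \<le> C * M\<^sup>2 * (\<Sum>k<m. (nrm E (y k))\<^sup>2)"
proof -
  obtain c where c: "c > 0" "\<And>n x. (\<forall>i\<in>{1..n}. x i \<in> car E) \<Longrightarrow>
        rademacher_average E n x \<le> c * sqrt (\<Sum>i=1..n. (nrm E (x i))\<^sup>2)"
    using assms unfolding type_2_def by blast
  show ?thesis
  proof (intro exI[of _ "8 * pi * c\<^sup>2"] conjI allI impI)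
    show "8 * pi * c\<^sup>2 > 0" using c by simp
  next
    fix m n :: nat and w y and M :: real
    assume m: "m > 0" and M: "M > 0" and "\<forall>k<m. y k \<in> car E"
      and "l2_bounded {..<m} {1..n} M w"
    then have y: "\<And>k. k < m \<Longrightarrow> y k \<in> car E"
      and w: "\<And>b. (\<Sum>k<m. (cmod (\<Sum>i=1..n. w k i * b i))\<^sup>2) \<le> M\<^sup>2 * (\<Sum>i=1..n. (cmod (b i))\<^sup>2)"
      by (auto simp: l2_bounded_def)
    define S where "S = (\<Sum>k<m. (nrm E (y k))\<^sup>2)"
    define A where "A P k i = P (w k i) / (2 * M)" for P :: "complex \<Rightarrow> real" and k i
    define a where "a P i = (\<Sum>k<m. complex_of_real (A P k i) *\<^sub>C y k)" for P i
    let ?R = "rademacher_comb n"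
    have bound: "(rademacher_average E n (a P))\<^sup>2 \<le> pi / 2 * c\<^sup>2 * S"
      if P: "\<And>z. \<bar>P z\<bar> \<le> cmod z" "\<And>(b::nat \<Rightarrow> real) k. P (\<Sum>i=1..n. w k i * of_real (b i)) = (\<Sum>i=1..n. P (w k i) * b i)" for P
      unfolding a_def S_def
    proof (rule type_2_real_contraction[OF c y m])
      fix b :: "nat \<Rightarrow> real"
      have "(\<Sum>k<m. (\<Sum>i=1..n. A P k i * b i)\<^sup>2) \<le> (\<Sum>k<m. (cmod (\<Sum>i=1..n. w k i * of_real (b i)))\<^sup>2 / (4 * M\<^sup>2))"
      proof (rule sum_mono)
        fix k
        have "(\<Sum>i=1..n. A P k i * b i) = P (\<Sum>i=1..n. w k i * of_real (b i)) / (2 * M)"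
          unfolding P(2) sum_divide_distrib by (intro sum.cong refl) (simp add: A_def)
        moreover have "(P (\<Sum>i=1..n. w k i * of_real (b i)))\<^sup>2 \<le> (cmod (\<Sum>i=1..n. w k i * of_real (b i)))\<^sup>2"
          using P(1) by (intro abs_le_square_iff[THEN iffD1]) simp
        ultimately show "(\<Sum>i=1..n. A P k i * b i)\<^sup>2 \<le> (cmod (\<Sum>i=1..n. w k i * of_real (b i)))\<^sup>2 / (4 * M\<^sup>2)"
          by (simp only: power_divide power_mult_distrib) (simp add: divide_right_mono)
      qed
      also have "\<dots> = (\<Sum>k<m. (cmod (\<Sum>i=1..n. w k i * of_real (b i)))\<^sup>2) / (4 * M\<^sup>2)"
        by (simp add: sum_divide_distrib)
      also have "\<dots> \<le> (M\<^sup>2 * (\<Sum>i=1..n. (cmod (complex_of_real (b i)))\<^sup>2)) / (4 * M\<^sup>2)"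
        using M by (intro divide_right_mono w) auto
      also have "\<dots> = 1 / 4 * (\<Sum>i=1..n. (b i)\<^sup>2)" using M by simp
      finally show "(\<Sum>k<m. (\<Sum>i=1..n. A P k i * b i)\<^sup>2) \<le> 1 / 4 * (\<Sum>i=1..n. (b i)\<^sup>2)" .
    next
      show "1 / 4 < (1 :: real)" by simp
    qed
    have bRe: "(rademacher_average E n (a Re))\<^sup>2 \<le> pi / 2 * c\<^sup>2 * S"
      by (rule bound) (simp_all add: abs_Re_le_cmod)
    have bIm: "(rademacher_average E n (a Im))\<^sup>2 \<le> pi / 2 * c\<^sup>2 * S"
      by (rule bound) (simp_all add: abs_Im_le_cmod)
    define z where "z i = (\<Sum>k<m. w k i *\<^sub>C y k)" for i
    have ac: "a P i \<in> car E" for P i unfolding a_def using y by (intro sum_car) auto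
    have Rc: "?R (a P) t \<in> car E" for P t unfolding rademacher_comb_def using ac by (intro sum_car) auto
    have z: "z i = of_real (2 * M) *\<^sub>C a Re i + (\<i> * of_real (2 * M)) *\<^sub>C a Im i" for i
    proof -
      have "w k i = of_real (2 * M) * of_real (A Re k i) + \<i> * of_real (2 * M) * of_real (A Im k i)" for k
        using M by (simp add: A_def complex_eq_iff)
      then show ?thesis
        unfolding z_def a_def complex_vector.scale_sum_right sum.distrib[symmetric]
        by (intro sum.cong refl) (metis complex_vector.scale_left_distrib complex_vector.scale_scale)
    qed
    have Rz: "?R z t = of_real (2 * M) *\<^sub>C ?R (a Re) t + (\<i> * of_real (2 * M)) *\<^sub>C ?R (a Im) t" for t
      unfolding rademacher_comb_def z complex_vector.scale_sum_right sum.distrib[symmetric]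
      by (intro sum.cong refl) (simp add: complex_vector.scale_right_distrib mult_ac)
    define r where "r j = (if j then a Re else a Im)" for j
    have point: "(nrm E (?R z t))\<^sup>2 \<le> 0 + (\<Sum>j\<in>UNIV. 8 * M\<^sup>2 * (nrm E (?R (r j) t))\<^sup>2)" for t
    proof -
      define p where "p = nrm E (?R (a Re) t)"
      define q where "q = nrm E (?R (a Im) t)"
      have "nrm E (?R z t) \<le> nrm E (of_real (2 * M) *\<^sub>C ?R (a Re) t) + nrm E ((\<i> * of_real (2 * M)) *\<^sub>C ?R (a Im) t)"
        unfolding Rz by (intro nrm_add scale_car Rc)
      also have "\<dots> = 2 * M * (p + q)"
        using M by (simp add: nrm_scale[OF Rc] norm_mult p_def q_def algebra_simps)
      finally have "(nrm E (?R z t))\<^sup>2 \<le> (2 * M * (p + q))\<^sup>2"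
        unfolding Rz by (intro power_mono nrm_ge_0 add_car scale_car Rc)
      also have "\<dots> = 4 * M\<^sup>2 * (p + q)\<^sup>2" by (simp add: power_mult_distrib)
      also have "\<dots> \<le> 4 * M\<^sup>2 * (2 * p\<^sup>2 + 2 * q\<^sup>2)"
      proof -
        have "(p + q)\<^sup>2 + (p - q)\<^sup>2 = 2 * p\<^sup>2 + 2 * q\<^sup>2" by (simp add: power2_eq_square algebra_simps)
        moreover have "(p - q)\<^sup>2 \<ge> 0" by simp
        ultimately have "(p + q)\<^sup>2 \<le> 2 * p\<^sup>2 + 2 * q\<^sup>2" by linarith
        then show ?thesis by (intro mult_left_mono) auto
      qed
      finally show ?thesis by (simp add: UNIV_bool r_def p_def q_def algebra_simps)
    qed
    have "(rademacher_average E n z)\<^sup>2 \<le> 0 + (\<Sum>j\<in>UNIV. 8 * M\<^sup>2 * (rademacher_average E n (r j))\<^sup>2)"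
      by (rule rademacher_average_sq_le[OF point])
    also have "\<dots> = 8 * M\<^sup>2 * (rademacher_average E n (a Im))\<^sup>2 + 8 * M\<^sup>2 * (rademacher_average E n (a Re))\<^sup>2"
      by (simp add: UNIV_bool r_def)
    also have "\<dots> \<le> 8 * M\<^sup>2 * (pi / 2 * c\<^sup>2 * S) + 8 * M\<^sup>2 * (pi / 2 * c\<^sup>2 * S)"
      by (intro add_mono mult_left_mono bRe bIm) auto
    finally show "(rademacher_average E n (\<lambda>i. \<Sum>k<m. w k i *\<^sub>C y k))\<^sup>2 \<le> 8 * pi * c\<^sup>2 * M\<^sup>2 * (\<Sum>k<m. (nrm E (y k))\<^sup>2)"
      unfolding z_def[symmetric] S_def[symmetric] by (simp add: algebra_simps)
  qed
qed

end

section \<open>Interpolation couples and Calderon functions\<close>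


context normed_carrier
begin

lemma continuous_map_limitin:
  fixes S :: "'b::topological_space set"
  shows "continuous_map (top_of_set S) (norm_topology E) f \<longleftrightarrow>
    (\<forall>x\<in>S. limitin (norm_topology E) f (f x) (at x within S))"
proof -
  have "\<forall>x\<in>S. f x \<in> car E \<Longrightarrow> \<forall>\<^sub>F y in at x within S. f y \<in> car E" for x
    by (auto simp: eventually_at_filter)
  then show ?thesis unfolding continuous_map_norm_iff limitin_norm_iff by blast
qed

lemma limitin_nrm:
  assumes "limitin (norm_topology E) f a F"
  shows "((\<lambda>x. nrm E (f x)) \<longlongrightarrow> nrm E a) F"
proof -
  from assms have a: "a \<in> car E" and ev: "\<forall>\<^sub>F x in F. f x \<in> car E"
    and lim: "((\<lambda>x. nrm E (f x - a)) \<longlongrightarrow> 0) F" by (auto simp: limitin_norm_iff)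
  have "((\<lambda>x. nrm E (f x) - nrm E a) \<longlongrightarrow> 0) F"
  proof (rule Lim_null_comparison[OF _ lim])
    show "\<forall>\<^sub>F x in F. norm (nrm E (f x) - nrm E a) \<le> nrm E (f x - a)"
      using ev
    proof eventually_elim
      case (elim x)
      then show ?case
        using nrm_le_add_diff[OF elim a] nrm_le_add_diff[OF a elim] nrm_diff_commute[OF elim a] by auto
    qed
  qed
  then show ?thesis by (simp add: LIM_zero_iff)
qed

end

text \<open>
The scalar functions by which Calderon functions may be multiplied.
\<close>

definition multiplier :: "(complex \<Rightarrow> complex) \<Rightarrow> bool" where
  "multiplier d \<longleftrightarrow> continuous_on strip d \<and> (\<exists>B. \<forall>z\<in>strip. cmod (d z) \<le> B) \<and>
    (\<forall>z\<in>open_strip. d field_differentiable at z)"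

lemma multiplier_const: "multiplier (\<lambda>_. c)"
  by (auto simp: multiplier_def intro: exI[of _ "cmod c"])

locale couple =
  fixes F0 F1 :: "'v::complex_vector normed"
  assumes couple: "interpolation_couple F0 F1"
begin

sublocale N0: normed_carrier F0
  using couple by unfold_locales (simp add: interpolation_couple_def banach_space_def)

sublocale N1: normed_carrier F1
  using couple by unfold_locales (simp add: interpolation_couple_def banach_space_def)

abbreviation \<Sigma> :: "'v normed" where "\<Sigma> \<equiv> sum_space F0 F1"

lemma car_sum: "car \<Sigma> = {a + b | a b. a \<in> car F0 \<and> b \<in> car F1}"
  by (simp add: sum_space_def)

lemma sum_nrm_lower: "y \<in> {nrm F0 a + nrm F1 b | a b. a \<in> car F0 \<and> b \<in> car F1 \<and> x = a + b} \<Longrightarrow> 0 \<le> y"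
  by auto

lemma sum_nrm_bdd: "bdd_below {nrm F0 a + nrm F1 b | a b. a \<in> car F0 \<and> b \<in> car F1 \<and> x = a + b}"
  by (rule bdd_belowI[of _ 0]) (rule sum_nrm_lower)

lemma sum_nrm_le:
  assumes "a \<in> car F0" "b \<in> car F1"
  shows "nrm \<Sigma> (a + b) \<le> nrm F0 a + nrm F1 b"
proof -
  have "Inf {nrm F0 a' + nrm F1 b' | a' b'. a' \<in> car F0 \<and> b' \<in> car F1 \<and> a + b = a' + b'} \<le> nrm F0 a + nrm F1 b"
    by (rule cInf_lower[OF _ sum_nrm_bdd]) (use assms in blast)
  then show ?thesis by (simp add: sum_space_def)
qed

lemma sum_nrm_ge_0:
  assumes "x \<in> car \<Sigma>"
  shows "0 \<le> nrm \<Sigma> x"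
proof -
  have "0 \<le> Inf {nrm F0 a + nrm F1 b | a b. a \<in> car F0 \<and> b \<in> car F1 \<and> x = a + b}"
    by (rule cInf_greatest) (use assms sum_nrm_lower in \<open>auto simp: car_sum\<close>)
  then show ?thesis by (simp add: sum_space_def)
qed

lemma sum_nrm_approx:
  assumes "x \<in> car \<Sigma>" "e > 0"
  obtains a b where "a \<in> car F0" "b \<in> car F1" "x = a + b" "nrm F0 a + nrm F1 b < nrm \<Sigma> x + e"
proof -
  let ?S = "{nrm F0 a + nrm F1 b | a b. a \<in> car F0 \<and> b \<in> car F1 \<and> x = a + b}"
  have "?S \<noteq> {}" using assms by (auto simp: car_sum)
  moreover have "Inf ?S < nrm \<Sigma> x + e" using assms(2) by (simp add: sum_space_def)
  ultimately have "\<exists>y\<in>?S. y < nrm \<Sigma> x + e" by (rule cInf_lessD)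
  then obtain a b where "a \<in> car F0" "b \<in> car F1" "x = a + b" "nrm F0 a + nrm F1 b < nrm \<Sigma> x + e"
    by (elim bexE CollectE exE conjE) simp
  then show ?thesis by (rule that)
qed

text \<open>
  An element of norm zero is a sum \<open>a\<^sub>n + b\<^sub>n\<close> with \<open>a\<^sub>n\<close> and \<open>b\<^sub>n\<close> tending to zero in their spaces, hence in
  the common Hausdorff vector topology.
\<close>

lemma sum_nrm_definite:
  assumes x: "x \<in> car \<Sigma>" and 0: "nrm \<Sigma> x = 0"
  shows "x = 0"
proof -
  obtain \<T> where T: "hausdorff_vector_topology \<T>"
    and c0: "continuous_map (norm_topology F0) \<T> id" and c1: "continuous_map (norm_topology F1) \<T> id"
    using couple by (auto simp: interpolation_couple_def)
  have "\<exists>a b. a \<in> car F0 \<and> b \<in> car F1 \<and> x = a + b \<and> nrm F0 a + nrm F1 b < 1 / real (Suc n)" for n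
  proof -
    have "0 < 1 / real (Suc n)" by simp
    from sum_nrm_approx[OF x this] show ?thesis unfolding 0 add_0 by blast
  qed
  then obtain a b where ab: "\<And>n. a n \<in> car F0" "\<And>n. b n \<in> car F1" "\<And>n. x = a n + b n"
    "\<And>n. nrm F0 (a n) + nrm F1 (b n) < 1 / real (Suc n)" by metis
  have le: "nrm F0 (a n) \<le> 1 / real (Suc n)" "nrm F1 (b n) \<le> 1 / real (Suc n)" for n
    using ab(4)[of n] N0.nrm_ge_0[OF ab(1)[of n]] N1.nrm_ge_0[OF ab(2)[of n]] by linarith+
  have inv: "(\<lambda>n. 1 / real (Suc n)) \<longlonglongrightarrow> 0" using LIMSEQ_inverse_real_of_nat by (simp add: divide_inverse)
  have "(\<lambda>n. nrm F0 (a n)) \<longlonglongrightarrow> 0"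
    by (rule Lim_null_comparison[OF _ inv]) (use le ab in auto)
  then have "limitin (norm_topology F0) a 0 sequentially"
    using ab by (simp add: N0.limitin_norm_iff)
  from continuous_map_limit[OF c0 this] have A: "limitin \<T> a 0 sequentially" by simp
  have "(\<lambda>n. nrm F1 (b n)) \<longlonglongrightarrow> 0"
    by (rule Lim_null_comparison[OF _ inv]) (use le ab in auto)
  then have "limitin (norm_topology F1) b 0 sequentially"
    using ab by (simp add: N1.limitin_norm_iff)
  from continuous_map_limit[OF c1 this] have B: "limitin \<T> b 0 sequentially" by simp
  have "limitin (prod_topology \<T> \<T>) (\<lambda>n. (a n, b n)) (0, 0) sequentially"
    using A B by (simp add: limitin_pairwise o_def)
  moreover have "continuous_map (prod_topology \<T> \<T>) \<T> (\<lambda>(x, y). x + y)"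
    using T by (simp add: hausdorff_vector_topology_def)
  ultimately have "limitin \<T> ((\<lambda>(x, y). x + y) \<circ> (\<lambda>n. (a n, b n))) ((\<lambda>(x, y). x + y) (0, 0)) sequentially"
    by (intro continuous_map_limit)
  moreover have "(\<lambda>(x, y). x + y) \<circ> (\<lambda>n. (a n, b n)) = (\<lambda>n. x)"
    by (rule ext) (simp add: ab(3)[symmetric])
  ultimately have "limitin \<T> (\<lambda>n. x) 0 sequentially" by simp
  moreover have "limitin \<T> (\<lambda>n. x) x sequentially"
    using T by (simp add: hausdorff_vector_topology_def)
  moreover have "Hausdorff_space \<T>" using T by (simp add: hausdorff_vector_topology_def)
  ultimately show "x = 0"
    using limitin_Hausdorff_unique[of \<T> "\<lambda>n. x" x sequentially 0] by simp
qed

lemma normed_sum: "normed_space \<Sigma>"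
proof -
  have sub: "complex_vector.subspace (car \<Sigma>)"
    unfolding car_sum by (rule complex_vector.subspace_sums[OF N0.subspace N1.subspace])
  have add: "nrm \<Sigma> (x + y) \<le> nrm \<Sigma> x + nrm \<Sigma> y" if x: "x \<in> car \<Sigma>" and y: "y \<in> car \<Sigma>" for x y
  proof (rule field_le_epsilon)
    fix e :: real assume e: "e > 0"
    obtain a b where ab: "a \<in> car F0" "b \<in> car F1" "x = a + b" "nrm F0 a + nrm F1 b < nrm \<Sigma> x + e / 2"
      using sum_nrm_approx[OF x half_gt_zero[OF e]] by blast
    obtain a' b' where ab': "a' \<in> car F0" "b' \<in> car F1" "y = a' + b'" "nrm F0 a' + nrm F1 b' < nrm \<Sigma> y + e / 2"
      using sum_nrm_approx[OF y half_gt_zero[OF e]] by blast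
    have xy: "x + y = (a + a') + (b + b')" by (simp add: ab ab' algebra_simps)
    have "nrm \<Sigma> (x + y) \<le> nrm F0 (a + a') + nrm F1 (b + b')"
      unfolding xy using ab ab' by (intro sum_nrm_le) auto
    then show "nrm \<Sigma> (x + y) \<le> nrm \<Sigma> x + nrm \<Sigma> y + e"
      using N0.nrm_add[OF ab(1) ab'(1)] N1.nrm_add[OF ab(2) ab'(2)] ab(4) ab'(4) by linarith
  qed
  have le: "nrm \<Sigma> (c *\<^sub>C x) \<le> cmod c * nrm \<Sigma> x" if x: "x \<in> car \<Sigma>" for c x
  proof (rule field_le_epsilon)
    fix e :: real assume e: "e > 0"
    define d where "d = e / (cmod c + 1)"
    have d: "d > 0" "cmod c * d \<le> e"
    proof -
      show "d > 0" using e by (simp add: d_def add_nonneg_pos)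
      have "cmod c * d \<le> (cmod c + 1) * d" using \<open>d > 0\<close> by (intro mult_right_mono) auto
      also have "\<dots> = e" unfolding d_def by (simp add: add_nonneg_eq_0_iff)
      finally show "cmod c * d \<le> e" .
    qed
    obtain a b where ab: "a \<in> car F0" "b \<in> car F1" "x = a + b" "nrm F0 a + nrm F1 b < nrm \<Sigma> x + d"
      using sum_nrm_approx[OF x d(1)] by blast
    have "nrm \<Sigma> (c *\<^sub>C x) \<le> nrm F0 (c *\<^sub>C a) + nrm F1 (c *\<^sub>C b)"
      using sum_nrm_le[of "c *\<^sub>C a" "c *\<^sub>C b"] ab by (simp add: complex_vector.scale_right_distrib)
    also have "\<dots> = cmod c * (nrm F0 a + nrm F1 b)"
      using ab by (simp add: N0.nrm_scale N1.nrm_scale distrib_left)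
    also have "\<dots> \<le> cmod c * (nrm \<Sigma> x + d)" using ab(4) by (intro mult_left_mono) auto
    finally show "nrm \<Sigma> (c *\<^sub>C x) \<le> cmod c * nrm \<Sigma> x + e" using d(2) by (simp add: distrib_left)
  qed
  have scale: "nrm \<Sigma> (c *\<^sub>C x) = cmod c * nrm \<Sigma> x" if x: "x \<in> car \<Sigma>" for c x
  proof (cases "c = 0")
    case True
    have "nrm \<Sigma> (0 *\<^sub>C x) \<le> 0" using le[OF x, of 0] by simp
    moreover have "0 \<le> nrm \<Sigma> (0 *\<^sub>C x)"
      using x by (intro sum_nrm_ge_0 complex_vector.subspace_scale[OF sub])
    ultimately show ?thesis using True by simp
  next
    case False
    have "nrm \<Sigma> (inverse c *\<^sub>C c *\<^sub>C x) \<le> cmod (inverse c) * nrm \<Sigma> (c *\<^sub>C x)"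
      using x by (intro le complex_vector.subspace_scale[OF sub])
    then have "nrm \<Sigma> x \<le> inverse (cmod c) * nrm \<Sigma> (c *\<^sub>C x)"
      by (simp only: scaleC_scaleC left_inverse[OF False] scaleC_one norm_inverse)
    then have "cmod c * nrm \<Sigma> x \<le> cmod c * (inverse (cmod c) * nrm \<Sigma> (c *\<^sub>C x))"
      by (rule mult_left_mono) simp
    also have "\<dots> = nrm \<Sigma> (c *\<^sub>C x)" using False by simp
    finally have "cmod c * nrm \<Sigma> x \<le> nrm \<Sigma> (c *\<^sub>C x)" .
    then show ?thesis using le[OF x, of c] by linarith
  qed
  show ?thesis
    unfolding normed_space_def using sub add scale sum_nrm_definite by blast
qed

sublocale NS: normed_carrier \<Sigma>
  by unfold_locales (rule normed_sum)

lemma calderon_iff: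
  "f \<in> calderon_functions F0 F1 \<longleftrightarrow>
    (\<forall>z\<in>strip. limitin (norm_topology \<Sigma>) f (f z) (at z within strip)) \<and>
    (\<exists>B. \<forall>z\<in>strip. nrm \<Sigma> (f z) \<le> B) \<and>
    (\<forall>z\<in>open_strip. \<exists>d. limitin (norm_topology \<Sigma>) (\<lambda>w. inverse (w - z) *\<^sub>C (f w - f z)) d (at z)) \<and>
    (\<forall>t::real. limitin (norm_topology F0) (\<lambda>t. f (Complex 0 t)) (f (Complex 0 t)) (at t)) \<and>
    ((\<lambda>t::real. nrm F0 (f (Complex 0 t))) \<longlongrightarrow> 0) at_infinity \<and>
    (\<forall>t::real. limitin (norm_topology F1) (\<lambda>t. f (Complex 1 t)) (f (Complex 1 t)) (at t)) \<and>
    ((\<lambda>t::real. nrm F1 (f (Complex 1 t))) \<longlongrightarrow> 0) at_infinity"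
  unfolding calderon_functions_def
  using N0.continuous_map_limitin[of UNIV "\<lambda>t::real. f (Complex 0 t)"]
    N1.continuous_map_limitin[of UNIV "\<lambda>t::real. f (Complex 1 t)"]
  by (simp add: NS.continuous_map_limitin)

lemma calderonD:
  assumes "f \<in> calderon_functions F0 F1"
  shows "z \<in> strip \<Longrightarrow> limitin (norm_topology \<Sigma>) f (f z) (at z within strip)"
    and "\<exists>B. \<forall>z\<in>strip. nrm \<Sigma> (f z) \<le> B"
    and "z \<in> open_strip \<Longrightarrow> \<exists>d. limitin (norm_topology \<Sigma>) (\<lambda>w. inverse (w - z) *\<^sub>C (f w - f z)) d (at z)"
    and "limitin (norm_topology F0) (\<lambda>t. f (Complex 0 t)) (f (Complex 0 t)) (at t)"
    and "((\<lambda>t. nrm F0 (f (Complex 0 t))) \<longlongrightarrow> 0) at_infinity"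
    and "limitin (norm_topology F1) (\<lambda>t. f (Complex 1 t)) (f (Complex 1 t)) (at t)"
    and "((\<lambda>t. nrm F1 (f (Complex 1 t))) \<longlongrightarrow> 0) at_infinity"
  using assms unfolding calderon_iff by blast+

lemma calderon_car:
  assumes "f \<in> calderon_functions F0 F1"
  shows "z \<in> strip \<Longrightarrow> f z \<in> car \<Sigma>" "f (Complex 0 t) \<in> car F0" "f (Complex 1 t) \<in> car F1"
  using assms unfolding calderon_iff
  by (auto simp: NS.limitin_norm_iff N0.limitin_norm_iff N1.limitin_norm_iff)

lemma calderon_zero: "(\<lambda>_. 0) \<in> calderon_functions F0 F1"
  unfolding calderon_iff
  by (auto simp: NS.limitin_norm_iff N0.limitin_norm_iff N1.limitin_norm_iff intro!: exI[of _ 0])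

lemma calderon_add:
  assumes f: "f \<in> calderon_functions F0 F1" and g: "g \<in> calderon_functions F0 F1"
  shows "(\<lambda>z. f z + g z) \<in> calderon_functions F0 F1"
  unfolding calderon_iff
proof (intro conjI ballI allI)
  show "limitin (norm_topology \<Sigma>) (\<lambda>z. f z + g z) (f z + g z) (at z within strip)" if "z \<in> strip" for z
    by (intro NS.limitin_add calderonD f g that)
  show "\<exists>B. \<forall>z\<in>strip. nrm \<Sigma> (f z + g z) \<le> B"
  proof -
    obtain B C where "\<forall>z\<in>strip. nrm \<Sigma> (f z) \<le> B" "\<forall>z\<in>strip. nrm \<Sigma> (g z) \<le> C"
      using calderonD(2)[OF f] calderonD(2)[OF g] by blast
    then have "\<forall>z\<in>strip. nrm \<Sigma> (f z + g z) \<le> B + C"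
      using NS.nrm_add calderon_car(1)[OF f] calderon_car(1)[OF g] by (meson add_mono order_trans)
    then show ?thesis by blast
  qed
  show "\<exists>d. limitin (norm_topology \<Sigma>) (\<lambda>w. inverse (w - z) *\<^sub>C (f w + g w - (f z + g z))) d (at z)" if z: "z \<in> open_strip" for z
  proof -
    obtain d d' where "limitin (norm_topology \<Sigma>) (\<lambda>w. inverse (w - z) *\<^sub>C (f w - f z)) d (at z)"
      "limitin (norm_topology \<Sigma>) (\<lambda>w. inverse (w - z) *\<^sub>C (g w - g z)) d' (at z)"
      using calderonD(3)[OF f z] calderonD(3)[OF g z] by blast
    from NS.limitin_add[OF this]
    have "limitin (norm_topology \<Sigma>) (\<lambda>w. inverse (w - z) *\<^sub>C (f w + g w - (f z + g z))) (d + d') (at z)"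
      by (simp add: add_diff_add complex_vector.scale_right_distrib)
    then show ?thesis by blast
  qed
  show "limitin (norm_topology F0) (\<lambda>t. f (Complex 0 t) + g (Complex 0 t)) (f (Complex 0 t) + g (Complex 0 t)) (at t)" for t
    by (intro N0.limitin_add calderonD f g)
  show "limitin (norm_topology F1) (\<lambda>t. f (Complex 1 t) + g (Complex 1 t)) (f (Complex 1 t) + g (Complex 1 t)) (at t)" for t
    by (intro N1.limitin_add calderonD f g)
  show "((\<lambda>t. nrm F0 (f (Complex 0 t) + g (Complex 0 t))) \<longlongrightarrow> 0) at_infinity"
  proof (rule Lim_null_comparison)
    show "\<forall>\<^sub>F t in at_infinity. norm (nrm F0 (f (Complex 0 t) + g (Complex 0 t))) \<le> nrm F0 (f (Complex 0 t)) + nrm F0 (g (Complex 0 t))"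
      using calderon_car[OF f] calderon_car[OF g] by (intro always_eventually) (simp add: N0.nrm_add)
    show "((\<lambda>t. nrm F0 (f (Complex 0 t)) + nrm F0 (g (Complex 0 t))) \<longlongrightarrow> 0) at_infinity"
      by (intro tendsto_add_zero calderonD f g)
  qed
  show "((\<lambda>t. nrm F1 (f (Complex 1 t) + g (Complex 1 t))) \<longlongrightarrow> 0) at_infinity"
  proof (rule Lim_null_comparison)
    show "\<forall>\<^sub>F t in at_infinity. norm (nrm F1 (f (Complex 1 t) + g (Complex 1 t))) \<le> nrm F1 (f (Complex 1 t)) + nrm F1 (g (Complex 1 t))"
      using calderon_car[OF f] calderon_car[OF g] by (intro always_eventually) (simp add: N1.nrm_add)
    show "((\<lambda>t. nrm F1 (f (Complex 1 t)) + nrm F1 (g (Complex 1 t))) \<longlongrightarrow> 0) at_infinity"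
      by (intro tendsto_add_zero calderonD f g)
  qed
qed

lemma calderon_mult:
  assumes d: "multiplier d" and f: "f \<in> calderon_functions F0 F1"
  shows "(\<lambda>z. d z *\<^sub>C f z) \<in> calderon_functions F0 F1"
proof -
  obtain Bd where Bd: "\<And>z. z \<in> strip \<Longrightarrow> cmod (d z) \<le> Bd"
    using d by (auto simp: multiplier_def)
  have c: "continuous_on strip d" using d by (simp add: multiplier_def)
  have line: "((\<lambda>t. d (Complex a t)) \<longlongrightarrow> d (Complex a t)) (at t)" if a: "0 \<le> a" "a \<le> 1" for a t
  proof -
    have "continuous_on UNIV (\<lambda>t. d (Complex a t))"
      by (rule continuous_on_compose2[OF c]) (use a in \<open>auto simp: strip_def Complex_eq intro!: continuous_intros\<close>)
    then show ?thesis by (simp add: continuous_on_def)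
  qed
  have on0: "Complex 0 t \<in> strip" and on1: "Complex 1 t \<in> strip" for t by (simp_all add: strip_def)
  have open_sub: "open_strip \<subseteq> strip" by (auto simp: open_strip_def strip_def)
  show ?thesis
    unfolding calderon_iff
  proof (intro conjI ballI allI)
    show "limitin (norm_topology \<Sigma>) (\<lambda>z. d z *\<^sub>C f z) (d z *\<^sub>C f z) (at z within strip)" if "z \<in> strip" for z
      using c that by (intro NS.limitin_scale calderonD f) (auto simp: continuous_on_def)
    show "\<exists>B. \<forall>z\<in>strip. nrm \<Sigma> (d z *\<^sub>C f z) \<le> B"
    proof -
      obtain B where B: "\<forall>z\<in>strip. nrm \<Sigma> (f z) \<le> B" using calderonD(2)[OF f] by blast
      have "nrm \<Sigma> (d z *\<^sub>C f z) \<le> Bd * B" if "z \<in> strip" for z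
      proof -
        have "Bd \<ge> 0" using Bd[OF that] norm_ge_zero order_trans by blast
        then show ?thesis
          using Bd[OF that] B that calderon_car(1)[OF f that] by (simp add: NS.nrm_scale mult_mono)
      qed
      then show ?thesis by blast
    qed
    show "\<exists>e. limitin (norm_topology \<Sigma>) (\<lambda>w. inverse (w - z) *\<^sub>C (d w *\<^sub>C f w - d z *\<^sub>C f z)) e (at z)" if z: "z \<in> open_strip" for z
    proof -
      obtain e where e: "limitin (norm_topology \<Sigma>) (\<lambda>w. inverse (w - z) *\<^sub>C (f w - f z)) e (at z)"
        using calderonD(3)[OF f z] by blast
      obtain d' where d': "(d has_field_derivative d') (at z)"
        using d z by (auto simp: multiplier_def field_differentiable_def)
      then have q: "((\<lambda>w. (d w - d z) / (w - z)) \<longlongrightarrow> d') (at z)"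
        by (simp add: has_field_derivative_iff)
      have dc: "(d \<longlongrightarrow> d z) (at z)" using DERIV_isCont[OF d'] by (simp add: isCont_def)
      have fz: "f z \<in> car \<Sigma>" using calderon_car(1)[OF f] z open_sub by auto
      have "limitin (norm_topology \<Sigma>) (\<lambda>w. d w *\<^sub>C inverse (w - z) *\<^sub>C (f w - f z) + ((d w - d z) / (w - z)) *\<^sub>C f z)
          (d z *\<^sub>C e + d' *\<^sub>C f z) (at z)"
        by (intro NS.limitin_add NS.limitin_scale dc e q NS.limitin_const' fz)
      moreover have "d w *\<^sub>C inverse (w - z) *\<^sub>C (f w - f z) + ((d w - d z) / (w - z)) *\<^sub>C f z
          = inverse (w - z) *\<^sub>C (d w *\<^sub>C f w - d z *\<^sub>C f z)" for w
      proof -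
        have "d w *\<^sub>C f w - d z *\<^sub>C f z = d w *\<^sub>C (f w - f z) + (d w - d z) *\<^sub>C f z"
          by (simp add: complex_vector.scale_right_diff_distrib complex_vector.scale_left_diff_distrib)
        then show ?thesis
          by (simp add: complex_vector.scale_right_distrib scaleC_scaleC divide_inverse mult.commute)
      qed
      ultimately show ?thesis by auto
    qed
    show "limitin (norm_topology F0) (\<lambda>t. d (Complex 0 t) *\<^sub>C f (Complex 0 t)) (d (Complex 0 t) *\<^sub>C f (Complex 0 t)) (at t)" for t
      by (intro N0.limitin_scale calderonD f line) auto
    show "limitin (norm_topology F1) (\<lambda>t. d (Complex 1 t) *\<^sub>C f (Complex 1 t)) (d (Complex 1 t) *\<^sub>C f (Complex 1 t)) (at t)" for t
      by (intro N1.limitin_scale calderonD f line) auto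
    show "((\<lambda>t. nrm F0 (d (Complex 0 t) *\<^sub>C f (Complex 0 t))) \<longlongrightarrow> 0) at_infinity"
    proof (rule Lim_null_comparison)
      show "\<forall>\<^sub>F t in at_infinity. norm (nrm F0 (d (Complex 0 t) *\<^sub>C f (Complex 0 t))) \<le> Bd * nrm F0 (f (Complex 0 t))"
        using calderon_car(2)[OF f] Bd[OF on0] by (intro always_eventually) (simp add: N0.nrm_scale mult_right_mono)
      show "((\<lambda>t. Bd * nrm F0 (f (Complex 0 t))) \<longlongrightarrow> 0) at_infinity"
        by (intro tendsto_mult_right_zero calderonD f)
    qed
    show "((\<lambda>t. nrm F1 (d (Complex 1 t) *\<^sub>C f (Complex 1 t))) \<longlongrightarrow> 0) at_infinity"
    proof (rule Lim_null_comparison)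
      show "\<forall>\<^sub>F t in at_infinity. norm (nrm F1 (d (Complex 1 t) *\<^sub>C f (Complex 1 t))) \<le> Bd * nrm F1 (f (Complex 1 t))"
        using calderon_car(3)[OF f] Bd[OF on1] by (intro always_eventually) (simp add: N1.nrm_scale mult_right_mono)
      show "((\<lambda>t. Bd * nrm F1 (f (Complex 1 t))) \<longlongrightarrow> 0) at_infinity"
        by (intro tendsto_mult_right_zero calderonD f)
    qed
  qed
qed

lemma calderon_sum:
  assumes "\<And>i. i \<in> I \<Longrightarrow> multiplier (d i)" "\<And>i. i \<in> I \<Longrightarrow> f i \<in> calderon_functions F0 F1"
  shows "(\<lambda>z. \<Sum>i\<in>I. d i z *\<^sub>C f i z) \<in> calderon_functions F0 F1"
  using assms
proof (induction I rule: infinite_finite_induct)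
  case (insert i I)
  have "(\<lambda>z. d i z *\<^sub>C f i z + (\<Sum>i\<in>I. d i z *\<^sub>C f i z)) \<in> calderon_functions F0 F1"
    using insert by (intro calderon_add calderon_mult) auto
  then show ?case using insert.hyps by simp
qed (simp_all add: calderon_zero)

end

section \<open>Analytic majorants on the strip\<close>


text \<open>
  A Riemann sum of a Poisson kernel, bounded independently of the step width by comparison with a telescoping sum.
\<close>

lemma poisson_sum_le:
  fixes \<eta> a :: real
  assumes \<eta>: "0 < \<eta>" "\<eta> \<le> a"
  shows "(\<Sum>j\<in>{-int n..int n}. \<eta> * a / (a\<^sup>2 + (j * \<eta>)\<^sup>2)) \<le> 5"
proof -
  define P where "P j = \<eta> * a / (a\<^sup>2 + (real_of_int j * \<eta>)\<^sup>2)" for j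
  have a: "a > 0" using \<eta> by linarith
  have P0: "P 0 \<le> 1" using \<eta> a by (simp add: P_def power2_eq_square divide_simps)
  have step: "P (int (Suc n)) \<le> 2 * a * (1 / (a + n * \<eta>) - 1 / (a + Suc n * \<eta>))" for n
  proof -
    define b where "b = real (Suc n) * \<eta>"
    have b: "b > 0" "a + n * \<eta> = a + b - \<eta>"
      using \<eta> by (simp add: b_def) (simp add: b_def algebra_simps)
    have p: "a + b - \<eta> > 0" using \<eta> b(1) by linarith
    have "(a + b - \<eta>) * (a + b) \<le> 2 * (a\<^sup>2 + b\<^sup>2)"
    proof -
      have "(a + b - \<eta>) * (a + b) \<le> (a + b) * (a + b)" using \<eta> a b by (intro mult_right_mono) auto
      also have "\<dots> = 2 * (a\<^sup>2 + b\<^sup>2) - (a - b)\<^sup>2" by (simp add: power2_eq_square algebra_simps)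
      also have "\<dots> \<le> 2 * (a\<^sup>2 + b\<^sup>2)" by simp
      finally show ?thesis .
    qed
    then have "1 / (a\<^sup>2 + b\<^sup>2) \<le> 2 / ((a + b - \<eta>) * (a + b))"
      using a b p by (simp add: divide_simps add_pos_pos)
    then have "\<eta> * a * (1 / (a\<^sup>2 + b\<^sup>2)) \<le> \<eta> * a * (2 / ((a + b - \<eta>) * (a + b)))"
      using \<eta> a by (intro mult_left_mono) auto
    also have "\<dots> = 2 * a * (1 / (a + b - \<eta>) - 1 / (a + b))"
      using a b p by (simp add: divide_simps)
    finally show ?thesis unfolding b(2) by (simp add: P_def b_def)
  qed
  have sym: "P (- j) = P j" for j by (simp add: P_def)
  have "(\<Sum>j\<in>{-int n..int n}. P j) \<le> 1 + 4 * a * (1 / a - 1 / (a + n * \<eta>))"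
  proof (induction n)
    case 0 then show ?case using P0 by simp
  next
    case (Suc n)
    have "{-int (Suc n)..int (Suc n)} = insert (int (Suc n)) (insert (- int (Suc n)) {-int n..int n})"
      by auto
    then have "(\<Sum>j\<in>{-int (Suc n)..int (Suc n)}. P j) = 2 * P (int (Suc n)) + (\<Sum>j\<in>{-int n..int n}. P j)"
      by (simp add: sym[of "int (Suc n)", simplified])
    also have "\<dots> \<le> 2 * (2 * a * (1 / (a + n * \<eta>) - 1 / (a + Suc n * \<eta>))) + (1 + 4 * a * (1 / a - 1 / (a + n * \<eta>)))"
      by (intro add_mono mult_left_mono step Suc) auto
    also have "\<dots> = 1 + 4 * a * (1 / a - 1 / (a + Suc n * \<eta>))"
      by (simp only: right_diff_distrib)
    finally show ?case .
  qed
  also have "\<dots> \<le> 1 + 4 * a * (1 / a)"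
    using a \<eta> by (intro add_left_mono mult_left_mono) auto
  also have "\<dots> = 5" using a by simp
  finally show ?thesis by (simp add: P_def)
qed

text \<open>
  Let \<open>\<kappa>\<^sub>j(z) = \<eta> / (1 + \<eta> + i j \<eta> - z)\<close>, the kernel of the half plane \<open>Re z < 1 + \<eta>\<close> with its pole just
  to the right of the point \<open>1 + i j \<eta>\<close>.  Its real part is positive on the strip, and at least \<open>1/2\<close> at the points
  \<open>1 + i \<tau>\<close> with \<open>\<bar>\<tau> - j \<eta>\<bar> \<le> \<eta>\<close>.  Subtracting the imaginary constants \<open>i Im \<kappa>\<^sub>j(\<theta>)\<close> makes
  \<open>\<Psi> = A + \<Sum> h\<^sub>j (\<kappa>\<^sub>j - i Im \<kappa>\<^sub>j(\<theta>))\<close> real at \<open>\<theta>\<close>, and so \<open>\<bar>\<Psi>(\<theta>)\<bar>\<close> is linear in the numbers \<open>h\<^sub>j\<close>.  The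
  function \<open>d\<close> is \<open>1 / \<surd>\<Psi>\<close>.
\<close>

lemma outer_majorant:
  fixes h :: "int \<Rightarrow> real"
  assumes \<eta>: "0 < \<eta>" and \<theta>: "0 < \<theta>" "\<theta> < 1" and A: "A > 0" and J: "finite J" and h: "\<And>j. h j \<ge> 0"
  obtains d where "multiplier d" "\<And>z. z \<in> strip \<Longrightarrow> d z \<noteq> 0" "\<And>z. z \<in> strip \<Longrightarrow> A * (cmod (d z))\<^sup>2 \<le> 1"
    "\<And>j \<tau>. j \<in> J \<Longrightarrow> \<bar>\<tau> - j * \<eta>\<bar> \<le> \<eta> \<Longrightarrow> h j / 2 * (cmod (d (Complex 1 \<tau>)))\<^sup>2 \<le> 1"
    "inverse ((cmod (d (of_real \<theta>)))\<^sup>2) = A + (\<Sum>j\<in>J. h j * (\<eta> * (1 + \<eta> - \<theta>) / ((1 + \<eta> - \<theta>)\<^sup>2 + (j * \<eta>)\<^sup>2)))"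
proof -
  define \<kappa> where "\<kappa> j z = of_real \<eta> / (Complex (1 + \<eta>) (j * \<eta>) - z)" for j :: int and z
  define \<Psi> where "\<Psi> z = of_real A + (\<Sum>j\<in>J. of_real (h j) * (\<kappa> j z - \<i> * of_real (Im (\<kappa> j (of_real \<theta>)))))" for z
  define U where "U = {z::complex. Re z < 1 + \<eta>}"
  define d where "d z = inverse (csqrt (\<Psi> z))" for z
  have stripU: "strip \<subseteq> U" "open_strip \<subseteq> U" using \<eta> by (auto simp: strip_def open_strip_def U_def)
  have oU: "open U" unfolding U_def by (rule open_halfspace_Re_lt)
  have Re\<kappa>: "Re (\<kappa> j z) = \<eta> * (1 + \<eta> - Re z) / ((1 + \<eta> - Re z)\<^sup>2 + (j * \<eta> - Im z)\<^sup>2)" for j z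
    by (simp add: \<kappa>_def Re_divide power2_eq_square)
  have Re\<kappa>0: "Re (\<kappa> j z) \<ge> 0" if "z \<in> U" for j z
    using that \<eta> unfolding Re\<kappa> by (auto simp: U_def)
  have Re\<Psi>: "Re (\<Psi> z) = A + (\<Sum>j\<in>J. h j * Re (\<kappa> j z))" for z
    by (simp add: \<Psi>_def)
  have Re\<Psi>A: "A \<le> Re (\<Psi> z)" if "z \<in> U" for z
    unfolding Re\<Psi> using h Re\<kappa>0[OF that] by (simp add: sum_nonneg)
  have \<Psi>mod: "A \<le> cmod (\<Psi> z)" if "z \<in> U" for z
    using Re\<Psi>A[OF that] complex_Re_le_cmod[of "\<Psi> z"] by linarith
  have \<Psi>nz: "\<Psi> z \<noteq> 0" if "z \<in> U" for z using \<Psi>mod[OF that] A by auto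
  have dsq: "(cmod (d z))\<^sup>2 = inverse (cmod (\<Psi> z))" for z
    by (simp add: d_def norm_inverse power_inverse)
  have \<kappa>hol: "\<kappa> j holomorphic_on U" for j
    unfolding \<kappa>_def by (intro holomorphic_intros) (auto simp: U_def complex_eq_iff)
  have \<Psi>hol: "\<Psi> holomorphic_on U"
    unfolding \<Psi>_def by (intro holomorphic_intros \<kappa>hol)
  have img: "\<Psi> ` U \<subseteq> - \<real>\<^sub>\<le>\<^sub>0"
    using Re\<Psi>A A by (fastforce simp: complex_nonpos_Reals_iff)
  have "(csqrt \<circ> \<Psi>) holomorphic_on U"
    by (rule holomorphic_on_compose_gen[OF \<Psi>hol _ img]) (rule holomorphic_on_csqrt)
  then have dhol: "d holomorphic_on U"
    unfolding d_def o_def by (rule holomorphic_on_inverse) (auto simp: \<Psi>nz)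
  have bnd: "A * (cmod (d z))\<^sup>2 \<le> 1" if "z \<in> strip" for z
    using \<Psi>mod[of z] that stripU A unfolding dsq by (auto simp: divide_simps)
  show ?thesis
  proof (rule that)
    show "multiplier d"
      unfolding multiplier_def
    proof (intro conjI ballI)
      show "continuous_on strip d"
        using holomorphic_on_imp_continuous_on[OF dhol] stripU(1) by (rule continuous_on_subset)
      show "\<exists>B. \<forall>z\<in>strip. cmod (d z) \<le> B"
      proof (intro exI ballI)
        fix z assume "z \<in> strip"
        then have "(cmod (d z))\<^sup>2 \<le> 1 / A" using bnd[of z] A by (simp add: pos_le_divide_eq mult.commute)
        then show "cmod (d z) \<le> sqrt (1 / A)" by (rule real_le_rsqrt)
      qed
      show "d field_differentiable at z" if "z \<in> open_strip" for z
        using dhol oU that stripU(2) by (meson holomorphic_on_imp_differentiable_at subsetD)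
    qed
    show "d z \<noteq> 0" if "z \<in> strip" for z using \<Psi>nz[of z] that stripU(1) by (auto simp: d_def)
    show "A * (cmod (d z))\<^sup>2 \<le> 1" if "z \<in> strip" for z using that by (rule bnd)
    show "h j / 2 * (cmod (d (Complex 1 \<tau>)))\<^sup>2 \<le> 1" if j: "j \<in> J" and \<tau>: "\<bar>\<tau> - j * \<eta>\<bar> \<le> \<eta>" for j \<tau>
    proof -
      have U: "Complex 1 \<tau> \<in> U" using \<eta> by (simp add: U_def)
      have "(j * \<eta> - \<tau>)\<^sup>2 \<le> \<eta>\<^sup>2" using \<tau> by (intro abs_le_square_iff[THEN iffD1]) auto
      then have "\<eta> * \<eta> / (\<eta>\<^sup>2 + \<eta>\<^sup>2) \<le> \<eta> * \<eta> / (\<eta>\<^sup>2 + (j * \<eta> - \<tau>)\<^sup>2)"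
        using \<eta> by (intro divide_left_mono add_left_mono) (auto simp: add_pos_nonneg)
      then have "1 / 2 \<le> Re (\<kappa> j (Complex 1 \<tau>))"
        unfolding Re\<kappa> using \<eta> by (simp add: power2_eq_square)
      then have "h j * (1 / 2) \<le> h j * Re (\<kappa> j (Complex 1 \<tau>))" using h by (intro mult_left_mono) auto
      also have "\<dots> \<le> (\<Sum>j\<in>J. h j * Re (\<kappa> j (Complex 1 \<tau>)))"
        using J j h Re\<kappa>0[OF U] by (intro member_le_sum) auto
      also have "\<dots> \<le> Re (\<Psi> (Complex 1 \<tau>))" unfolding Re\<Psi> using A by simp
      also have "\<dots> \<le> cmod (\<Psi> (Complex 1 \<tau>))" by (rule complex_Re_le_cmod)
      finally show ?thesis
        using \<Psi>nz[OF U] unfolding dsq by (simp add: divide_simps)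
    qed
    have "\<kappa> j (of_real \<theta>) - \<i> * of_real (Im (\<kappa> j (of_real \<theta>))) = of_real (Re (\<kappa> j (of_real \<theta>)))" for j
      by (simp add: complex_eq_iff)
    then have "\<Psi> (of_real \<theta>) = of_real (A + (\<Sum>j\<in>J. h j * Re (\<kappa> j (of_real \<theta>))))"
      unfolding \<Psi>_def by simp
    moreover have "A + (\<Sum>j\<in>J. h j * Re (\<kappa> j (of_real \<theta>))) \<ge> 0"
    proof -
      have "complex_of_real \<theta> \<in> U" using \<theta> \<eta> by (simp add: U_def)
      then show ?thesis using Re\<Psi>A[of "of_real \<theta>"] A unfolding Re\<Psi> by linarith
    qed
    ultimately have "cmod (\<Psi> (of_real \<theta>)) = A + (\<Sum>j\<in>J. h j * Re (\<kappa> j (of_real \<theta>)))"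
      by (simp only: norm_of_real abs_of_nonneg)
    then show "inverse ((cmod (d (of_real \<theta>)))\<^sup>2) = A + (\<Sum>j\<in>J. h j * (\<eta> * (1 + \<eta> - \<theta>) / ((1 + \<eta> - \<theta>)\<^sup>2 + (j * \<eta>)\<^sup>2)))"
      unfolding dsq Re\<kappa> by simp
  qed
qed

section \<open>Interpolation of sign averages\<close>


lemma bdd_above_vanishing:
  fixes g :: "real \<Rightarrow> real"
  assumes "\<And>t. (g \<longlongrightarrow> g t) (at t)" "(g \<longlongrightarrow> 0) at_infinity"
  shows "bdd_above (range g)"
proof -
  have "\<forall>\<^sub>F t in at_infinity. g t < 1" using assms(2) by (rule order_tendstoD(2)) simp
  then obtain R where R: "\<And>t. R \<le> norm t \<Longrightarrow> g t < 1" by (auto simp: eventually_at_infinity)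
  have "continuous_on {-R..R} g" using assms(1) by (auto simp: continuous_on_def intro: tendsto_within_subset)
  then have "bounded (g ` {-R..R})" by (intro compact_imp_bounded compact_continuous_image) auto
  then obtain B where B: "\<forall>t\<in>{-R..R}. \<bar>g t\<bar> \<le> B" by (auto simp: bounded_iff)
  have "g t \<le> max B 1" for t
  proof (cases "R \<le> norm t")
    case True
    then show ?thesis using R[OF True] by simp
  next
    case False
    then have "t \<in> {-R..R}" by auto
    then have "\<bar>g t\<bar> \<le> B" using B by blast
    then show ?thesis by simp
  qed
  then show ?thesis by (intro bdd_aboveI) auto
qed

context couple
begin

lemma calderon_bdd:
  assumes f: "f \<in> calderon_functions F0 F1"
  shows "bdd_above (range (\<lambda>t. nrm F0 (f (Complex 0 t))))" "bdd_above (range (\<lambda>t. nrm F1 (f (Complex 1 t))))"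
  by (intro bdd_above_vanishing N0.limitin_nrm N1.limitin_nrm calderonD[OF f])+

lemma calderon_norm_ge:
  assumes f: "f \<in> calderon_functions F0 F1"
  shows "nrm F0 (f (Complex 0 t)) \<le> calderon_norm F0 F1 f" "nrm F1 (f (Complex 1 t)) \<le> calderon_norm F0 F1 f"
  unfolding calderon_norm_def
  by (intro max.coboundedI1 cSUP_upper calderon_bdd[OF f] UNIV_I)
     (intro max.coboundedI2 cSUP_upper calderon_bdd[OF f] UNIV_I)

lemma calderon_norm_le:
  assumes "\<And>t. nrm F0 (f (Complex 0 t)) \<le> B" "\<And>t. nrm F1 (f (Complex 1 t)) \<le> B"
  shows "calderon_norm F0 F1 f \<le> B"
  unfolding calderon_norm_def using assms by (intro max.boundedI cSUP_least) auto

lemma calderon_norm_ge_0: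
  assumes f: "f \<in> calderon_functions F0 F1"
  shows "0 \<le> calderon_norm F0 F1 f"
  using N0.nrm_ge_0[OF calderon_car(2)[OF f]] calderon_norm_ge(1)[OF f] by (rule order_trans)

lemma complex_interpolation_le:
  assumes f: "f \<in> calderon_functions F0 F1"
  shows "f (of_real \<theta>) \<in> car (complex_interpolation F0 F1 \<theta>)"
    and "nrm (complex_interpolation F0 F1 \<theta>) (f (of_real \<theta>)) \<le> calderon_norm F0 F1 f"
proof -
  show "f (of_real \<theta>) \<in> car (complex_interpolation F0 F1 \<theta>)"
    using f by (auto simp: complex_interpolation_def)
  have "Inf {calderon_norm F0 F1 g | g. g \<in> calderon_functions F0 F1 \<and> g (of_real \<theta>) = f (of_real \<theta>)} \<le> calderon_norm F0 F1 f"
    by (rule cInf_lower) (use f calderon_norm_ge_0 in \<open>auto intro!: bdd_belowI[of _ 0]\<close>)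
  then show "nrm (complex_interpolation F0 F1 \<theta>) (f (of_real \<theta>)) \<le> calderon_norm F0 F1 f"
    by (simp add: complex_interpolation_def)
qed

lemma complex_interpolation_approx:
  assumes x: "x \<in> car (complex_interpolation F0 F1 \<theta>)" and e: "nrm (complex_interpolation F0 F1 \<theta>) x < e"
  obtains f where "f \<in> calderon_functions F0 F1" "f (of_real \<theta>) = x" "calderon_norm F0 F1 f < e"
proof -
  let ?S = "{calderon_norm F0 F1 f | f. f \<in> calderon_functions F0 F1 \<and> f (of_real \<theta>) = x}"
  have "?S \<noteq> {}" using x by (auto simp: complex_interpolation_def)
  moreover have "Inf ?S < e" using e by (simp add: complex_interpolation_def)
  ultimately have "\<exists>y\<in>?S. y < e" by (rule cInf_lessD)
  then obtain f where "f \<in> calderon_functions F0 F1" "f (of_real \<theta>) = x" "calderon_norm F0 F1 f < e"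
    by auto
  then show ?thesis by (rule that)
qed

text \<open>
  Continuous functions on the line that vanish at infinity are uniformly continuous: outside a compact
  interval they are small, and inside it a Lebesgue number serves as step width.
\<close>

lemma calderon_boundary_net:
  assumes I: "finite I" and g: "\<And>i. i \<in> I \<Longrightarrow> g i \<in> calderon_functions F0 F1"
  obtains \<eta> N where "\<eta> > 0"
    "\<And>\<tau>. (\<exists>j\<in>{-int N..int N}. \<bar>\<tau> - j * \<eta>\<bar> \<le> \<eta> \<and>
        (\<Sum>i\<in>I. nrm F1 (g i (Complex 1 \<tau>) - g i (Complex 1 (j * \<eta>)))) \<le> 1) \<or>
      (\<Sum>i\<in>I. nrm F1 (g i (Complex 1 \<tau>))) \<le> 1"
proof -
  have gc: "g i (Complex 1 t) \<in> car F1" if "i \<in> I" for i t by (rule calderon_car(3)[OF g[OF that]])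
  have "((\<lambda>t. \<Sum>i\<in>I. nrm F1 (g i (Complex 1 t))) \<longlongrightarrow> (\<Sum>i\<in>I. 0)) at_infinity"
    by (intro tendsto_sum calderonD(7) g)
  then have "\<forall>\<^sub>F t in at_infinity. (\<Sum>i\<in>I. nrm F1 (g i (Complex 1 t))) < 1"
    by (rule order_tendstoD(2)) simp
  then obtain R where R: "\<And>t. R \<le> norm t \<Longrightarrow> (\<Sum>i\<in>I. nrm F1 (g i (Complex 1 t))) < 1"
    by (auto simp: eventually_at_infinity)
  have "\<exists>r>0. \<forall>t. \<bar>t - s\<bar> < r \<longrightarrow> (\<Sum>i\<in>I. nrm F1 (g i (Complex 1 t) - g i (Complex 1 s))) < 1 / 2" for s
  proof -
    have "((\<lambda>t. \<Sum>i\<in>I. nrm F1 (g i (Complex 1 t) - g i (Complex 1 s))) \<longlongrightarrow> (\<Sum>i\<in>I. 0)) (at s)"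
      using calderonD(6)[OF g, of _ s] by (intro tendsto_sum) (auto simp: N1.limitin_norm_iff)
    then have "\<forall>\<^sub>F t in at s. (\<Sum>i\<in>I. nrm F1 (g i (Complex 1 t) - g i (Complex 1 s))) < 1 / 2"
      by (rule order_tendstoD(2)) simp
    then obtain r where r: "r > 0" "\<And>t. t \<noteq> s \<Longrightarrow> dist t s < r \<Longrightarrow> (\<Sum>i\<in>I. nrm F1 (g i (Complex 1 t) - g i (Complex 1 s))) < 1 / 2"
      by (auto simp: eventually_at)
    show ?thesis
    proof (intro exI conjI allI impI)
      fix t assume "\<bar>t - s\<bar> < r"
      then show "(\<Sum>i\<in>I. nrm F1 (g i (Complex 1 t) - g i (Complex 1 s))) < 1 / 2"
        using r(2)[of t] by (cases "t = s") (auto simp: dist_real_def)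
    qed (rule r)
  qed
  then obtain r where r: "\<And>s. r s > 0"
    "\<And>s t. \<bar>t - s\<bar> < r s \<Longrightarrow> (\<Sum>i\<in>I. nrm F1 (g i (Complex 1 t) - g i (Complex 1 s))) < 1 / 2"
    by metis
  have cover: "{-\<bar>R\<bar>..\<bar>R\<bar>} \<subseteq> \<Union> (range (\<lambda>s. ball s (r s)))" using r(1) by (auto intro: centre_in_ball[THEN iffD2])
  have opn: "open G" if "G \<in> range (\<lambda>s. ball s (r s))" for G using that by auto
  obtain \<epsilon> where \<epsilon>: "\<epsilon> > 0" "\<And>s. s \<in> {-\<bar>R\<bar>..\<bar>R\<bar>} \<Longrightarrow> \<exists>G\<in>range (\<lambda>s. ball s (r s)). ball s \<epsilon> \<subseteq> G"
    by (rule Heine_Borel_lemma[OF compact_Icc cover opn]) (assumption, rule that)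
  have unif: "(\<Sum>i\<in>I. nrm F1 (g i (Complex 1 t) - g i (Complex 1 u))) \<le> 1"
    if t: "t \<in> {-\<bar>R\<bar>..\<bar>R\<bar>}" and u: "\<bar>t - u\<bar> < \<epsilon>" for t u
  proof -
    obtain s where s: "ball t \<epsilon> \<subseteq> ball s (r s)" using \<epsilon>(2)[OF t] by auto
    have "t \<in> ball s (r s)" "u \<in> ball s (r s)"
      using s u \<epsilon>(1) by (auto simp: subset_iff dist_real_def)
    then have st: "\<bar>t - s\<bar> < r s" "\<bar>u - s\<bar> < r s" by (auto simp: dist_real_def)
    have "(\<Sum>i\<in>I. nrm F1 (g i (Complex 1 t) - g i (Complex 1 u)))
        \<le> (\<Sum>i\<in>I. nrm F1 (g i (Complex 1 t) - g i (Complex 1 s)) + nrm F1 (g i (Complex 1 u) - g i (Complex 1 s)))"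
    proof (rule sum_mono)
      fix i assume i: "i \<in> I"
      show "nrm F1 (g i (Complex 1 t) - g i (Complex 1 u))
          \<le> nrm F1 (g i (Complex 1 t) - g i (Complex 1 s)) + nrm F1 (g i (Complex 1 u) - g i (Complex 1 s))"
        using N1.nrm_triangle3[OF gc[OF i, of t] gc[OF i, of s] gc[OF i, of u]]
          N1.nrm_diff_commute[OF gc[OF i, of s] gc[OF i, of u]] by simp
    qed
    also have "\<dots> \<le> 1" using r(2)[OF st(1)] r(2)[OF st(2)] by (simp add: sum.distrib)
    finally show ?thesis .
  qed
  define \<eta> where "\<eta> = \<epsilon> / 2"
  have \<eta>: "\<eta> > 0" "\<eta> < \<epsilon>" using \<epsilon>(1) by (simp_all add: \<eta>_def)
  obtain N :: nat where N: "\<bar>R\<bar> / \<eta> + 1 \<le> real N" using real_arch_simple by blast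
  show ?thesis
  proof (rule that[OF \<eta>(1), of N])
    fix \<tau> :: real
    show "(\<exists>j\<in>{-int N..int N}. \<bar>\<tau> - j * \<eta>\<bar> \<le> \<eta> \<and>
        (\<Sum>i\<in>I. nrm F1 (g i (Complex 1 \<tau>) - g i (Complex 1 (j * \<eta>)))) \<le> 1) \<or>
      (\<Sum>i\<in>I. nrm F1 (g i (Complex 1 \<tau>))) \<le> 1"
    proof (cases "\<bar>\<tau>\<bar> \<le> \<bar>R\<bar>")
      case True
      define j where "j = \<lfloor>\<tau> / \<eta>\<rfloor>"
      have fl: "of_int j \<le> \<tau> / \<eta>" "\<tau> / \<eta> < of_int j + 1" by (simp_all add: j_def)
      have jd: "j * \<eta> \<le> \<tau>" "\<tau> < j * \<eta> + \<eta>"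
        using fl \<eta>(1) by (simp_all add: field_simps)
      have q: "\<bar>\<tau> / \<eta>\<bar> \<le> \<bar>R\<bar> / \<eta>" using True \<eta>(1) by (simp add: divide_right_mono)
      have "real_of_int j \<le> real N" "- real N \<le> real_of_int j" using q N fl by linarith+
      then have "j \<in> {-int N..int N}" by simp
      moreover have "(\<Sum>i\<in>I. nrm F1 (g i (Complex 1 \<tau>) - g i (Complex 1 (j * \<eta>)))) \<le> 1"
        using True jd \<eta> by (intro unif) auto
      ultimately show ?thesis using jd by (intro disjI1 bexI[of _ j]) auto
    next
      case False
      then have "R \<le> norm \<tau>" by simp
      then show ?thesis using R[of \<tau>] by simp
    qed
  qed
qed

text \<open>
  For fixed \<open>e\<close> let \<open>G = \<Sum> e\<^sub>i g\<^sub>i\<close>.  The majorant is taken with \<open>A = K\<^sup>2 + 1\<close> and with heights \<open>h\<^sub>j\<close> such that \<open>h\<^sub>j / 2\<close>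
  dominates \<open>\<parallel>G\<parallel>\<^sup>2\<close> near the grid points \<open>1 + i j \<eta>\<close>; the resulting quotient \<open>d G\<close> has Calderon norm at most one, so
  \<open>\<parallel>G(\<theta>)\<parallel>\<^sup>2 \<le> 1 / \<bar>d(\<theta>)\<bar>\<^sup>2\<close>.  Grid and weights depend only on the \<open>g\<^sub>i\<close>.  The inequality therefore
  can be averaged over random \<open>e\<close>, and on the line \<open>Re z = 1\<close> only bounds for averages at single points are used.
\<close>

theorem interpolation_average_bound:
  fixes I :: "'i set"
  assumes \<theta>: "0 < \<theta>" "\<theta> < 1"
    and F: "normed_space F" "car F = car (complex_interpolation F0 F1 \<theta>)"
      "\<forall>x\<in>car F. nrm F x = nrm (complex_interpolation F0 F1 \<theta>) x"
    and I: "finite I" and g: "\<And>i. i \<in> I \<Longrightarrow> g i \<in> calderon_functions F0 F1"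
    and K: "\<forall>e t. (\<forall>i\<in>I. \<bar>e i\<bar> \<le> 1) \<longrightarrow> nrm F0 (\<Sum>i\<in>I. complex_of_real (e i) *\<^sub>C g i (Complex 0 t)) \<le> K"
  shows "\<exists>(J :: int set) c s. finite J \<and> (\<forall>j. 0 \<le> c j) \<and> (\<Sum>j\<in>J. c j) \<le> 20 \<and>
    (\<forall>e. (\<forall>i\<in>I. \<bar>e i\<bar> \<le> 1) \<longrightarrow> (nrm F (\<Sum>i\<in>I. complex_of_real (e i) *\<^sub>C g i (of_real \<theta>)))\<^sup>2
      \<le> K\<^sup>2 + 21 + (\<Sum>j\<in>J. c j * (nrm F1 (\<Sum>i\<in>I. complex_of_real (e i) *\<^sub>C g i (Complex 1 (s j))))\<^sup>2))"
proof -
  interpret NF: normed_carrier F by unfold_locales (rule F(1))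
  obtain \<eta> N where \<eta>: "\<eta> > 0" and net:
    "\<And>\<tau>. (\<exists>j\<in>{-int N..int N}. \<bar>\<tau> - j * \<eta>\<bar> \<le> \<eta> \<and>
        (\<Sum>i\<in>I. nrm F1 (g i (Complex 1 \<tau>) - g i (Complex 1 (j * \<eta>)))) \<le> 1) \<or>
      (\<Sum>i\<in>I. nrm F1 (g i (Complex 1 \<tau>))) \<le> 1"
    using calderon_boundary_net[where g = g, OF I g] by blast
  define a where "a = 1 + \<eta> - \<theta>"
  define c where "c j = \<eta> * a / (a\<^sup>2 + (real_of_int j * \<eta>)\<^sup>2)" for j
  have a: "\<eta> \<le> a" using \<theta> by (simp add: a_def)
  have sum_c: "(\<Sum>j\<in>{-int N..int N}. c j) \<le> 5" unfolding c_def by (rule poisson_sum_le[OF \<eta> a])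
  show ?thesis
  proof (rule exI[of _ "{-int N..int N}"], rule exI[of _ "\<lambda>j. 4 * c j"], rule exI[of _ "\<lambda>j. real_of_int j * \<eta>"],
      intro conjI allI impI)
    show "0 \<le> 4 * c j" for j using \<eta> a by (simp add: c_def)
    show "(\<Sum>j\<in>{-int N..int N}. 4 * c j) \<le> 20"
      unfolding sum_distrib_left[symmetric] using sum_c by simp
  next
    fix e :: "'i \<Rightarrow> real"
    assume e': "\<forall>i\<in>I. \<bar>e i\<bar> \<le> 1"
    then have e: "\<And>i. i \<in> I \<Longrightarrow> \<bar>e i\<bar> \<le> 1" by blast
    define G where "G z = (\<Sum>i\<in>I. complex_of_real (e i) *\<^sub>C g i z)" for z
    have GC: "G \<in> calderon_functions F0 F1"
      unfolding G_def[abs_def] by (intro calderon_sum multiplier_const g)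
    \<comment> \<open>Twice \<open>2 \<parallel>G\<parallel>\<^sup>2 + 2\<close>, which is at least \<open>(\<parallel>G\<parallel> + 1)\<^sup>2\<close>; near a grid point \<open>G\<close> varies by at most 1.\<close>
    define h where "h j = 4 * (nrm F1 (G (Complex 1 (real_of_int j * \<eta>))))\<^sup>2 + 4" for j
    define A where "A = K\<^sup>2 + 1"
    have A: "A \<ge> 1" by (simp add: A_def)
    have h0: "h j \<ge> 0" for j by (simp add: h_def)
    have Apos: "A > 0" using A by simp
    obtain d where d: "multiplier d" "\<And>z. z \<in> strip \<Longrightarrow> d z \<noteq> 0" "\<And>z. z \<in> strip \<Longrightarrow> A * (cmod (d z))\<^sup>2 \<le> 1"
      "\<And>j \<tau>. j \<in> {-int N..int N} \<Longrightarrow> \<bar>\<tau> - j * \<eta>\<bar> \<le> \<eta> \<Longrightarrow> h j / 2 * (cmod (d (Complex 1 \<tau>)))\<^sup>2 \<le> 1"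
      "inverse ((cmod (d (of_real \<theta>)))\<^sup>2) = A + (\<Sum>j\<in>{-int N..int N}. h j * c j)"
      by (rule outer_majorant[OF \<eta> \<theta> Apos finite_atLeastAtMost_int[of "- int N" "int N"] h0, folded a_def, folded c_def])
        (rule that)
    define H where "H z = d z *\<^sub>C G z" for z
    have HC: "H \<in> calderon_functions F0 F1"
      unfolding H_def[abs_def] by (rule calderon_mult[OF d(1) GC])
    have prod_le: "\<delta> * m \<le> 1" if "B * \<delta>\<^sup>2 \<le> 1" "m\<^sup>2 \<le> B" for B \<delta> m :: real
    proof -
      have "(\<delta> * m)\<^sup>2 = \<delta>\<^sup>2 * m\<^sup>2" by (rule power_mult_distrib)
      also have "\<dots> \<le> \<delta>\<^sup>2 * B" using that(2) by (rule mult_left_mono) simp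
      also have "\<dots> \<le> 1" using that(1) by (simp add: mult.commute)
      finally show ?thesis by (simp add: abs_square_le_1)
    qed
    have "calderon_norm F0 F1 H \<le> 1"
    proof (rule calderon_norm_le)
      fix t
      have "nrm F0 (G (Complex 0 t)) \<le> K" unfolding G_def using K e' by blast
      then have "(nrm F0 (G (Complex 0 t)))\<^sup>2 \<le> K\<^sup>2"
        using N0.nrm_ge_0[OF calderon_car(2)[OF GC]] by (intro power_mono) auto
      then have le: "(nrm F0 (G (Complex 0 t)))\<^sup>2 \<le> A" by (simp add: A_def)
      have "A * (cmod (d (Complex 0 t)))\<^sup>2 \<le> 1" by (rule d(3)) (simp add: strip_def)
      from prod_le[OF this le] have "cmod (d (Complex 0 t)) * nrm F0 (G (Complex 0 t)) \<le> 1"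
        .
      then show "nrm F0 (H (Complex 0 t)) \<le> 1"
        unfolding H_def by (simp add: N0.nrm_scale calderon_car(2)[OF GC])
    next
      fix t
      have Gt: "G (Complex 1 u) \<in> car F1" for u by (rule calderon_car(3)[OF GC])
      have gc: "g i (Complex 1 u) \<in> car F1" if "i \<in> I" for i u by (rule calderon_car(3)[OF g[OF that]])
      have "cmod (d (Complex 1 t)) * nrm F1 (G (Complex 1 t)) \<le> 1"
        using net[of t]
      proof
        assume "\<exists>j\<in>{-int N..int N}. \<bar>t - j * \<eta>\<bar> \<le> \<eta> \<and>
          (\<Sum>i\<in>I. nrm F1 (g i (Complex 1 t) - g i (Complex 1 (j * \<eta>)))) \<le> 1"
        then obtain j where j: "j \<in> {-int N..int N}" "\<bar>t - j * \<eta>\<bar> \<le> \<eta>"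
          "(\<Sum>i\<in>I. nrm F1 (g i (Complex 1 t) - g i (Complex 1 (j * \<eta>)))) \<le> 1" by blast
        define m where "m = nrm F1 (G (Complex 1 (real_of_int j * \<eta>)))"
        have "G (Complex 1 t) - G (Complex 1 (j * \<eta>))
            = (\<Sum>i\<in>I. complex_of_real (e i) *\<^sub>C (g i (Complex 1 t) - g i (Complex 1 (j * \<eta>))))"
          by (simp add: G_def complex_vector.scale_right_diff_distrib sum_subtractf)
        then have "nrm F1 (G (Complex 1 t) - G (Complex 1 (j * \<eta>)))
            \<le> (\<Sum>i\<in>I. nrm F1 (g i (Complex 1 t) - g i (Complex 1 (j * \<eta>))))"
          by (simp only:) (intro N1.nrm_sum_signs N1.diff_car gc e)
        then have "nrm F1 (G (Complex 1 t) - G (Complex 1 (j * \<eta>))) \<le> 1" using j(3) by linarith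
        then have "nrm F1 (G (Complex 1 t)) \<le> m + 1"
          using N1.nrm_le_add_diff[OF Gt Gt, of t "j * \<eta>"] by (simp add: m_def)
        then have "(nrm F1 (G (Complex 1 t)))\<^sup>2 \<le> (m + 1)\<^sup>2"
          using N1.nrm_ge_0[OF Gt] by (intro power_mono) auto
        also have "\<dots> \<le> h j / 2"
        proof -
          have "(m + 1)\<^sup>2 + (m - 1)\<^sup>2 = 2 * m\<^sup>2 + 2" by (simp add: power2_eq_square algebra_simps)
          moreover have "(m - 1)\<^sup>2 \<ge> 0" by simp
          ultimately have "(m + 1)\<^sup>2 \<le> 2 * m\<^sup>2 + 2" by linarith
          then show ?thesis by (simp add: h_def m_def)
        qed
        finally show ?thesis by (rule prod_le[OF d(4)[OF j(1,2)]])
      next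
        assume small: "(\<Sum>i\<in>I. nrm F1 (g i (Complex 1 t))) \<le> 1"
        have "nrm F1 (G (Complex 1 t)) \<le> (\<Sum>i\<in>I. nrm F1 (g i (Complex 1 t)))"
          unfolding G_def by (intro N1.nrm_sum_signs gc e)
        then have "nrm F1 (G (Complex 1 t)) \<le> 1" using small by linarith
        then have "(nrm F1 (G (Complex 1 t)))\<^sup>2 \<le> 1\<^sup>2"
          using N1.nrm_ge_0[OF Gt] by (intro power_mono) auto
        then have le: "(nrm F1 (G (Complex 1 t)))\<^sup>2 \<le> A" using A by simp
        have "A * (cmod (d (Complex 1 t)))\<^sup>2 \<le> 1" by (rule d(3)) (simp add: strip_def)
        then show ?thesis using le by (rule prod_le)
      qed
      then show "nrm F1 (H (Complex 1 t)) \<le> 1"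
        unfolding H_def by (simp add: N1.nrm_scale Gt)
    qed
    then have H1: "nrm F (H (of_real \<theta>)) \<le> 1"
      using complex_interpolation_le[OF HC, of \<theta>] F(2) F(3)[THEN bspec, of "H (of_real \<theta>)"] by simp
    have Gcar: "G (of_real \<theta>) \<in> car F" using complex_interpolation_le(1)[OF GC] F(2) by simp
    have "d (of_real \<theta>) \<noteq> 0" using \<theta> by (intro d(2)) (simp add: strip_def)
    then have dp: "cmod (d (of_real \<theta>)) > 0" by simp
    have "cmod (d (of_real \<theta>)) * nrm F (G (of_real \<theta>)) \<le> 1"
      using H1 Gcar unfolding H_def by (simp add: NF.nrm_scale)
    then have "nrm F (G (of_real \<theta>)) \<le> inverse (cmod (d (of_real \<theta>)))"
      using dp by (simp add: field_simps)
    then have "(nrm F (G (of_real \<theta>)))\<^sup>2 \<le> (inverse (cmod (d (of_real \<theta>))))\<^sup>2"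
      using NF.nrm_ge_0[OF Gcar] by (intro power_mono) auto
    also have "\<dots> = A + (\<Sum>j\<in>{-int N..int N}. c j * h j)"
      using d(5) by (simp add: power_inverse mult.commute)
    also have "\<dots> = K\<^sup>2 + 1 + 4 * (\<Sum>j\<in>{-int N..int N}. c j)
        + (\<Sum>j\<in>{-int N..int N}. 4 * c j * (nrm F1 (G (Complex 1 (real_of_int j * \<eta>))))\<^sup>2)"
      by (simp add: A_def h_def sum.distrib sum_distrib_left algebra_simps)
    also have "\<dots> \<le> K\<^sup>2 + 21 + (\<Sum>j\<in>{-int N..int N}. 4 * c j * (nrm F1 (G (Complex 1 (real_of_int j * \<eta>))))\<^sup>2)"
      using sum_c by simp
    finally show "(nrm F (\<Sum>i\<in>I. complex_of_real (e i) *\<^sub>C g i (of_real \<theta>)))\<^sup>2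
      \<le> K\<^sup>2 + 21 + (\<Sum>j\<in>{-int N..int N}. 4 * c j * (nrm F1 (\<Sum>i\<in>I. complex_of_real (e i) *\<^sub>C g i (Complex 1 (real_of_int j * \<eta>))))\<^sup>2)"
      unfolding G_def .
  qed simp
qed

end

section \<open>Finitely supported families\<close>


lemma multiplier_exp:
  fixes a :: real
  shows "multiplier (\<lambda>z. c * exp (of_real a * ((1 - z) / 2)))"
  unfolding multiplier_def
proof (intro conjI ballI)
  show "continuous_on strip (\<lambda>z. c * exp (of_real a * ((1 - z) / 2)))"
    by (intro continuous_intros) auto
  show "\<exists>B. \<forall>z\<in>strip. cmod (c * exp (of_real a * ((1 - z) / 2))) \<le> B"
  proof (intro exI ballI)
    fix z assume z: "z \<in> strip"
    have "\<bar>1 - Re z\<bar> \<le> 1" using z by (auto simp: strip_def)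
    then have "\<bar>a\<bar> * \<bar>1 - Re z\<bar> \<le> \<bar>a\<bar> * 1" by (rule mult_left_mono) simp
    then have "a * (1 - Re z) \<le> \<bar>a\<bar>" by (simp add: abs_mult[symmetric])
    then have "cmod (exp (of_real a * ((1 - z) / 2))) \<le> exp (\<bar>a\<bar> / 2)"
      by (simp add: norm_exp_eq_Re)
    then show "cmod (c * exp (of_real a * ((1 - z) / 2))) \<le> cmod c * exp (\<bar>a\<bar> / 2)"
      by (simp add: norm_mult mult_left_mono)
  qed
  show "(\<lambda>z. c * exp (of_real a * ((1 - z) / 2))) field_differentiable at z" for z
    by (rule holomorphic_on_imp_differentiable_at[of _ UNIV]) (auto intro!: holomorphic_intros)
qed

lemma sum_mult_le_sqrt:
  fixes a b :: "'k \<Rightarrow> real"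
  assumes "(\<Sum>k\<in>K. (a k)\<^sup>2) \<le> P" "(\<Sum>k\<in>K. (b k)\<^sup>2) \<le> Q"
  shows "(\<Sum>k\<in>K. a k * b k) \<le> sqrt P * sqrt Q"
proof -
  have "(\<Sum>k\<in>K. a k * b k) \<le> (\<Sum>k\<in>K. \<bar>a k\<bar> * \<bar>b k\<bar>)"
    by (intro sum_mono) (metis abs_ge_self abs_mult)
  also have "\<dots> \<le> L2_set a K * L2_set b K" by (rule L2_set_mult_ineq)
  also have "\<dots> \<le> sqrt P * sqrt Q"
  proof (rule mult_mono)
    show "L2_set a K \<le> sqrt P" "L2_set b K \<le> sqrt Q"
      using assms by (simp_all add: L2_set_def)
    then show "0 \<le> sqrt P" using L2_set_nonneg[of a K] by linarith
  qed simp
  finally show ?thesis .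
qed

lemma abs_rademacher_le_1: "\<bar>rademacher i t\<bar> \<le> 1"
  by (simp add: rademacher_def sgn_if)

context couple
begin

text \<open>
  The functions \<open>g\<^sub>i(z) = \<Sum>\<^sub>k w\<^sub>k\<^sub>i \<surd>u\<^sub>k E\<^sub>i(z) f\<^sub>k(z)\<close>, where \<open>E\<^sub>i(z)\<close> is \<open>t\<^sub>i\<close> to the power \<open>(1 - z) / 2\<close>, take the
  values \<open>\<Sum>\<^sub>k x\<^sub>k\<^sub>i y\<^sub>k\<close> at \<open>\<theta>\<close>.  Since \<open>\<bar>E\<^sub>i\<bar>\<^sup>2 = t\<^sub>i\<close> for \<open>Re z = 0\<close>, the Cauchy-Schwarz inequality bounds all sign sums in
  \<open>F\<^sub>0\<close>; since \<open>\<bar>E\<^sub>i\<bar> = 1\<close> for \<open>Re z = 1\<close>, the type 2 estimate for matrices bounded on Hilbert space applies in \<open>F\<^sub>1\<close>.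
\<close>

theorem finitely_supported_bound:
  assumes \<theta>: "0 < \<theta>" "\<theta> < 1"
    and F: "normed_space F" "car F = car (complex_interpolation F0 F1 \<theta>)"
      "\<forall>x\<in>car F. nrm F x = nrm (complex_interpolation F0 F1 \<theta>) x"
    and type: "type_2 F1" and B: "B > 0"
  shows "\<exists>C>0. \<forall>(m::nat) n x y. m > 0 \<longrightarrow> (\<forall>k<m. y k \<in> car F \<and> nrm F (y k) < B) \<longrightarrow> scalar_bound {..<m} {1..n} (2 / \<theta>) x \<longrightarrow>
      (rademacher_average F n (\<lambda>i. \<Sum>k<m. x k i *\<^sub>C y k))\<^sup>2 \<le> C"
proof -
  interpret NF: normed_carrier F by unfold_locales (rule F(1))
  obtain C1 where C1: "C1 > 0" and C1_bound: "\<forall>(m::nat) n w y M. m > 0 \<longrightarrow> M > 0 \<longrightarrow> (\<forall>k<m. y k \<in> car F1) \<longrightarrow>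
      l2_bounded {..<m} {1..n} M w \<longrightarrow>
      (rademacher_average F1 n (\<lambda>i. \<Sum>k<m. w k i *\<^sub>C y k))\<^sup>2 \<le> C1 * M\<^sup>2 * (\<Sum>k<m. (nrm F1 (y k))\<^sup>2)"
    using N1.type_2_contraction[OF type] by (elim exE conjE) (rule that)
  \<comment> \<open>The bound \<open>96 \<surd>2 \<surd>2 B\<close> in \<open>F\<^sub>0\<close>: both weights have sum at most 2.\<close>
  define K where "K = 192 * B"
  define Q where "Q = C1 * 96\<^sup>2 * (2 * B\<^sup>2)"
  have Q: "Q \<ge> 0" using C1 by (simp add: Q_def)
  define C where "C = K\<^sup>2 + 21 + 20 * Q"
  have C: "C > 0" unfolding C_def using Q by (intro add_pos_nonneg add_nonneg_pos) auto
  show ?thesis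
  proof (rule exI[of _ C], intro conjI allI impI)
    show "C > 0" by (rule C)
  next
    fix m n :: nat and x :: "nat \<Rightarrow> nat \<Rightarrow> complex" and y :: "nat \<Rightarrow> 'v"
    assume m: "m > 0" and y': "\<forall>k<m. y k \<in> car F \<and> nrm F (y k) < B"
      and x: "scalar_bound {..<m} {1..n} (2 / \<theta>) x"
    have y: "\<And>k. k < m \<Longrightarrow> y k \<in> car F" "\<And>k. k < m \<Longrightarrow> nrm F (y k) < B" using y' by blast+
    show "(rademacher_average F n (\<lambda>i. \<Sum>k<m. x k i *\<^sub>C y k))\<^sup>2 \<le> C"
    proof (cases "n = 0")
      case True
      then show ?thesis using C by (simp add: rademacher_average_sq(2))
    next
      case False
      have ne: "{..<m} \<noteq> {}" "{1..n} \<noteq> {}" using m False by auto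
      have "\<exists>u t w. (\<forall>k\<in>{..<m}. 0 < u k) \<and> (\<forall>i\<in>{1..n}. 0 < t i) \<and> (\<Sum>k<m. u k) \<le> 2 \<and> (\<Sum>i=1..n. t i) \<le> 2 \<and>
          (\<forall>k\<in>{..<m}. \<forall>i\<in>{1..n}. x k i = w k i * of_real (sqrt (u k) * t i powr ((1 - \<theta>) / 2))) \<and>
          l2_bounded {..<m} {1..n} 96 w"
        by (rule maurey_factorization[OF finite_lessThan finite_atLeastAtMost ne \<theta> x])
      then obtain u t w where u': "\<forall>k\<in>{..<m}. 0 < u k" and t': "\<forall>i\<in>{1..n}. 0 < t i"
        and su: "(\<Sum>k<m. u k) \<le> 2" and st: "(\<Sum>i=1..n. t i) \<le> 2"
        and xw': "\<forall>k\<in>{..<m}. \<forall>i\<in>{1..n}. x k i = w k i * of_real (sqrt (u k) * t i powr ((1 - \<theta>) / 2))"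
        and w': "l2_bounded {..<m} {1..n} 96 w"
        by (elim exE conjE) (rule that)
      note u = u'[rule_format, unfolded lessThan_iff] and t = t'[rule_format] and w = w'[unfolded l2_bounded_def, rule_format]
        and xw = xw'[rule_format, unfolded lessThan_iff]
      have "\<exists>f. f \<in> calderon_functions F0 F1 \<and> f (of_real \<theta>) = y k \<and> calderon_norm F0 F1 f < B" if "k < m" for k
        using complex_interpolation_approx[of "y k" \<theta> B] y[OF that] F(2) F(3)[THEN bspec, OF y(1)[OF that]] by metis
      then obtain f where f: "\<And>k. k < m \<Longrightarrow> f k \<in> calderon_functions F0 F1" "\<And>k. k < m \<Longrightarrow> f k (of_real \<theta>) = y k"
        "\<And>k. k < m \<Longrightarrow> calderon_norm F0 F1 (f k) < B" by metis
      have f0: "f k (Complex 0 s) \<in> car F0" "nrm F0 (f k (Complex 0 s)) \<le> B" if "k < m" for k s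
        using calderon_car(2)[OF f(1)[OF that]] calderon_norm_ge(1)[OF f(1)[OF that], of s] f(3)[OF that] by auto
      have f1: "f k (Complex 1 s) \<in> car F1" "nrm F1 (f k (Complex 1 s)) \<le> B" if "k < m" for k s
        using calderon_car(3)[OF f(1)[OF that]] calderon_norm_ge(2)[OF f(1)[OF that], of s] f(3)[OF that] by auto
      define E where "E i z = exp (of_real (ln (t i)) * ((1 - z) / 2))" for i and z :: complex
      define g where "g i z = (\<Sum>k<m. (w k i * of_real (sqrt (u k)) * E i z) *\<^sub>C f k z)" for i z
      have gC: "g i \<in> calderon_functions F0 F1" for i
        unfolding g_def[abs_def] E_def by (intro calderon_sum multiplier_exp f(1)) simp
      have E\<theta>: "E i (of_real \<theta>) = of_real (t i powr ((1 - \<theta>) / 2))" if "i \<in> {1..n}" for i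
      proof -
        have "t i powr ((1 - \<theta>) / 2) = exp (ln (t i) * ((1 - \<theta>) / 2))"
          using t[OF that] by (simp add: powr_def mult.commute)
        then show ?thesis by (simp add: E_def flip: exp_of_real)
      qed
      have E0: "(cmod (E i (Complex 0 s)))\<^sup>2 = t i" if "i \<in> {1..n}" for i s
      proof -
        have "(cmod (E i (Complex 0 s)))\<^sup>2 = exp (ln (t i) / 2 + ln (t i) / 2)"
          by (simp add: E_def norm_exp_eq_Re power2_eq_square flip: exp_add)
        then show ?thesis using t[OF that] by simp
      qed
      have E1: "cmod (E i (Complex 1 s)) = 1" for i s
        by (simp add: E_def norm_exp_eq_Re)
      have g\<theta>: "g i (of_real \<theta>) = (\<Sum>k<m. x k i *\<^sub>C y k)" if "i \<in> {1..n}" for i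
        unfolding g_def using f(2) xw[OF _ that] E\<theta>[OF that] by (intro sum.cong refl) (simp add: mult.assoc)
      have K: "nrm F0 (\<Sum>i=1..n. complex_of_real (e i) *\<^sub>C g i (Complex 0 s)) \<le> K"
        if e: "\<And>i. i \<in> {1..n} \<Longrightarrow> \<bar>e i\<bar> \<le> 1" for e s
      proof -
        define b where "b i = of_real (e i) * E i (Complex 0 s)" for i
        have bb: "(\<Sum>i=1..n. (cmod (b i))\<^sup>2) \<le> 2"
        proof -
          have "(\<Sum>i=1..n. (cmod (b i))\<^sup>2) \<le> (\<Sum>i=1..n. t i)"
          proof (rule sum_mono)
            fix i assume i: "i \<in> {1..n}"
            have "(e i)\<^sup>2 \<le> 1" using e[OF i] by (simp add: abs_square_le_1)
            then show "(cmod (b i))\<^sup>2 \<le> t i"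
              using t[OF i] by (simp add: b_def norm_mult power_mult_distrib E0[OF i] mult_left_le_one_le)
          qed
          then show ?thesis using st by linarith
        qed
        have "(\<Sum>i=1..n. complex_of_real (e i) *\<^sub>C g i (Complex 0 s))
            = (\<Sum>k<m. (of_real (sqrt (u k)) * (\<Sum>i=1..n. w k i * b i)) *\<^sub>C f k (Complex 0 s))"
          unfolding g_def complex_vector.scale_sum_right sum_distrib_left complex_vector.scale_sum_left
          by (subst sum.swap, intro sum.cong refl) (simp add: b_def scaleC_scaleC mult_ac)
        then have "nrm F0 (\<Sum>i=1..n. complex_of_real (e i) *\<^sub>C g i (Complex 0 s))
            \<le> (\<Sum>k<m. nrm F0 ((of_real (sqrt (u k)) * (\<Sum>i=1..n. w k i * b i)) *\<^sub>C f k (Complex 0 s)))"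
          using f0(1) by (simp only:) (intro N0.nrm_sum N0.scale_car, simp)
        also have "\<dots> \<le> (\<Sum>k<m. sqrt (u k) * cmod (\<Sum>i=1..n. w k i * b i) * B)"
        proof (rule sum_mono)
          fix k assume "k \<in> {..<m}"
          then have k: "k < m" by simp
          have "nrm F0 ((of_real (sqrt (u k)) * (\<Sum>i=1..n. w k i * b i)) *\<^sub>C f k (Complex 0 s))
              = sqrt (u k) * cmod (\<Sum>i=1..n. w k i * b i) * nrm F0 (f k (Complex 0 s))"
            using u[OF k] by (simp add: N0.nrm_scale[OF f0(1)[OF k]] norm_mult)
          also have "\<dots> \<le> sqrt (u k) * cmod (\<Sum>i=1..n. w k i * b i) * B"
            using u[OF k] by (intro mult_left_mono f0(2)[OF k]) simp
          finally show "nrm F0 ((of_real (sqrt (u k)) * (\<Sum>i=1..n. w k i * b i)) *\<^sub>C f k (Complex 0 s))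
              \<le> sqrt (u k) * cmod (\<Sum>i=1..n. w k i * b i) * B" .
        qed
        also have "\<dots> = (\<Sum>k<m. sqrt (u k) * cmod (\<Sum>i=1..n. w k i * b i)) * B"
          by (simp add: sum_distrib_right)
        also have "\<dots> \<le> (sqrt 2 * sqrt (96\<^sup>2 * 2)) * B"
        proof (intro mult_right_mono sum_mult_le_sqrt)
          have "(\<Sum>k<m. (sqrt (u k))\<^sup>2) = (\<Sum>k<m. u k)" using u by (intro sum.cong) (auto simp: less_imp_le)
          then show "(\<Sum>k<m. (sqrt (u k))\<^sup>2) \<le> 2" using su by simp
          show "(\<Sum>k<m. (cmod (\<Sum>i=1..n. w k i * b i))\<^sup>2) \<le> 96\<^sup>2 * 2"
            by (rule order_trans[OF w mult_left_mono[OF bb]]) simp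
        qed (use B in simp)
        also have "\<dots> = K" 
        proof -
          have "sqrt (96\<^sup>2 * 2) = 96 * sqrt 2" by (simp only: real_sqrt_mult real_sqrt_abs)
          then show ?thesis by (simp add: K_def)
        qed
        finally show ?thesis .
      qed
      have Q_bound: "(rademacher_average F1 n (\<lambda>i. g i (Complex 1 s)))\<^sup>2 \<le> Q" for s
      proof -
        have "(rademacher_average F1 n (\<lambda>i. \<Sum>k<m. (w k i * E i (Complex 1 s)) *\<^sub>C (of_real (sqrt (u k)) *\<^sub>C f k (Complex 1 s))))\<^sup>2
            \<le> C1 * 96\<^sup>2 * (\<Sum>k<m. (nrm F1 (of_real (sqrt (u k)) *\<^sub>C f k (Complex 1 s)))\<^sup>2)"
        proof (rule C1_bound[rule_format, OF m])
          show "of_real (sqrt (u k)) *\<^sub>C f k (Complex 1 s) \<in> car F1" if "k < m" for k using f1(1)[OF that] by simp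
          show "l2_bounded {..<m} {1..n} 96 (\<lambda>k i. w k i * E i (Complex 1 s))"
            unfolding l2_bounded_def
          proof
            show "(\<Sum>k<m. (cmod (\<Sum>i=1..n. w k i * E i (Complex 1 s) * b i))\<^sup>2) \<le> 96\<^sup>2 * (\<Sum>i=1..n. (cmod (b i))\<^sup>2)" for b
              using w[of "\<lambda>i. E i (Complex 1 s) * b i"] by (simp add: mult.assoc norm_mult E1)
          qed
        qed simp
        also have "(\<Sum>k<m. (nrm F1 (of_real (sqrt (u k)) *\<^sub>C f k (Complex 1 s)))\<^sup>2) \<le> (\<Sum>k<m. u k * B\<^sup>2)"
        proof (rule sum_mono)
          fix k assume "k \<in> {..<m}"
          then have k: "k < m" by simp
          have "(nrm F1 (of_real (sqrt (u k)) *\<^sub>C f k (Complex 1 s)))\<^sup>2 = u k * (nrm F1 (f k (Complex 1 s)))\<^sup>2"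
            using u[OF k] by (simp add: N1.nrm_scale[OF f1(1)[OF k]] power_mult_distrib)
          also have "\<dots> \<le> u k * B\<^sup>2"
            using u[OF k] f1[OF k] by (intro mult_left_mono power_mono N1.nrm_ge_0) auto
          finally show "(nrm F1 (of_real (sqrt (u k)) *\<^sub>C f k (Complex 1 s)))\<^sup>2 \<le> u k * B\<^sup>2" .
        qed
        also have "(\<Sum>k<m. u k * B\<^sup>2) \<le> 2 * B\<^sup>2"
          unfolding sum_distrib_right[symmetric] using su by (intro mult_right_mono) auto
        finally have "(rademacher_average F1 n (\<lambda>i. \<Sum>k<m. (w k i * E i (Complex 1 s)) *\<^sub>C (of_real (sqrt (u k)) *\<^sub>C f k (Complex 1 s))))\<^sup>2 \<le> Q"
          using C1 by (simp add: Q_def mult_left_mono)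
        moreover have "(\<lambda>i. \<Sum>k<m. (w k i * E i (Complex 1 s)) *\<^sub>C (of_real (sqrt (u k)) *\<^sub>C f k (Complex 1 s))) = (\<lambda>i. g i (Complex 1 s))"
          unfolding g_def by (intro ext sum.cong refl) (simp add: scaleC_scaleC mult_ac)
        ultimately show ?thesis by simp
      qed
      have K': "\<forall>e s. (\<forall>i\<in>{1..n}. \<bar>e i\<bar> \<le> 1) \<longrightarrow>
          nrm F0 (\<Sum>i=1..n. complex_of_real (e i) *\<^sub>C g i (Complex 0 s)) \<le> K"
        using K by blast
      obtain J :: "int set" and c s :: "int \<Rightarrow> real" where J: "finite J" "\<forall>j. 0 \<le> c j" "(\<Sum>j\<in>J. c j) \<le> 20"
        "\<forall>e. (\<forall>i\<in>{1..n}. \<bar>e i\<bar> \<le> 1) \<longrightarrow> (nrm F (\<Sum>i=1..n. complex_of_real (e i) *\<^sub>C g i (of_real \<theta>)))\<^sup>2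
          \<le> K\<^sup>2 + 21 + (\<Sum>j\<in>J. c j * (nrm F1 (\<Sum>i=1..n. complex_of_real (e i) *\<^sub>C g i (Complex 1 (s j))))\<^sup>2)"
        using interpolation_average_bound[where g = g, OF \<theta> F finite_atLeastAtMost gC K'] by (elim exE conjE) (rule that)
      define V where "V j i = g i (Complex 1 (s j))" for j i
      have "(nrm F (rademacher_comb n (\<lambda>i. \<Sum>k<m. x k i *\<^sub>C y k) r))\<^sup>2
          \<le> (K\<^sup>2 + 21) + (\<Sum>j\<in>J. c j * (nrm F1 (rademacher_comb n (V j) r))\<^sup>2)" for r
      proof -
        have "rademacher_comb n (\<lambda>i. \<Sum>k<m. x k i *\<^sub>C y k) r = (\<Sum>i=1..n. complex_of_real (rademacher i r) *\<^sub>C g i (of_real \<theta>))"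
          unfolding rademacher_comb_def by (intro sum.cong refl) (simp add: g\<theta>)
        then show ?thesis
          using J(4)[rule_format, of "\<lambda>i. rademacher i r", OF abs_rademacher_le_1]
          unfolding rademacher_comb_def V_def by (simp only:)
      qed
      then have "(rademacher_average F n (\<lambda>i. \<Sum>k<m. x k i *\<^sub>C y k))\<^sup>2
          \<le> (K\<^sup>2 + 21) + (\<Sum>j\<in>J. c j * (rademacher_average F1 n (V j))\<^sup>2)"
        by (rule rademacher_average_sq_le)
      also have "\<dots> \<le> (K\<^sup>2 + 21) + (\<Sum>j\<in>J. c j * Q)"
        using Q_bound J(2) by (intro add_left_mono sum_mono mult_left_mono) (auto simp: V_def[abs_def])
      also have "\<dots> \<le> (K\<^sup>2 + 21) + 20 * Q"
        unfolding sum_distrib_right[symmetric] using J(3) Q by (intro add_left_mono mult_right_mono) auto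
      finally show ?thesis by (simp add: C_def)
    qed
  qed
qed

end

section \<open>Operators on the space of summable sequences\<close>


lemma normed_space_ell1: "normed_space ell1"
proof -
  have add: "summable (\<lambda>k. cmod (x k + y k))" "(\<Sum>k. cmod (x k + y k)) \<le> (\<Sum>k. cmod (x k)) + (\<Sum>k. cmod (y k))"
    if "summable (\<lambda>k. cmod (x k))" "summable (\<lambda>k. cmod (y k))" for x y :: "nat \<Rightarrow> complex"
  proof -
    have s: "summable (\<lambda>k. cmod (x k) + cmod (y k))" by (rule summable_add[OF that])
    show 1: "summable (\<lambda>k. cmod (x k + y k))"
      by (rule summable_comparison_test'[OF s]) (simp add: norm_triangle_ineq)
    have "(\<Sum>k. cmod (x k + y k)) \<le> (\<Sum>k. cmod (x k) + cmod (y k))"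
      by (rule suminf_le[OF _ 1 s]) (rule norm_triangle_ineq)
    then show "(\<Sum>k. cmod (x k + y k)) \<le> (\<Sum>k. cmod (x k)) + (\<Sum>k. cmod (y k))"
      by (simp add: suminf_add[OF that])
  qed
  have scale: "summable (\<lambda>k. cmod (c * x k))" "(\<Sum>k. cmod (c * x k)) = cmod c * (\<Sum>k. cmod (x k))"
    if "summable (\<lambda>k. cmod (x k))" for c and x :: "nat \<Rightarrow> complex"
    using that by (simp_all add: norm_mult summable_mult suminf_mult)
  have "complex_vector.subspace (car ell1)"
    unfolding complex_vector.subspace_def
    by (auto simp: ell1_def scaleC_fun_def scaleC_complex_def add(1) scale(1))
  moreover have "x = 0" if "summable (\<lambda>k. cmod (x k))" "(\<Sum>k. cmod (x k)) = 0" for x :: "nat \<Rightarrow> complex"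
    using suminf_eq_zero_iff[OF that(1)] that(2) by (simp add: fun_eq_iff)
  ultimately show ?thesis
    by (auto simp: normed_space_def ell1_def scaleC_fun_def scaleC_complex_def add(2) scale(2))
qed

interpretation ell1: normed_carrier ell1
  by unfold_locales (rule normed_space_ell1)

definition unit_seq :: "nat \<Rightarrow> nat \<Rightarrow> complex" where
  "unit_seq k = (\<lambda>l. if l = k then 1 else 0)"

lemma unit_seq_ell1: "unit_seq k \<in> car ell1" "nrm ell1 (unit_seq k) = 1"
proof -
  have "(\<lambda>l. cmod (unit_seq k l)) sums 1"
    using sums_single[of k "\<lambda>_. 1 :: real"] by (simp add: unit_seq_def if_distrib[of cmod] cong: if_cong)
  then show "unit_seq k \<in> car ell1" "nrm ell1 (unit_seq k) = 1"
    by (auto simp: ell1_def sums_iff)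
qed

definition truncate :: "nat \<Rightarrow> (nat \<Rightarrow> complex) \<Rightarrow> nat \<Rightarrow> complex" where
  "truncate m x = (\<Sum>k<m. x k *\<^sub>C unit_seq k)"

lemma truncate_apply: "truncate m x l = (if l < m then x l else 0)"
proof -
  have "truncate m x l = (\<Sum>k<m. (x k *\<^sub>C unit_seq k) l)"
    unfolding truncate_def by (induction m) auto
  also have "\<dots> = (\<Sum>k<m. if k = l then x l else 0)"
    by (intro sum.cong refl) (auto simp: scaleC_fun_def scaleC_complex_def unit_seq_def)
  finally show ?thesis by simp
qed

lemma truncate_ell1: "truncate m x \<in> car ell1"
  unfolding truncate_def by (intro ell1.sum_car ell1.scale_car unit_seq_ell1)

lemma truncate_tendsto:
  assumes "x \<in> car ell1"
  shows "(\<lambda>m. nrm ell1 (x - truncate m x)) \<longlonglongrightarrow> 0"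
proof -
  have s: "summable (\<lambda>k. cmod (x k))" using assms by (simp add: ell1_def)
  have "nrm ell1 (x - truncate m x) = (\<Sum>k. cmod (x (k + m)))" for m
  proof -
    have s': "summable (\<lambda>k. cmod ((x - truncate m x) k))"
      using ell1.diff_car[OF assms truncate_ell1[of m x]] by (simp add: ell1_def)
    have "nrm ell1 (x - truncate m x) = (\<Sum>k. cmod ((x - truncate m x) k))" by (simp add: ell1_def)
    also have "\<dots> = (\<Sum>k. cmod ((x - truncate m x) (k + m))) + (\<Sum>k<m. cmod ((x - truncate m x) k))"
      by (rule suminf_split_initial_segment[OF s'])
    finally show ?thesis by (simp add: truncate_apply)
  qed
  moreover have "(\<lambda>m. \<Sum>k. cmod (x (k + m))) \<longlonglongrightarrow> 0"
    by (rule suminf_exist_split2[OF s])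
  ultimately show ?thesis by simp
qed

text \<open>
  The supremum that defines the operator norm bounds the values on the unit ball only because \<open>\<phi>\<close> is bounded there.
\<close>

lemma dual_ball_bound:
  assumes \<phi>: "\<phi> \<in> dual_ball E" and x: "x \<in> car E" and E: "normed_space E"
  shows "cmod (\<phi> x) \<le> nrm E x"
proof -
  interpret normed_carrier E by unfold_locales (rule E)
  have sc: "\<And>c x. x \<in> car E \<Longrightarrow> \<phi> (c *\<^sub>C x) = c *\<^sub>C \<phi> x"
    using \<phi> by (auto simp: dual_ball_def bounded_operators_def)
  obtain C where "\<forall>x\<in>car E. cmod (\<phi> x) \<le> C * nrm E x"
    using \<phi> by (auto simp: dual_ball_def bounded_operators_def scalars_def)
  then have C: "\<And>x. x \<in> car E \<Longrightarrow> cmod (\<phi> x) \<le> C * nrm E x" by blast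
  have le1: "cmod (\<phi> z) \<le> 1" if z: "z \<in> car E" "nrm E z \<le> 1" for z
  proof -
    have "bdd_above ((\<lambda>x. nrm scalars (\<phi> x)) ` {x \<in> car E. nrm E x \<le> 1})"
    proof (rule bdd_aboveI2)
      fix x assume "x \<in> {x \<in> car E. nrm E x \<le> 1}"
      then have "x \<in> car E" "nrm E x \<le> 1" by auto
      then have "C * nrm E x \<le> \<bar>C\<bar> * 1" by (intro mult_mono) auto
      then show "nrm scalars (\<phi> x) \<le> \<bar>C\<bar>" using C[OF \<open>x \<in> car E\<close>] by (simp add: scalars_def)
    qed
    then have "nrm scalars (\<phi> z) \<le> operator_norm E scalars \<phi>"
      unfolding operator_norm_def using z by (intro cSUP_upper) auto
    then show ?thesis using \<phi> by (simp add: dual_ball_def scalars_def)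
  qed
  show ?thesis
  proof (cases "nrm E x = 0")
    case True
    then show ?thesis using C[OF x] by simp
  next
    case False
    then have N: "nrm E x > 0" using nrm_ge_0[OF x] by linarith
    have "cmod (\<phi> (of_real (inverse (nrm E x)) *\<^sub>C x)) \<le> 1"
      using x N by (intro le1) (simp_all add: nrm_scale norm_inverse)
    then have "inverse (nrm E x) * cmod (\<phi> x) \<le> 1"
      by (simp only: sc[OF x] scaleC_complex_def norm_mult norm_of_real abs_of_pos positive_imp_inverse_positive[OF N])
    then show ?thesis using N by (simp add: field_simps)
  qed
qed

lemma weak_norm_upper:
  assumes E: "normed_space E" and p: "p > 0" and x: "\<And>i. i \<in> {1..n} \<Longrightarrow> x i \<in> car E" and \<phi>: "\<phi> \<in> dual_ball E"
  shows "(\<Sum>i=1..n. cmod (\<phi> (x i)) powr p) powr (1 / p) \<le> weak_norm p E n x"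
  unfolding weak_norm_def
proof (rule cSUP_upper[OF \<phi>])
  show "bdd_above ((\<lambda>\<phi>. (\<Sum>i=1..n. cmod (\<phi> (x i)) powr p) powr (1 / p)) ` dual_ball E)"
  proof (rule bdd_aboveI2)
    fix \<psi> assume "\<psi> \<in> dual_ball E"
    then have "cmod (\<psi> (x i)) powr p \<le> nrm E (x i) powr p" if "i \<in> {1..n}" for i
      using dual_ball_bound[OF _ x[OF that] E] p by (intro powr_mono2) auto
    then have "(\<Sum>i=1..n. cmod (\<psi> (x i)) powr p) \<le> (\<Sum>i=1..n. nrm E (x i) powr p)"
      by (rule sum_mono)
    then show "(\<Sum>i=1..n. cmod (\<psi> (x i)) powr p) powr (1 / p) \<le> (\<Sum>i=1..n. nrm E (x i) powr p) powr (1 / p)"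
      using p by (intro powr_mono2) (auto intro: sum_nonneg)
  qed
qed

definition coordinate_functional :: "nat \<Rightarrow> (nat \<Rightarrow> complex) \<Rightarrow> (nat \<Rightarrow> complex) \<Rightarrow> complex" where
  "coordinate_functional m s = restrict (\<lambda>x. \<Sum>k<m. s k * x k) (car ell1)"

lemma coordinate_functional_dual_ball:
  assumes s: "\<And>k. k < m \<Longrightarrow> cmod (s k) \<le> 1"
  shows "coordinate_functional m s \<in> dual_ball ell1"
proof -
  let ?\<phi> = "coordinate_functional m s"
  have bound: "cmod (?\<phi> x) \<le> nrm ell1 x" if x: "x \<in> car ell1" for x
  proof -
    have "cmod (?\<phi> x) \<le> (\<Sum>k<m. cmod (x k))"
      unfolding coordinate_functional_def restrict_apply'[OF x]
      by (rule sum_norm_le) (use s in \<open>simp add: norm_mult mult_left_le_one_le\<close>)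
    also have "\<dots> \<le> nrm ell1 x"
      using x by (auto simp: ell1_def intro: sum_le_suminf)
    finally show ?thesis .
  qed
  have "?\<phi> \<in> bounded_operators ell1 scalars"
    unfolding bounded_operators_def
  proof (intro CollectI conjI ballI allI)
    show "?\<phi> \<in> car ell1 \<rightarrow>\<^sub>E car scalars"
      by (auto simp: coordinate_functional_def scalars_def)
    show "?\<phi> (x + y) = ?\<phi> x + ?\<phi> y" if "x \<in> car ell1" "y \<in> car ell1" for x y
      using that by (simp add: coordinate_functional_def distrib_left sum.distrib)
    show "?\<phi> (c *\<^sub>C x) = c *\<^sub>C ?\<phi> x" if "x \<in> car ell1" for c x
      using that by (simp add: coordinate_functional_def) (simp add: scaleC_fun_def scaleC_complex_def sum_distrib_left mult_ac)
    show "\<exists>C. \<forall>x\<in>car ell1. nrm scalars (?\<phi> x) \<le> C * nrm ell1 x"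
      using bound by (intro exI[of _ 1]) (simp add: scalars_def)
  qed
  moreover have "operator_norm ell1 scalars ?\<phi> \<le> 1"
    unfolding operator_norm_def
  proof (rule cSUP_least)
    show "{x \<in> car ell1. nrm ell1 x \<le> 1} \<noteq> {}" using ell1.zero_car ell1.nrm_0 by force
    show "nrm scalars (?\<phi> x) \<le> 1" if "x \<in> {x \<in> car ell1. nrm ell1 x \<le> 1}" for x
      using that bound[of x] by (simp add: scalars_def)
  qed
  ultimately show ?thesis by (simp add: dual_ball_def)
qed

lemma holder_normalized:
  fixes a b :: "'i \<Rightarrow> real"
  assumes pq: "p > 1" "q > 1" "1 / p + 1 / q = 1" and nn: "\<And>i. 0 \<le> a i" "\<And>i. 0 \<le> b i"
    and a: "(\<Sum>i\<in>I. a i powr p) \<le> 1" and b: "(\<Sum>i\<in>I. b i powr q) \<le> 1"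
  shows "(\<Sum>i\<in>I. a i * b i) \<le> 1"
proof -
  have "(\<Sum>i\<in>I. a i * b i) \<le> (\<Sum>i\<in>I. a i powr p / p + b i powr q / q)"
    using pq nn by (intro sum_mono Youngs_inequality) auto
  also have "\<dots> = (\<Sum>i\<in>I. a i powr p) / p + (\<Sum>i\<in>I. b i powr q) / q"
    by (simp add: sum.distrib sum_divide_distrib)
  also have "\<dots> \<le> 1 / p + 1 / q"
    using pq a b by (intro add_mono divide_right_mono) auto
  finally show ?thesis using pq by simp
qed

text \<open>
  Sequences \<open>s\<close> in the unit ball of \<open>\<ell>\<^sub>\<infinity>\<close> are functionals in the unit ball of the dual of \<open>\<ell>\<^sub>1\<close>; the sum
  over \<open>i\<close> is estimated by the inequality of Hoelder.
\<close>

lemma weak_norm_scalar_bound: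
  assumes pq: "p > 1" "q > 1" "1 / p + 1 / q = 1"
    and x: "\<And>i. i \<in> {1..n} \<Longrightarrow> x i \<in> car ell1" and \<sigma>: "\<sigma> > 0" "weak_norm p ell1 n x \<le> \<sigma>"
  shows "scalar_bound {..<m} {1..n} q (\<lambda>k i. x i k / of_real \<sigma>)"
  unfolding scalar_bound_def
proof (intro allI impI)
  fix s b :: "nat \<Rightarrow> complex"
  assume s: "\<forall>k\<in>{..<m}. cmod (s k) \<le> 1" and b: "(\<Sum>i=1..n. cmod (b i) powr q) \<le> 1"
  define \<phi> where "\<phi> = coordinate_functional m s"
  have \<phi>x: "\<phi> (x i) = (\<Sum>k<m. s k * x i k)" if "i \<in> {1..n}" for i
    using x[OF that] by (simp add: \<phi>_def coordinate_functional_def)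
  have "(\<Sum>i=1..n. cmod (\<phi> (x i)) powr p) powr (1 / p) \<le> weak_norm p ell1 n x"
    unfolding \<phi>_def using pq x s by (intro weak_norm_upper normed_space_ell1 coordinate_functional_dual_ball) auto
  then have "(\<Sum>i=1..n. cmod (\<phi> (x i)) powr p) powr (1 / p) \<le> \<sigma>"
    using \<sigma>(2) by (rule order_trans)
  then have "((\<Sum>i=1..n. cmod (\<phi> (x i)) powr p) powr (1 / p)) powr p \<le> \<sigma> powr p"
    using pq by (intro powr_mono2) auto
  then have "(\<Sum>i=1..n. cmod (\<phi> (x i)) powr p) \<le> \<sigma> powr p"
    using pq by (simp add: powr_powr sum_nonneg)
  then have a: "(\<Sum>i=1..n. (cmod (\<phi> (x i)) / \<sigma>) powr p) \<le> 1"
    using \<sigma>(1) by (simp add: powr_divide flip: sum_divide_distrib)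
  have "(\<Sum>k<m. \<Sum>i=1..n. x i k / of_real \<sigma> * (s k * b i)) = (\<Sum>i=1..n. \<phi> (x i) / of_real \<sigma> * b i)"
    by (subst sum.swap, intro sum.cong refl) (simp add: \<phi>x sum_divide_distrib sum_distrib_left sum_distrib_right mult_ac)
  also have "cmod \<dots> \<le> (\<Sum>i=1..n. cmod (\<phi> (x i)) / \<sigma> * cmod (b i))"
    using \<sigma>(1) by (intro sum_norm_le) (simp add: norm_mult norm_divide)
  also have "\<dots> \<le> 1"
    using \<sigma>(1) by (intro holder_normalized[OF pq _ _ a b]) auto
  finally show "cmod (\<Sum>k<m. \<Sum>i=1..n. x i k / of_real \<sigma> * (s k * b i)) \<le> 1" .
qed

lemma (in normed_carrier) rademacher_average_perturb:
  assumes v: "\<And>i. i \<in> {1..n} \<Longrightarrow> v i \<in> car E" and w: "\<And>i. i \<in> {1..n} \<Longrightarrow> w i \<in> car E"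
    and d: "(\<Sum>i=1..n. nrm E (v i - w i)) \<le> \<delta>"
  shows "(rademacher_average E n v)\<^sup>2 \<le> 2 * (rademacher_average E n w)\<^sup>2 + 2 * \<delta>\<^sup>2"
proof -
  let ?R = "rademacher_comb n"
  have Rc: "?R v t \<in> car E" "?R w t \<in> car E" for t
    unfolding rademacher_comb_def using v w by (auto intro: sum_car)
  have "(nrm E (?R v t))\<^sup>2 \<le> 2 * \<delta>\<^sup>2 + (\<Sum>j\<in>{()}. 2 * (nrm E (?R w t))\<^sup>2)" for t
  proof -
    have "?R v t - ?R w t = (\<Sum>i=1..n. of_real (rademacher i t) *\<^sub>C (v i - w i))"
      by (simp add: rademacher_comb_def complex_vector.scale_right_diff_distrib sum_subtractf)
    then have "nrm E (?R v t - ?R w t) \<le> (\<Sum>i=1..n. nrm E (v i - w i))"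
      by (simp only:) (intro nrm_sum_signs diff_car v w abs_rademacher_le_1)
    then have "nrm E (?R v t) \<le> nrm E (?R w t) + \<delta>"
      using nrm_le_add_diff[OF Rc, of t t] d by linarith
    then have "(nrm E (?R v t))\<^sup>2 \<le> (nrm E (?R w t) + \<delta>)\<^sup>2"
      using Rc by (intro power_mono) auto
    moreover have "(nrm E (?R w t) + \<delta>)\<^sup>2 + (nrm E (?R w t) - \<delta>)\<^sup>2 = 2 * (nrm E (?R w t))\<^sup>2 + 2 * \<delta>\<^sup>2"
      by (simp add: power2_eq_square algebra_simps)
    moreover have "(nrm E (?R w t) - \<delta>)\<^sup>2 \<ge> 0" by simp
    ultimately have "(nrm E (?R v t))\<^sup>2 \<le> 2 * (nrm E (?R w t))\<^sup>2 + 2 * \<delta>\<^sup>2" by linarith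
    then show ?thesis by simp
  qed
  from rademacher_average_sq_le[OF this] show ?thesis by simp
qed

lemma bounded_operator_sum:
  assumes T: "T \<in> bounded_operators E F" and E: "normed_space E" and x: "\<And>k. k < m \<Longrightarrow> x k \<in> car E"
  shows "T (\<Sum>k<m. c k *\<^sub>C x k) = (\<Sum>k<(m::nat). c k *\<^sub>C T (x k))"
proof -
  interpret normed_carrier E by unfold_locales (rule E)
  have add: "\<And>x y. x \<in> car E \<Longrightarrow> y \<in> car E \<Longrightarrow> T (x + y) = T x + T y"
    and scale: "\<And>c x. x \<in> car E \<Longrightarrow> T (c *\<^sub>C x) = c *\<^sub>C T x"
    using T by (auto simp: bounded_operators_def)
  show ?thesis
    using x
  proof (induction m)
    case 0
    have "T (0 *\<^sub>C 0) = 0 *\<^sub>C T 0" by (rule scale) simp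
    then show ?case by simp
  next
    case (Suc m)
    have "(\<Sum>k<m. c k *\<^sub>C x k) \<in> car E" using Suc.prems by (intro sum_car scale_car) simp
    then show ?case using Suc by (simp add: add scale)
  qed
qed

text \<open>
  Normalise by any \<open>\<sigma> > 0\<close> above the weak norm and cut off all \<open>x\<^sub>i\<close> at an index \<open>m\<close> where the
  error, after applying \<open>T\<close>, is at most \<open>\<sigma>\<close>; this costs a constant factor.  The number \<open>\<sigma>\<close> is kept separate from the weak norm
  because the latter may be zero.
\<close>

theorem bounded_operator_rademacher_summing:
  fixes F :: "'v::complex_vector normed"
  assumes \<theta>: "0 < \<theta>" "\<theta> < 1" and pq: "p > 1" "2 / \<theta> > 1" "1 / p + 1 / (2 / \<theta>) = 1"
    and F: "theta_type_2 \<theta> F" and T: "T \<in> bounded_operators ell1 F"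
  shows "T \<in> rademacher_summing p ell1 F"
proof -
  obtain F0 F1 where couple: "interpolation_couple F0 F1" and type: "type_2 F1"
    and carF: "car F = car (complex_interpolation F0 F1 \<theta>)"
    and nrmF: "\<forall>x\<in>car F. nrm F x = nrm (complex_interpolation F0 F1 \<theta>) x"
    using F by (auto simp: theta_type_2_def)
  have nF: "normed_space F" using F by (simp add: theta_type_2_def banach_space_def)
  interpret couple F0 F1 by unfold_locales (rule couple)
  interpret NF: normed_carrier F by unfold_locales (rule nF)
  obtain M0 where M0: "\<forall>x\<in>car ell1. nrm F (T x) \<le> M0 * nrm ell1 x"
    using T by (auto simp: bounded_operators_def)
  define M where "M = \<bar>M0\<bar> + 1"
  have M: "M > 0" by (simp add: M_def add_nonneg_pos)
  have TM: "nrm F (T x) \<le> M * nrm ell1 x" if "x \<in> car ell1" for x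
  proof -
    have "M0 * nrm ell1 x \<le> M * nrm ell1 x"
      using ell1.nrm_ge_0[OF that] by (intro mult_right_mono) (auto simp: M_def)
    then show ?thesis using M0 that by (meson order_trans)
  qed
  have Tcar: "T x \<in> car F" if "x \<in> car ell1" for x
    using T that by (auto simp: bounded_operators_def)
  have Tdiff: "T (x - y) = T x - T y" if "x \<in> car ell1" "y \<in> car ell1" for x y
  proof -
    have "T ((x - y) + y) = T (x - y) + T y"
      using T that ell1.diff_car[OF that] unfolding bounded_operators_def by blast
    then show ?thesis by simp
  qed
  obtain C where C0: "C > 0" and C: "\<forall>(m::nat) n x y. m > 0 \<longrightarrow> (\<forall>k<m. y k \<in> car F \<and> nrm F (y k) < M + 1) \<longrightarrow> scalar_bound {..<m} {1..n} (2 / \<theta>) x \<longrightarrow>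
      (rademacher_average F n (\<lambda>i. \<Sum>k<m. x k i *\<^sub>C y k))\<^sup>2 \<le> C"
    using finitely_supported_bound[OF \<theta> nF carF nrmF type add_pos_pos[OF M zero_less_one]]
    by (elim exE conjE) (rule that)
  define c where "c = sqrt (2 * C + 2)"
  have c: "c > 0" using C0 by (simp add: c_def)
  have main: "rademacher_average F n (\<lambda>i. T (x i)) \<le> c * \<sigma>"
    if x: "\<And>i. i \<in> {1..n} \<Longrightarrow> x i \<in> car ell1" and \<sigma>: "\<sigma> > 0" "weak_norm p ell1 n x \<le> \<sigma>" for n x \<sigma>
  proof -
    have "(\<lambda>m. \<Sum>i=1..n. nrm ell1 (x i - truncate m (x i))) \<longlonglongrightarrow> (\<Sum>i=1..n. 0)"
      by (intro tendsto_sum truncate_tendsto x)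
    then have "\<forall>\<^sub>F m in sequentially. (\<Sum>i=1..n. nrm ell1 (x i - truncate m (x i))) < \<sigma> / M"
      by (rule order_tendstoD(2)) (use \<sigma> M in simp)
    then obtain m0 where m0: "\<And>m. m \<ge> m0 \<Longrightarrow> (\<Sum>i=1..n. nrm ell1 (x i - truncate m (x i))) < \<sigma> / M"
      by (auto simp: eventually_sequentially)
    \<comment> \<open>The successor makes \<open>m\<close> positive.\<close>
    define m where "m = Suc m0"
    have close: "(\<Sum>i=1..n. nrm F (T (x i) - T (truncate m (x i)))) \<le> \<sigma>"
    proof -
      have "(\<Sum>i=1..n. nrm F (T (x i) - T (truncate m (x i)))) \<le> (\<Sum>i=1..n. M * nrm ell1 (x i - truncate m (x i)))"
      proof (rule sum_mono)
        fix i assume i: "i \<in> {1..n}"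
        show "nrm F (T (x i) - T (truncate m (x i))) \<le> M * nrm ell1 (x i - truncate m (x i))"
          using TM[OF ell1.diff_car[OF x[OF i] truncate_ell1[of m "x i"]]] Tdiff[OF x[OF i] truncate_ell1[of m "x i"]] by simp
      qed
      also have "\<dots> \<le> M * (\<sigma> / M)"
        unfolding sum_distrib_left[symmetric] using m0[of m] M by (intro mult_left_mono) (auto simp: m_def)
      finally show ?thesis using M by simp
    qed
    define z where "z i = (\<Sum>k<m. (x i k / of_real \<sigma>) *\<^sub>C T (unit_seq k))" for i
    have Tt: "T (truncate m (x i)) = of_real \<sigma> *\<^sub>C z i" for i
      unfolding truncate_def bounded_operator_sum[OF T normed_space_ell1 unit_seq_ell1(1)] z_def complex_vector.scale_sum_right
      using \<sigma>(1) by (intro sum.cong refl) (simp add: scaleC_scaleC)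
    have zc: "z i \<in> car F" for i
      unfolding z_def using Tcar unit_seq_ell1(1) by (auto intro: NF.sum_car)
    have "(rademacher_average F n z)\<^sup>2 \<le> C"
      unfolding z_def[abs_def]
    proof (rule C[rule_format])
      show "m > 0" by (simp add: m_def)
      show "T (unit_seq k) \<in> car F \<and> nrm F (T (unit_seq k)) < M + 1" for k
        using Tcar[OF unit_seq_ell1(1)] TM[OF unit_seq_ell1(1)[of k]] by (simp add: unit_seq_ell1)
      show "scalar_bound {..<m} {1..n} (2 / \<theta>) (\<lambda>k i. x i k / of_real \<sigma>)"
        by (rule weak_norm_scalar_bound[OF pq x \<sigma>])
    qed
    moreover have "(rademacher_average F n (\<lambda>i. T (truncate m (x i))))\<^sup>2 = \<sigma>\<^sup>2 * (rademacher_average F n z)\<^sup>2"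
    proof -
      have "(\<Sum>i=1..n. of_real (rademacher i t) *\<^sub>C of_real \<sigma> *\<^sub>C z i) = of_real \<sigma> *\<^sub>C (\<Sum>i=1..n. of_real (rademacher i t) *\<^sub>C z i)" for t
        unfolding complex_vector.scale_sum_right by (intro sum.cong refl) (simp add: scaleC_scaleC mult.commute)
      moreover have "(\<Sum>i=1..n. of_real (rademacher i t) *\<^sub>C z i) \<in> car F" for t
        using zc by (auto intro: NF.sum_car)
      ultimately show ?thesis
        unfolding rademacher_average_sq(1) rademacher_comb_def Tt by (simp add: NF.nrm_scale power_mult_distrib)
    qed
    ultimately have tr: "(rademacher_average F n (\<lambda>i. T (truncate m (x i))))\<^sup>2 \<le> \<sigma>\<^sup>2 * C"
      by (simp add: mult_left_mono)
    have perturb: "(rademacher_average F n (\<lambda>i. T (x i)))\<^sup>2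
        \<le> 2 * (rademacher_average F n (\<lambda>i. T (truncate m (x i))))\<^sup>2 + 2 * \<sigma>\<^sup>2"
      using x close by (intro NF.rademacher_average_perturb Tcar truncate_ell1) auto
    have "c\<^sup>2 = 2 * C + 2" using C0 by (simp add: c_def)
    then have "(c * \<sigma>)\<^sup>2 = 2 * (\<sigma>\<^sup>2 * C) + 2 * \<sigma>\<^sup>2"
      unfolding power_mult_distrib by (simp add: algebra_simps)
    then have "(rademacher_average F n (\<lambda>i. T (x i)))\<^sup>2 \<le> (c * \<sigma>)\<^sup>2"
      using perturb tr by linarith
    then show ?thesis
      by (rule power2_le_imp_le) (use c \<sigma>(1) in simp)
  qed
  have summing: "rademacher_average F n (\<lambda>i. T (x i)) \<le> c * weak_norm p ell1 n x"
    if x: "\<forall>i\<in>{1..n}. x i \<in> car ell1" for n x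
  proof (rule field_le_epsilon)
    fix e :: real assume e: "e > 0"
    have "0 \<le> (\<Sum>i=1..n. cmod (coordinate_functional 0 (\<lambda>_. 0) (x i)) powr p) powr (1 / p)" by simp
    also have "\<dots> \<le> weak_norm p ell1 n x"
      using pq x by (intro weak_norm_upper normed_space_ell1 coordinate_functional_dual_ball) auto
    finally have pos: "weak_norm p ell1 n x + e / c > 0" using e c by (simp add: add_nonneg_pos)
    have le: "weak_norm p ell1 n x \<le> weak_norm p ell1 n x + e / c" using e c by simp
    from main[OF x[rule_format] pos le]
    show "rademacher_average F n (\<lambda>i. T (x i)) \<le> c * weak_norm p ell1 n x + e"
      using c by (simp add: distrib_left)
  qed
  show ?thesis
    unfolding rademacher_summing_def
    by (rule CollectI, intro conjI T, rule exI[of _ c], intro conjI c allI impI) (rule summing)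
qed

theorem theorem3p1:
  fixes p p' \<theta> :: real and F :: "'v::complex_vector normed"
  assumes "1 < p" and "p < 2"
    and "1 / p + 1 / p' = 1"
    and "\<theta> = 2 / p'"
    and "theta_type_2 \<theta> F"
  shows "bounded_operators ell1 F = rademacher_summing p ell1 F"
proof
  have p': "1 / p' = 1 - 1 / p" "1 / p < 1" "1 / p > 1 / 2"
    using assms(1-3) by (simp_all add: field_simps)
  then have inv: "0 < 1 / p'" "1 / p' < 1 / 2" by linarith+
  then have pp: "p' > 0" by (simp add: zero_less_divide_iff)
  with inv have p'2: "p' > 2" by (simp add: field_simps)
  have \<theta>: "0 < \<theta>" "\<theta> < 1" "2 / \<theta> = p'"
    using assms(4) pp p'2 by simp_all
  show "bounded_operators ell1 F \<subseteq> rademacher_summing p ell1 F"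
    using bounded_operator_rademacher_summing[OF \<theta>(1,2) assms(1) _ _ assms(5)] \<theta>(3) p'2 assms(3) by auto
  show "rademacher_summing p ell1 F \<subseteq> bounded_operators ell1 F"
    by (auto simp: rademacher_summing_def)
qed

end
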